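(* Let $\mathcal{R}=(r_i,\rho_i)_{i\ge 1}$ be a sequence of matching pairs for which there is $r\in[\frac13,\frac35]$ with $\sum_{i=1}^\infty |r-r_i|<\infty$, let $\beta\in(0,\frac13)$ and $\eta\in(0,1]$. Then there exist constants $\tilde c_1,\tilde c_2\in(0,\infty)$, independent of $n$, and a sequence $(\nu_n)_{n\ge1}$ of eigenvalues of $-\Delta_D^{\mu_\eta,\mathcal{R}}$ such that for every $n$ the eigenvalue $\nu_n$ has multiplicity at least $3^n$ and $$\tilde c_1\left(\tfrac3r\right)^n\le\nu_n\le\tilde c_2\left(\tfrac3r\right)^n\quad\text{if }\eta\in(0,1),\qquad \tilde c_1(\beta r)^{-n}\le\nu_n\le\tilde c_2(\beta r)^{-n}\quad\text{if }\eta=1.$$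
   Context: Stretched Sierpinski Gasket. Fix $\alpha\in(0,1)$. Let $p_1,p_2,p_3\in\mathbb{R}^2$ be the vertices of an equilateral triangle of side length 1, $\mathcal{A}=\{1,2,3\}$, $G_i(x)=\frac{1-\alpha}{2}(x-p_i)+p_i$, and for $\{i,j,k\}=\{1,2,3\}$ let $e_i=\{\lambda G_j(p_k)+(1-\lambda)G_k(p_j):\lambda\in(0,1)\}$ (open segment). $K$ is the unique nonempty compact set with $K=G_1(K)\cup G_2(K)\cup G_3(K)\cup e_1\cup e_2\cup e_3$. For $w=w_1\cdots w_m\in\mathcal{A}^m$, $m\in\mathbb{N}_0$, put $|w|=m$, $G_w=G_{w_1}\circ\cdots\circ G_{w_m}$ ($G_w=\mathrm{id}$ for the empty word), $K_w=G_w(K)$, $e_i^w=G_w(e_i)$; $V_0=\{p_1,p_2,p_3\}$. Energy. A matching pair is $(r,\rho)$ with $r,\rho>0$ and $\frac53 r+\rho=1$. For a sequence of matching pairs $\mathcal{R}=(r_i,\rho_i)_{i\ge1}$ put $\delta_m=r_1\cdots r_m$ ($\delta_0=1$), $\gamma_m=r_1\cdots r_{m-1}\rho_m$. For $u:K\to\mathbb{R}$ let $Q_0(u,u)=(u(p_1)-u(p_2))^2+(u(p_2)-u(p_3))^2+(u(p_3)-u(p_1))^2$, $Q_m(u,u)=\sum_{w\in\mathcal{A}^m}Q_0(u\circ G_w,u\circ G_w)$, and $\mathcal{D}^I_k(u,u)=\sum_{w\in\mathcal{A}^{k-1},\,i\in\mathcal{A}}\int_0^1\big(\frac{d(u\circ\xi_{e_i^w})}{dx}\big)^2dx$,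 where $\xi_{e}:(0,1)\to e$ is the affine parametrization of the segment $e$. Define $$\mathcal{E}_{\mathcal{R}}(u,u)=\lim_{m\to\infty}\frac1{\delta_m}Q_m(u,u)+\sum_{k=1}^\infty\frac1{\gamma_k}\mathcal{D}^I_k(u,u)$$ on $\mathcal{D}_{\mathcal{R}}=\{u\in C(K):\ u\circ\xi_{e_i^w}\in H^1(0,1)\text{ for all } i\in\mathcal{A},\,w\in\bigcup_m\mathcal{A}^m,\ \mathcal{E}_{\mathcal{R}}(u,u)<\infty\}$, extended to a bilinear form by polarization. Let $\mathcal{D}_{\mathcal{R}}^0=\{u\in\mathcal{D}_{\mathcal{R}}: u|_{V_0}\equiv0\}$. Measures. $\mu_f$ is the Borel probability measure on $K$ with $\mu_f(K_w)=3^{-|w|}$ for all words $w$. For $\beta\in(0,\frac13)$, $\mu_l$ is the Borel probability measure on $K$ carried by the union of all $e_i^w$ with $\mu_l|_{e_i^w}=a\beta^{|w|}\frac{\lambda^1}{\lambda^1(e_i^w)}$, where $\lambda^1$ is one-dimensional Lebesgue measure (length) and $a=\frac13-\beta$. For $\eta\in(0,1]$, $\mu_\eta=\eta\mu_l+(1-\eta)\mu_f$. Operators. It is known that $(\mathcal{E}_{\mathcal{R}},\mathcal{D}_{\mathcal{R}}^0)$ is a regular Dirichlet form on $L^2(K,\mu_\eta|_{K\setminus V_0})$ whose associated self-adjoint operator $-\Delta_D^{\mu_\eta,\mathcal{R}}$ has discrete nonnegative spectrum. *)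

theory Defs
  imports "HOL-Analysis.Analysis" "HOL-Probability.Probability" "HOL-Library.Extended_Nat"
begin

(* The alphabet {1,2,3} is the numeral type 3 of integers modulo 3, so that the two letters
   other than i are i + 1 and i + 2. Words are lists over this type. *)

section \<open>The stretched Sierpinski gasket\<close>

definition equilateral :: "(3 \<Rightarrow> real^2) \<Rightarrow> bool" where
  "equilateral p \<longleftrightarrow> (\<forall>i j. i \<noteq> j \<longrightarrow> dist (p i) (p j) = 1)"

definition ssg_map :: "real \<Rightarrow> (3 \<Rightarrow> real^2) \<Rightarrow> 3 \<Rightarrow> real^2 \<Rightarrow> real^2" where
  "ssg_map \<alpha> p i x = ((1 - \<alpha>) / 2) *\<^sub>R (x - p i) + p i"

definition ssg_word_map :: "real \<Rightarrow> (3 \<Rightarrow> real^2) \<Rightarrow> 3 list \<Rightarrow> real^2 \<Rightarrow> real^2" where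
  "ssg_word_map \<alpha> p w = foldr (\<lambda>i f. ssg_map \<alpha> p i \<circ> f) w id"

(* Affine parametrization over (0,1) of the image under G_w of the segment opposite to p i. *)
definition edge_param :: "real \<Rightarrow> (3 \<Rightarrow> real^2) \<Rightarrow> 3 list \<Rightarrow> 3 \<Rightarrow> real \<Rightarrow> real^2" where
  "edge_param \<alpha> p w i t = ssg_word_map \<alpha> p w
     (t *\<^sub>R ssg_map \<alpha> p (i + 1) (p (i + 2)) + (1 - t) *\<^sub>R ssg_map \<alpha> p (i + 2) (p (i + 1)))"

definition edge :: "real \<Rightarrow> (3 \<Rightarrow> real^2) \<Rightarrow> 3 list \<Rightarrow> 3 \<Rightarrow> (real^2) set" where
  "edge \<alpha> p w i = edge_param \<alpha> p w i ` {0<..<1}"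

definition is_stretched_gasket :: "real \<Rightarrow> (3 \<Rightarrow> real^2) \<Rightarrow> (real^2) set \<Rightarrow> bool" where
  "is_stretched_gasket \<alpha> p K \<longleftrightarrow> compact K \<and> K \<noteq> {} \<and>
     K = (\<Union>i. ssg_map \<alpha> p i ` K) \<union> (\<Union>i. edge \<alpha> p [] i)"

section \<open>The Sobolev space on the unit interval\<close>

definition L2 :: "'a measure \<Rightarrow> ('a \<Rightarrow> real) set" where
  "L2 M = {f \<in> borel_measurable M. integrable M (\<lambda>x. (f x)\<^sup>2)}"

abbreviation unit_interval_measure :: "real measure" where
  "unit_interval_measure \<equiv> lebesgue_on {0<..<1}"

(* Continuously differentiable functions with compact support in (0,1); these define the same
   weak derivatives as smooth ones. *)
definition test_function :: "(real \<Rightarrow> real) \<Rightarrow> bool" where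
  "test_function \<phi> \<longleftrightarrow> \<phi> C1_differentiable_on UNIV \<and>
     (\<exists>a b. 0 < a \<and> b < 1 \<and> (\<forall>x. x \<notin> {a..b} \<longrightarrow> \<phi> x = 0))"

definition has_weak_derivative :: "(real \<Rightarrow> real) \<Rightarrow> (real \<Rightarrow> real) \<Rightarrow> bool" where
  "has_weak_derivative f g \<longleftrightarrow> (\<forall>\<phi>. test_function \<phi> \<longrightarrow>
     (LINT x|unit_interval_measure. f x * deriv \<phi> x) =
     - (LINT x|unit_interval_measure. g x * \<phi> x))"

definition H1 :: "(real \<Rightarrow> real) set" where
  "H1 = {f \<in> L2 unit_interval_measure. \<exists>g \<in> L2 unit_interval_measure. has_weak_derivative f g}"

(* The choice is unique up to null sets. *)
definition weak_derivative :: "(real \<Rightarrow> real) \<Rightarrow> real \<Rightarrow> real" where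
  "weak_derivative f = (SOME g. g \<in> L2 unit_interval_measure \<and> has_weak_derivative f g)"

section \<open>The energy form\<close>

definition matching_pair :: "real \<Rightarrow> real \<Rightarrow> bool" where
  "matching_pair r \<rho> \<longleftrightarrow> r > 0 \<and> \<rho> > 0 \<and> 5/3 * r + \<rho> = 1"

(* Sequences of matching pairs are indexed from 1; the value at 0 is never used. *)
definition res_delta :: "(nat \<Rightarrow> real) \<Rightarrow> nat \<Rightarrow> real" where
  "res_delta r m = (\<Prod>i=1..m. r i)"

definition res_gamma :: "(nat \<Rightarrow> real) \<Rightarrow> (nat \<Rightarrow> real) \<Rightarrow> nat \<Rightarrow> real" where
  "res_gamma r \<rho> m = (\<Prod>i=1..m-1. r i) * \<rho> m"

definition Q0 :: "(3 \<Rightarrow> real^2) \<Rightarrow> (real^2 \<Rightarrow> real) \<Rightarrow> real" where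
  "Q0 p u = (u (p 1) - u (p 2))\<^sup>2 + (u (p 2) - u (p 3))\<^sup>2 + (u (p 3) - u (p 1))\<^sup>2"

definition Q :: "real \<Rightarrow> (3 \<Rightarrow> real^2) \<Rightarrow> nat \<Rightarrow> (real^2 \<Rightarrow> real) \<Rightarrow> real" where
  "Q \<alpha> p m u = (\<Sum>w | length w = m. Q0 p (u \<circ> ssg_word_map \<alpha> p w))"

definition DI :: "real \<Rightarrow> (3 \<Rightarrow> real^2) \<Rightarrow> nat \<Rightarrow> (real^2 \<Rightarrow> real) \<Rightarrow> real" where
  "DI \<alpha> p k u = (\<Sum>w | length w = k - 1. \<Sum>i\<in>UNIV.
     LINT x|unit_interval_measure. (weak_derivative (u \<circ> edge_param \<alpha> p w i) x)\<^sup>2)"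

definition energy :: "real \<Rightarrow> (3 \<Rightarrow> real^2) \<Rightarrow> (nat \<Rightarrow> real) \<Rightarrow> (nat \<Rightarrow> real)
    \<Rightarrow> (real^2 \<Rightarrow> real) \<Rightarrow> real" where
  "energy \<alpha> p r \<rho> u = lim (\<lambda>m. 1 / res_delta r m * Q \<alpha> p m u)
     + (\<Sum>k. 1 / res_gamma r \<rho> (Suc k) * DI \<alpha> p (Suc k) u)"

(* A function on K is represented by a function on the plane of which only the values on K
   matter. Both parts of the energy are nonnegative, so finite energy means that the limit
   exists in the reals and the series converges. *)
definition energy_domain :: "real \<Rightarrow> (3 \<Rightarrow> real^2) \<Rightarrow> (real^2) set \<Rightarrow> (nat \<Rightarrow> real)
    \<Rightarrow> (nat \<Rightarrow> real) \<Rightarrow> (real^2 \<Rightarrow> real) set" where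
  "energy_domain \<alpha> p K r \<rho> = {u. continuous_on K u \<and>
     (\<forall>w i. u \<circ> edge_param \<alpha> p w i \<in> H1) \<and>
     convergent (\<lambda>m. 1 / res_delta r m * Q \<alpha> p m u) \<and>
     summable (\<lambda>k. 1 / res_gamma r \<rho> (Suc k) * DI \<alpha> p (Suc k) u)}"

definition energy_domain0 :: "real \<Rightarrow> (3 \<Rightarrow> real^2) \<Rightarrow> (real^2) set \<Rightarrow> (nat \<Rightarrow> real)
    \<Rightarrow> (nat \<Rightarrow> real) \<Rightarrow> (real^2 \<Rightarrow> real) set" where
  "energy_domain0 \<alpha> p K r \<rho> = {u \<in> energy_domain \<alpha> p K r \<rho>. \<forall>i. u (p i) = 0}"

definition energy_form :: "real \<Rightarrow> (3 \<Rightarrow> real^2) \<Rightarrow> (nat \<Rightarrow> real) \<Rightarrow> (nat \<Rightarrow> real)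
    \<Rightarrow> (real^2 \<Rightarrow> real) \<Rightarrow> (real^2 \<Rightarrow> real) \<Rightarrow> real" where
  "energy_form \<alpha> p r \<rho> u v =
     (energy \<alpha> p r \<rho> (\<lambda>x. u x + v x) - energy \<alpha> p r \<rho> (\<lambda>x. u x - v x)) / 4"

section \<open>The measures\<close>

definition borel_prob_on :: "(real^2) set \<Rightarrow> (real^2) measure \<Rightarrow> bool" where
  "borel_prob_on K M \<longleftrightarrow> prob_space M \<and> sets M = sets (restrict_space borel K)"

definition is_mu_f :: "real \<Rightarrow> (3 \<Rightarrow> real^2) \<Rightarrow> (real^2) set \<Rightarrow> (real^2) measure \<Rightarrow> bool" where
  "is_mu_f \<alpha> p K M \<longleftrightarrow> borel_prob_on K M \<and>
     (\<forall>w. measure M (ssg_word_map \<alpha> p w ` K) = (1/3) ^ length w)"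

(* The normalized length measure on an edge is the image of Lebesgue measure on (0,1)
   under the affine parametrization. *)
definition is_mu_l :: "real \<Rightarrow> (3 \<Rightarrow> real^2) \<Rightarrow> (real^2) set \<Rightarrow> real \<Rightarrow> (real^2) measure \<Rightarrow> bool" where
  "is_mu_l \<alpha> p K \<beta> M \<longleftrightarrow> borel_prob_on K M \<and>
     measure M (\<Union>w. \<Union>i. edge \<alpha> p w i) = 1 \<and>
     (\<forall>w i. restrict_space M (edge \<alpha> p w i) =
        scale_measure (ennreal ((1/3 - \<beta>) * \<beta> ^ length w))
          (distr (restrict_space lborel {0<..<1}) (restrict_space borel (edge \<alpha> p w i))
             (edge_param \<alpha> p w i)))"

(* The convex combination \<eta> M + (1 - \<eta>) N of measures on the same sigma-algebra. *)
definition mix_measure :: "real \<Rightarrow> 'a measure \<Rightarrow> 'a measure \<Rightarrow> 'a measure" where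
  "mix_measure \<eta> M N = measure_of (space M) (sets M)
     (\<lambda>A. ennreal \<eta> * emeasure M A + ennreal (1 - \<eta>) * emeasure N A)"

section \<open>Operators associated with forms, eigenvalues and multiplicities\<close>

(* The graph of the nonnegative self-adjoint operator A on L2 M associated with the closed form
   (E, D): u lies in the domain of A and A u = f iff u is in D, f is in L2 and
   E(u,v) = (f,v) for all v in D. *)
definition form_operator :: "('a \<Rightarrow> real) set \<Rightarrow> (('a \<Rightarrow> real) \<Rightarrow> ('a \<Rightarrow> real) \<Rightarrow> real)
    \<Rightarrow> 'a measure \<Rightarrow> (('a \<Rightarrow> real) \<times> ('a \<Rightarrow> real)) set" where
  "form_operator D E M = {(u, f). u \<in> D \<and> u \<in> L2 M \<and> f \<in> L2 M \<and>
     (\<forall>v\<in>D. E u v = (LINT x|M. f x * v x))}"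

definition eigenspace :: "(('a \<Rightarrow> real) \<times> ('a \<Rightarrow> real)) set \<Rightarrow> real \<Rightarrow> ('a \<Rightarrow> real) set" where
  "eigenspace A l = {u. (u, \<lambda>x. l * u x) \<in> A}"

definition is_eigenvalue :: "'a measure \<Rightarrow> (('a \<Rightarrow> real) \<times> ('a \<Rightarrow> real)) set \<Rightarrow> real \<Rightarrow> bool" where
  "is_eigenvalue M A l \<longleftrightarrow> (\<exists>u \<in> eigenspace A l. \<not> (AE x in M. u x = 0))"

definition L2_independent :: "'a measure \<Rightarrow> nat \<Rightarrow> (nat \<Rightarrow> 'a \<Rightarrow> real) \<Rightarrow> bool" where
  "L2_independent M N f \<longleftrightarrow>
     (\<forall>c. (AE x in M. (\<Sum>i<N. c i * f i x) = 0) \<longrightarrow> (\<forall>i<N. c i = (0::real)))"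

(* The dimension, as a subspace of L2 M, of the eigenspace. *)
definition multiplicity_in :: "'a measure \<Rightarrow> (('a \<Rightarrow> real) \<times> ('a \<Rightarrow> real)) set \<Rightarrow> real \<Rightarrow> enat" where
  "multiplicity_in M A l =
     Sup {enat N | N. \<exists>f. (\<forall>i<N. f i \<in> eigenspace A l) \<and> L2_independent M N f}"

section \<open>The Dirichlet Laplacian\<close>

definition interior_measure :: "(3 \<Rightarrow> real^2) \<Rightarrow> (real^2) set \<Rightarrow> (real^2) measure \<Rightarrow> (real^2) measure" where
  "interior_measure p K M = restrict_space M (K - range p)"

definition neg_dirichlet_laplacian :: "real \<Rightarrow> (3 \<Rightarrow> real^2) \<Rightarrow> (real^2) set \<Rightarrow> (nat \<Rightarrow> real)
    \<Rightarrow> (nat \<Rightarrow> real) \<Rightarrow> (real^2) measure \<Rightarrow> ((real^2 \<Rightarrow> real) \<times> (real^2 \<Rightarrow> real)) set" where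
  "neg_dirichlet_laplacian \<alpha> p K r \<rho> M =
     form_operator (energy_domain0 \<alpha> p K r \<rho>) (energy_form \<alpha> p r \<rho>) (interior_measure p K M)"

end

theory Submission
  imports Defs "HOL-Library.Diagonal_Subsequence"
begin

text \<open>
  Let $u$ minimize the Rayleigh quotient of the energy belonging to the resistances
  $(r_{n+i}, \rho_{n+i})_i$ among the functions of $K$ that change sign under each reflection of the triangle.
  Antisymmetry forces $u = 0$ on $V_0$, and every function of finite energy differs from an antisymmetric one
  by a function orthogonal to $u$; hence $u$ satisfies the eigenvalue equation against all test functions,
  without boundary condition. The function $u \circ G_w^{-1}$ on $K_w$, extended by $0$, is therefore an eigenfunction
  for each of the $3^n$ words $w$ of length $n$, always for the same eigenvalue.

  It equals $\delta_n^{-1}$ times the minimal quotient, formed with the measure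
  $\eta \beta^n \mu_l + (1 - \eta) 3^{-n} \mu_f$. Since $r_i \le 3/5$, the energy controls the oscillation
  uniformly in the resistances, which bounds the quotient from below and gives the compactness for the minimizer;
  a test function built from harmonic functions bounds it from above. Summability of
  $|r - r_i|$ makes $\delta_n$ comparable to $r^n$.
\<close>

section \<open>Finite-energy functions on the unit interval\<close>

text \<open>A function on a cell, extended by zero, stays an eigenfunction only if its normal
  derivatives at the vertices vanish along with its values, which a Dirichlet eigenfunction has no
  reason to satisfy. The sign representation of the symmetry group gives both conditions at once,
  and minimizing inside it replaces spectral theory. The problem of level n belongs to a shifted
  sequence of resistances, so every estimate must be uniform in the sequence. The delicate case is r
  = 3/5, where the \<rho>_i tend to 0 and the edge conductances explode. The oscillation bounds
  therefore use only r_i <= 3/5 and \<rho>_i <= 1, and the test function is constant on the coarse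
  edges and harmonic in the finer cells, where the matching condition accounts for the edge energy
  exactly. Weak derivatives are traded at the outset for dyadic difference quotients: the energy
  becomes a supremum of forms in finitely many values, for which symmetry, scaling and
  semicontinuity are elementary.\<close>

definition dyad :: "nat \<Rightarrow> (real \<Rightarrow> real) \<Rightarrow> (real \<Rightarrow> real) \<Rightarrow> real" where
  "dyad N f g = 2 ^ N * (\<Sum>j<2 ^ N. (f (real (Suc j) / 2 ^ N) - f (real j / 2 ^ N)) *
     (g (real (Suc j) / 2 ^ N) - g (real j / 2 ^ N)))"

lemma sum_lessThan_double: "(\<Sum>j<2 * n. h j) = (\<Sum>j<n. h (2 * j) + h (2 * j + 1))"
  for h :: "nat \<Rightarrow> real"
  by (induction n) (auto simp: algebra_simps)

lemma dyad_0: "dyad 0 f g = (f 1 - f 0) * (g 1 - g 0)"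
  by (simp add: dyad_def)

lemma dyad_nonneg: "0 \<le> dyad N f f"
  unfolding dyad_def by (intro mult_nonneg_nonneg sum_nonneg zero_le_square) auto

text \<open>\<open>dyad N f f\<close> is the Dirichlet integral of the piecewise linear interpolant
  of f at the dyadic points of level N. Inserting midpoints can only raise it: the defect is the
  square of a second difference, and the factor 2 in front is the one by which \<open>2 ^ N\<close>
  grows.\<close>

lemma dyad_mono_Suc: "dyad N f f \<le> dyad (Suc N) f f"
proof -
  define t where "t j = f (real j / 2 ^ Suc N)" for j
  have t: "f (real j / 2 ^ N) = t (2 * j)" for j
    by (simp add: t_def field_simps)
  have "dyad N f f = 2 ^ N * (\<Sum>j<2 ^ N. (t (2 * j + 2) - t (2 * j))\<^sup>2)"
    unfolding dyad_def t by (simp add: power2_eq_square)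
  also have "\<dots> \<le> 2 ^ N * (\<Sum>j<2 ^ N. 2 * ((t (2 * j + 1) - t (2 * j))\<^sup>2 + (t (2 * j + 2) - t (2 * j + 1))\<^sup>2))"
  proof (intro mult_left_mono sum_mono)
    fix j :: nat
    have "(a - c)\<^sup>2 \<le> 2 * ((b - c)\<^sup>2 + (a - b)\<^sup>2)" for a b c :: real
    proof -
      have "2 * ((b - c)\<^sup>2 + (a - b)\<^sup>2) - (a - c)\<^sup>2 = (a + c - 2 * b)\<^sup>2"
        by (simp add: power2_eq_square algebra_simps)
      then show ?thesis by (metis diff_ge_0_iff_ge zero_le_power2)
    qed
    then show "(t (2 * j + 2) - t (2 * j))\<^sup>2 \<le> 2 * ((t (2 * j + 1) - t (2 * j))\<^sup>2 + (t (2 * j + 2) - t (2 * j + 1))\<^sup>2)" .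
  qed simp
  also have "\<dots> = dyad (Suc N) f f"
  proof -
    have "dyad (Suc N) f f = 2 ^ Suc N * (\<Sum>j<2 * 2 ^ N. (t (Suc j) - t j)\<^sup>2)"
      unfolding dyad_def t_def by (simp add: power2_eq_square)
    also have "\<dots> = 2 ^ Suc N * (\<Sum>j<2 ^ N. (t (2 * j + 1) - t (2 * j))\<^sup>2 + (t (2 * j + 2) - t (2 * j + 1))\<^sup>2)"
      by (subst sum_lessThan_double) simp
    finally show ?thesis
      by (simp add: sum_distrib_left algebra_simps)
  qed
  finally show ?thesis .
qed

lemma dyad_mono: "N \<le> N' \<Longrightarrow> dyad N f f \<le> dyad N' f f"
  by (rule lift_Suc_mono_le[of "\<lambda>N. dyad N f f", OF dyad_mono_Suc])

lemma dyad_cong: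
  assumes "\<And>t. t \<in> {0..1} \<Longrightarrow> f t = f' t" "\<And>t. t \<in> {0..1} \<Longrightarrow> g t = g' t"
  shows "dyad N f g = dyad N f' g'"
proof -
  have "real j / 2 ^ N \<in> {0..1}" if "j \<le> 2 ^ N" for j
    using that by (simp add: field_simps)
  then show ?thesis
    unfolding dyad_def using assms
    by (intro arg_cong2[where f = "(*)"] refl sum.cong) (simp_all add: Suc_le_eq del: of_nat_Suc)
qed

lemma dyad_commute: "dyad N f g = dyad N g f"
  by (simp add: dyad_def mult.commute)

lemma dyad_add_left: "dyad N (\<lambda>x. f x + f' x) g = dyad N f g + dyad N f' g"
  by (simp add: dyad_def algebra_simps sum.distrib sum_subtractf)

lemma dyad_scale_left: "dyad N (\<lambda>x. c * f x) g = c * dyad N f g"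
  by (simp add: dyad_def algebra_simps sum_distrib_left sum_subtractf)

lemma dyad_reverse: "dyad N (\<lambda>t. f (1 - t)) (\<lambda>t. g (1 - t)) = dyad N f g"
proof -
  let ?h = "\<lambda>j::nat. (f (real (Suc j) / 2 ^ N) - f (real j / 2 ^ N)) * (g (real (Suc j) / 2 ^ N) - g (real j / 2 ^ N))"
  have "(\<Sum>j<2 ^ N. ?h j) = (\<Sum>j<2 ^ N. ?h (2 ^ N - Suc j))"
    by (rule sum.nat_diff_reindex[symmetric])
  also have "\<dots> = (\<Sum>j<2 ^ N. (f (1 - real (Suc j) / 2 ^ N) - f (1 - real j / 2 ^ N)) * (g (1 - real (Suc j) / 2 ^ N) - g (1 - real j / 2 ^ N)))"
  proof (rule sum.cong[OF refl])
    fix j assume "j \<in> {..<2 ^ N :: nat}"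
    then have j: "Suc j \<le> 2 ^ N" by auto
    have 1: "real (2 ^ N - Suc j) / 2 ^ N = 1 - real (Suc j) / 2 ^ N"
      using j by (simp add: of_nat_diff field_simps)
    have 2: "real (Suc (2 ^ N - Suc j)) / 2 ^ N = 1 - real j / 2 ^ N"
      using j by (simp add: Suc_diff_Suc of_nat_diff field_simps)
    show "?h (2 ^ N - Suc j) = (f (1 - real (Suc j) / 2 ^ N) - f (1 - real j / 2 ^ N)) * (g (1 - real (Suc j) / 2 ^ N) - g (1 - real j / 2 ^ N))"
      unfolding 1 2 by (simp add: algebra_simps)
  qed
  finally show ?thesis by (simp add: dyad_def)
qed

lemma dyad_affine: "dyad N (\<lambda>t. a + t * b) (\<lambda>t. a + t * b) = b\<^sup>2"
proof -
  have "(real (Suc j) / 2 ^ N) * b - (real j / 2 ^ N) * b = b / 2 ^ N" for j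
    by (simp add: field_simps)
  then show ?thesis
    by (simp add: dyad_def power2_eq_square)
qed

section \<open>Increments of square integrable functions on (0,1)\<close>

abbreviation UI :: "real measure" where "UI \<equiv> unit_interval_measure"

text \<open>An indicator under one fixed measure stands in for integrals over varying domains, so
  that linearity and dominated convergence apply directly. Intervals open on the left and closed on
  the right tile without overlap.\<close>

definition incr :: "(real \<Rightarrow> real) \<Rightarrow> real \<Rightarrow> real \<Rightarrow> real" where
  "incr g a b = (LINT x|UI. indicator {a<..b} x * g x)"

lemma finite_measure_UI: "finite_measure UI"
  by (rule finite_measure_lebesgue_on) simp

lemma borel_meas_UI: "f \<in> borel_measurable borel \<Longrightarrow> f \<in> borel_measurable UI"
  by (intro measurable_restrict_space1 measurable_completion) simp

lemma cont_meas_UI: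
  "continuous_on {0..1} f \<Longrightarrow> (f :: real \<Rightarrow> real) \<in> borel_measurable UI"
  by (rule continuous_imp_measurable_on_sets_lebesgue) (auto elim: continuous_on_subset)

lemma integrable_bounded_UI:
  assumes "(f :: real \<Rightarrow> real) \<in> borel_measurable UI" "\<And>x. x \<in> {0<..<1} \<Longrightarrow> \<bar>f x\<bar> \<le> B"
  shows "integrable UI f"
  using assms by (intro finite_measure.integrable_const_bound[OF finite_measure_UI, of f B] AE_I2) auto

lemma cont_bounded: 
  assumes "continuous_on {0..1} (f :: real \<Rightarrow> real)" obtains B where "0 \<le> B" "\<And>x. x \<in> {0..1} \<Longrightarrow> \<bar>f x\<bar> \<le> B"
proof -
  have "bounded (f ` {0..1})" by (intro compact_imp_bounded compact_continuous_image assms) simp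
  then obtain B where "\<And>x. x \<in> {0..1} \<Longrightarrow> \<bar>f x\<bar> \<le> B"
    unfolding bounded_iff by (metis image_eqI real_norm_def)
  then show ?thesis by (intro that[of "max 0 B"]) (auto simp: le_max_iff_disj)
qed

lemma cont_integrable_UI:
  assumes "continuous_on {0..1} (f :: real \<Rightarrow> real)" shows "integrable UI f"
proof -
  obtain B where "0 \<le> B" "\<And>x. x \<in> {0..1} \<Longrightarrow> \<bar>f x\<bar> \<le> B"
    using cont_bounded[OF assms] by blast
  then show ?thesis by (intro integrable_bounded_UI[where B = B] cont_meas_UI assms) auto
qed

lemma cont_L2_UI:
  assumes "continuous_on {0..1} f" shows "f \<in> L2 UI"
  using assms by (auto simp: L2_def intro!: cont_meas_UI cont_integrable_UI continuous_intros)

lemma L2_integrable_mult: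
  assumes "f \<in> L2 M" "g \<in> L2 M" shows "integrable M (\<lambda>x. f x * g x)"
proof (rule Bochner_Integration.integrable_bound)
  show "integrable M (\<lambda>x. (f x)\<^sup>2 + (g x)\<^sup>2)" using assms by (auto simp: L2_def)
  show "(\<lambda>x. f x * g x) \<in> borel_measurable M" using assms by (auto simp: L2_def)
  have "\<bar>a * b\<bar> \<le> a\<^sup>2 + b\<^sup>2" for a b :: real
  proof -
    have "0 \<le> (\<bar>a\<bar> - \<bar>b\<bar>)\<^sup>2" by simp
    then have "2 * \<bar>a * b\<bar> \<le> a\<^sup>2 + b\<^sup>2" by (simp add: power2_diff abs_mult)
    then show ?thesis using abs_ge_zero[of "a * b"] by linarith
  qed
  then show "AE x in M. norm (f x * g x) \<le> norm ((f x)\<^sup>2 + (g x)\<^sup>2)" by simp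
qed

lemma L2_UI_const: "(\<lambda>x. c) \<in> L2 UI"
  by (rule cont_L2_UI) simp

lemma L2_UI_integrable: "f \<in> L2 UI \<Longrightarrow> integrable UI f"
  using L2_integrable_mult[OF _ L2_UI_const[of 1]] by simp

lemma L2_add: assumes "f \<in> L2 M" "g \<in> L2 M" shows "(\<lambda>x. f x + g x) \<in> L2 M"
proof -
  have "(\<lambda>x. (f x + g x)\<^sup>2) = (\<lambda>x. (f x)\<^sup>2 + (g x)\<^sup>2 + 2 * (f x * g x))"
    by (auto simp: power2_eq_square algebra_simps)
  then show ?thesis using assms L2_integrable_mult[OF assms] by (auto simp: L2_def)
qed

lemma L2_scale: "f \<in> L2 M \<Longrightarrow> (\<lambda>x. c * f x) \<in> L2 M"
  by (auto simp: L2_def power_mult_distrib)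

lemma L2_diff: assumes "f \<in> L2 M" "g \<in> L2 M" shows "(\<lambda>x. f x - g x) \<in> L2 M"
  using L2_add[OF assms(1) L2_scale[OF assms(2), of "-1"]] by simp

lemma ind_meas_UI: "(\<lambda>x::real. indicator {a<..b} x :: real) \<in> borel_measurable UI"
  by (rule borel_meas_UI) simp

lemma ind_integrable_UI:
  assumes "integrable UI g"
  shows "integrable UI (\<lambda>x. indicator {a<..b} x * g x :: real)"
proof (rule Bochner_Integration.integrable_bound[OF assms])
  show "(\<lambda>x. indicator {a<..b} x * g x :: real) \<in> borel_measurable UI"
    using assms by (intro borel_measurable_times ind_meas_UI) auto
qed (auto simp: indicator_def)

lemma ind_L2_UI: "(\<lambda>x. indicator {a<..b} x :: real) \<in> L2 UI"
  unfolding L2_def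
proof (intro CollectI conjI)
  show "integrable UI (\<lambda>x. (indicator {a<..b} x :: real)\<^sup>2)"
    by (rule integrable_bounded_UI[where B = 1, OF borel_measurable_power[OF ind_meas_UI]]) (auto simp: indicator_def)
qed (rule ind_meas_UI)

lemma incr_diff:
  assumes "integrable UI f" "integrable UI g"
  shows "incr (\<lambda>x. f x - g x) a b = incr f a b - incr g a b"
  unfolding incr_def using assms
  by (simp add: right_diff_distrib ind_integrable_UI)

lemma incr_combine:
  assumes "integrable UI g" "a \<le> b" "b \<le> c"
  shows "incr g a c = incr g a b + incr g b c"
proof -
  have "indicator {a<..c} x * g x = indicator {a<..b} x * g x + indicator {b<..c} x * g x" for x
    using assms(2,3) by (auto simp: indicator_def)
  then show ?thesis unfolding incr_def using ind_integrable_UI[OF assms(1)] by simp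
qed

lemma incr_1:
  assumes "0 \<le> a" "a \<le> b" "b \<le> 1" shows "incr (\<lambda>_. c) a b = c * (b - a)"
proof -
  \<comment> \<open>The interval may contain the endpoint 1, which is missing from the domain of
    \<open>UI\<close>.\<close>
  have "measure lebesgue ({a<..b} \<inter> {0<..<1}) = measure lebesgue {a<..b}"
  proof (rule measure_eq_AE)
    show "AE x in lebesgue. (x \<in> {a<..b} \<inter> {0<..<1}) = (x \<in> {a<..b})"
      using AE_lborel_singleton[of 1] assms
      by (intro AE_completion) (auto elim!: eventually_mono)
  qed auto
  also have "\<dots> = b - a" using assms by simp
  finally have 2: "measure lebesgue ({a<..b} \<inter> {0<..<1}) = b - a" .
  have "incr (\<lambda>_. c) a b = (LINT x|lebesgue_on {0<..<1}. indicator ({a<..b} \<inter> {0<..<1}) x) * c"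
    unfolding incr_def by (subst integral_mult_left_zero[symmetric], rule Bochner_Integration.integral_cong) (auto simp: indicator_def)
  also have "(LINT x|lebesgue_on {0<..<1}. indicator ({a<..b} \<inter> {0<..<1}) x) = measure (lebesgue_on {0<..<1}) ({a<..b} \<inter> {0<..<1})"
    by (simp add: Int_absorb2)
  also have "\<dots> = b - a" using 2 by (subst measure_restrict_space) auto
  finally show ?thesis by simp
qed

lemma incr_tendsto:
  assumes g: "integrable UI g" and a: "A \<longlonglongrightarrow> a" and b: "B \<longlonglongrightarrow> b"
  shows "(\<lambda>n. incr g (A n) (B n)) \<longlonglongrightarrow> incr g a b"
  unfolding incr_def
proof (rule integral_dominated_convergence[where w = "\<lambda>x. \<bar>g x\<bar>"])
  have ne: "AE x in UI. x \<noteq> c" for c :: real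
    using AE_completion[OF AE_lborel_singleton[of c]]
    by (subst AE_restrict_space_iff) (auto elim: eventually_mono)
  show "AE x in UI. (\<lambda>n. indicator {A n<..B n} x * g x) \<longlonglongrightarrow> indicator {a<..b} x * g x"
    using ne[of a] ne[of b]
  proof eventually_elim
    case (elim x)
    have "\<forall>\<^sub>F n in sequentially. (A n < x) = (a < x)"
    proof (cases "a < x")
      case True with order_tendstoD(2)[OF a True] show ?thesis by simp
    next
      case False with elim have "x < a" by simp
      from order_tendstoD(1)[OF a this] False show ?thesis by (auto elim!: eventually_mono)
    qed
    moreover have "\<forall>\<^sub>F n in sequentially. (x \<le> B n) = (x \<le> b)"
    proof (cases "x \<le> b")
      case True with elim have "x < b" by simp
      from order_tendstoD(1)[OF b this] True show ?thesis by (auto elim!: eventually_mono)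
    next
      case False then have "b < x" by simp
      from order_tendstoD(2)[OF b this] False show ?thesis by (auto elim!: eventually_mono)
    qed
    ultimately have "\<forall>\<^sub>F n in sequentially. indicator {A n<..B n} x * g x = indicator {a<..b} x * g x"
      by eventually_elim (auto simp: indicator_def)
    then show ?case by (rule tendsto_eventually)
  qed
  show "integrable UI (\<lambda>x. \<bar>g x\<bar>)" using g by simp
  show "AE x in UI. norm (indicator {A n<..B n} x * g x) \<le> \<bar>g x\<bar>" for n
    by (rule AE_I2) (simp add: indicator_def)
qed (use ind_integrable_UI[OF g] in \<open>blast dest: borel_measurable_integrable\<close>)+

text \<open>Cauchy-Schwarz, read off from the nonnegativity of the integral of (g - c)^2 over the
  interval, with c the mean of g there.\<close>

lemma incr_square_le:
  assumes g: "g \<in> L2 UI" and ab: "0 \<le> a" "a \<le> b" "b \<le> 1"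
  shows "(incr g a b)\<^sup>2 \<le> (b - a) * incr (\<lambda>x. (g x)\<^sup>2) a b"
proof (cases "a = b")
  case True
  then show ?thesis by (simp add: incr_def)
next
  case False
  define c where "c = incr g a b / (b - a)"
  have i: "integrable UI (\<lambda>x. (g x)\<^sup>2)" "integrable UI g"
    using g L2_UI_integrable[OF g] by (auto simp: L2_def)
  have k: "integrable UI (\<lambda>x. indicator {a<..b} x * c\<^sup>2)"
    by (rule ind_integrable_UI) (use L2_UI_integrable L2_UI_const in blast)
  have "0 \<le> (LINT x|UI. indicator {a<..b} x * (g x - c)\<^sup>2)"
    by (intro integral_nonneg_AE AE_I2) auto
  also have "\<dots> = (LINT x|UI. indicator {a<..b} x * (g x)\<^sup>2 - 2 * c * (indicator {a<..b} x * g x) + indicator {a<..b} x * c\<^sup>2)"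
    by (simp add: power2_eq_square algebra_simps)
  also have "\<dots> = incr (\<lambda>x. (g x)\<^sup>2) a b - 2 * c * incr g a b + incr (\<lambda>_. c\<^sup>2) a b"
    unfolding incr_def using ind_integrable_UI[OF i(1), of a b] ind_integrable_UI[OF i(2), of a b] k
    by simp
  also have "\<dots> = incr (\<lambda>x. (g x)\<^sup>2) a b - 2 * c * incr g a b + c\<^sup>2 * (b - a)"
    using ab by (simp add: incr_1)
  also have "\<dots> = incr (\<lambda>x. (g x)\<^sup>2) a b - (incr g a b)\<^sup>2 / (b - a)"
  proof -
    have "(incr g a b)\<^sup>2 / (b - a) = c * incr g a b" by (simp add: c_def power2_eq_square)
    moreover have "c\<^sup>2 * (b - a) = c * incr g a b" using False by (simp add: c_def power2_eq_square)
    ultimately show ?thesis by simp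
  qed
  finally show ?thesis using False ab by (simp add: field_simps)
qed

lemma dyadic_in_unit: "j \<le> 2 ^ N \<Longrightarrow> real j / 2 ^ N \<in> {0..1}"
  by (simp add: field_simps)

lemma incr_sum_dyadic:
  assumes g: "integrable UI g"
  shows "(\<Sum>j<k. incr g (real j / 2 ^ N) (real (Suc j) / 2 ^ N)) = incr g 0 (real k / 2 ^ N)"
proof (induction k)
  case 0 show ?case by (simp add: incr_def)
next
  case (Suc k)
  show ?case unfolding sum.lessThan_Suc Suc
    by (rule incr_combine[symmetric, OF g]) (auto simp: field_simps)
qed

lemma incr_0_1: "incr g 0 1 = (LINT x|UI. g x)"
  unfolding incr_def by (rule Bochner_Integration.integral_cong) auto

lemma incr_mono:
  assumes "integrable UI g" "\<And>x. 0 \<le> g x" "a' \<le> a" "b \<le> b'"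
  shows "incr g a b \<le> incr g a' b'"
  unfolding incr_def using ind_integrable_UI[OF assms(1)] assms
  by (intro integral_mono) (auto simp: indicator_def)

text \<open>Cauchy-Schwarz on each dyadic cell; the cell length cancels the factor
  \<open>2 ^ N\<close>.\<close>

lemma dyad_le_L2:
  assumes g: "g \<in> L2 UI"
    and f: "\<And>a b. 0 \<le> a \<Longrightarrow> a \<le> b \<Longrightarrow> b \<le> 1 \<Longrightarrow> incr g a b = f b - f a"
  shows "dyad N f f \<le> (LINT x|UI. (g x)\<^sup>2)"
proof -
  have i: "integrable UI (\<lambda>x. (g x)\<^sup>2)" using g by (auto simp: L2_def)
  let ?a = "\<lambda>j::nat. real j / 2 ^ N"
  have "dyad N f f = (\<Sum>j<2 ^ N. 2 ^ N * (f (?a (Suc j)) - f (?a j))\<^sup>2)"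
    by (simp add: dyad_def power2_eq_square sum_distrib_left)
  also have "\<dots> \<le> (\<Sum>j<2 ^ N. incr (\<lambda>x. (g x)\<^sup>2) (?a j) (?a (Suc j)))"
  proof (rule sum_mono)
    fix j assume "j \<in> {..<2 ^ N :: nat}"
    then have j: "0 \<le> ?a j" "?a j \<le> ?a (Suc j)" "?a (Suc j) \<le> 1"
      using dyadic_in_unit[of "Suc j" N] by (auto simp: field_simps)
    have "?a (Suc j) - ?a j = 1 / 2 ^ N" by (simp add: field_simps)
    with incr_square_le[OF g j] f[OF j, symmetric]
    show "2 ^ N * (f (?a (Suc j)) - f (?a j))\<^sup>2 \<le> incr (\<lambda>x. (g x)\<^sup>2) (?a j) (?a (Suc j))"
      by (simp add: field_simps del: of_nat_Suc)
  qed
  also have "\<dots> = incr (\<lambda>x. (g x)\<^sup>2) 0 1"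
    by (subst incr_sum_dyadic[OF i]) simp
  finally show ?thesis by (simp add: incr_0_1)
qed

section \<open>Dyadic step functions and discrete integration by parts\<close>

lemma dyadic_cell:
  assumes "x \<in> {0<..<1}"
  obtains j where "j < 2 ^ N" "real j / 2 ^ N < x" "x \<le> real (Suc j) / 2 ^ N"
    "\<And>c :: nat \<Rightarrow> real. (\<Sum>i<2 ^ N. c i * indicator {real i / 2 ^ N<..real (Suc i) / 2 ^ N} x) = c j"
proof -
  \<comment> \<open>Cells are open on the left, so the index is a ceiling minus one;
    \<open>c1\<close> keeps it from being negative.\<close>
  define j where "j = nat (\<lceil>2 ^ N * x\<rceil> - 1)"
  have pos: "0 < 2 ^ N * x" using assms by simp
  then have c1: "1 \<le> \<lceil>2 ^ N * x\<rceil>" by (simp add: one_le_ceiling)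
  have c2: "\<lceil>2 ^ N * x\<rceil> \<le> 2 ^ N"
    using assms by (simp add: ceiling_le_iff)
  have rj: "real j = of_int \<lceil>2 ^ N * x\<rceil> - 1" using c1 by (simp add: j_def)
  have "real j < 2 ^ N" using c2 rj
    by (metis (no_types, opaque_lifting) diff_less_eq less_add_one of_int_le_iff of_int_numeral of_int_power order_le_less_trans)
  then have jN: "j < 2 ^ N" by simp
  have lo: "real j / 2 ^ N < x"
    using rj ceiling_correct[of "2 ^ N * x"] by (simp add: field_simps)
  have hi: "x \<le> real (Suc j) / 2 ^ N"
    using rj by (simp add: field_simps)
  have other: "indicator {real i / 2 ^ N<..real (Suc i) / 2 ^ N} x = (0::real)" if "i \<noteq> j" for i
  proof (cases "i < j")
    case True
    then have "real (Suc i) \<le> real j" by simp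
    then have "real (Suc i) / 2 ^ N \<le> real j / 2 ^ N" by (rule divide_right_mono) simp
    with lo show ?thesis by (simp add: indicator_def)
  next
    case False
    with that have "real (Suc j) \<le> real i" by simp
    then have "real (Suc j) / 2 ^ N \<le> real i / 2 ^ N" by (rule divide_right_mono) simp
    with hi show ?thesis by (simp add: indicator_def)
  qed
  have "(\<Sum>i<2 ^ N. c i * indicator {real i / 2 ^ N<..real (Suc i) / 2 ^ N} x) = c j" for c :: "nat \<Rightarrow> real"
  proof -
    have "(\<Sum>i<2 ^ N. c i * indicator {real i / 2 ^ N<..real (Suc i) / 2 ^ N} x) = (\<Sum>i<2 ^ N. if i = j then c i else 0)"
      using other lo hi by (intro sum.cong) (auto simp: indicator_def)
    then show ?thesis using jN by simp
  qed
  with jN lo hi that show ?thesis by blast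
qed

definition step_fun :: "nat \<Rightarrow> (nat \<Rightarrow> real) \<Rightarrow> real \<Rightarrow> real" where
  "step_fun N c x = (\<Sum>i<2 ^ N. c i * indicator {real i / 2 ^ N<..real (Suc i) / 2 ^ N} x)"

lemma step_fun_L2: "step_fun N c \<in> L2 UI"
proof -
  have "(\<lambda>x. \<Sum>i<k. c i * indicator {real i / 2 ^ N<..real (Suc i) / 2 ^ N} x) \<in> L2 UI" for k :: nat
  proof (induction k)
    case 0 then show ?case using L2_UI_const[of 0] by simp
  next
    case (Suc k)
    show ?case using L2_add[OF Suc L2_scale[OF ind_L2_UI]] by simp
  qed
  then show ?thesis by (simp add: step_fun_def[abs_def])
qed

lemma integral_step_fun:
  assumes "integrable UI g"
  shows "(LINT x|UI. step_fun N c x * g x) =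
    (\<Sum>i<2 ^ N. c i * incr g (real i / 2 ^ N) (real (Suc i) / 2 ^ N))"
proof -
  have "(LINT x|UI. step_fun N c x * g x) =
     (LINT x|UI. (\<Sum>i<2 ^ N. c i * (indicator {real i / 2 ^ N<..real (Suc i) / 2 ^ N} x * g x)))"
    unfolding step_fun_def sum_distrib_right mult.assoc ..
  also have "\<dots> = (\<Sum>i<2 ^ N. c i * incr g (real i / 2 ^ N) (real (Suc i) / 2 ^ N))"
    unfolding incr_def using ind_integrable_UI[OF assms]
    by (subst Bochner_Integration.integral_sum) simp_all
  finally show ?thesis .
qed

lemma incr_step_fun:
  assumes "j < 2 ^ N"
  shows "incr (step_fun N c) (real j / 2 ^ N) (real (Suc j) / 2 ^ N) = c j / 2 ^ N"
proof -
  let ?I = "{real j / 2 ^ N<..real (Suc j) / 2 ^ N}"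
  have "incr (step_fun N c) (real j / 2 ^ N) (real (Suc j) / 2 ^ N) = incr (\<lambda>_. c j) (real j / 2 ^ N) (real (Suc j) / 2 ^ N)"
    unfolding incr_def
  proof (rule Bochner_Integration.integral_cong[OF refl])
    fix x :: real assume "x \<in> space UI"
    then have "x \<in> {0<..<1}" by simp
    then obtain k where k: "k < 2 ^ N" "real k / 2 ^ N < x" "x \<le> real (Suc k) / 2 ^ N"
      "\<And>c :: nat \<Rightarrow> real. (\<Sum>i<2 ^ N. c i * indicator {real i / 2 ^ N<..real (Suc i) / 2 ^ N} x) = c k"
      using dyadic_cell[of x N thesis] by blast
    show "indicator ?I x * step_fun N c x = indicator ?I x * c j"
    proof (cases "x \<in> ?I")
      case True
      then have "real j / 2 ^ N < real (Suc k) / 2 ^ N" "real k / 2 ^ N < real (Suc j) / 2 ^ N"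
        using k(2,3) by auto
      then have "k = j" by (simp add: divide_less_cancel)
      then show ?thesis using k(4)[of c] by (simp add: step_fun_def)
    qed simp
  qed
  also have "\<dots> = c j * (real (Suc j) / 2 ^ N - real j / 2 ^ N)"
    using dyadic_in_unit[of "Suc j" N] assms by (intro incr_1) (auto simp: field_simps)
  also have "\<dots> = c j / 2 ^ N" by (simp add: field_simps)
  finally show ?thesis .
qed

text \<open>The offset \<open>e\<close> selects the left (0) or right (1) end of each cell as sample
  point; summation by parts needs one factor sampled at either end. The limit itself is dominated
  convergence for a bounded continuous F.\<close>

lemma step_fun_tendsto:
  assumes F: "continuous_on {0..1} F" and g: "integrable UI g" and e: "e \<le> 1"
  shows "(\<lambda>N. LINT x|UI. step_fun N (\<lambda>j. F (real (j + e) / 2 ^ N)) x * g x)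
    \<longlonglongrightarrow> (LINT x|UI. F x * g x)"
proof -
  obtain B where B: "0 \<le> B" "\<And>x. x \<in> {0..1} \<Longrightarrow> \<bar>F x\<bar> \<le> B"
    using cont_bounded[OF F] by blast
  have ex: "\<exists>y \<in> {0..1}. \<bar>y - x\<bar> \<le> 1 / 2 ^ N \<and> step_fun N (\<lambda>j. F (real (j + e) / 2 ^ N)) x = F y"
    if x: "x \<in> {0<..<1}" for x N
  proof -
    obtain j where j: "j < 2 ^ N" "real j / 2 ^ N < x" "x \<le> real (Suc j) / 2 ^ N"
      "\<And>c :: nat \<Rightarrow> real. (\<Sum>i<2 ^ N. c i * indicator {real i / 2 ^ N<..real (Suc i) / 2 ^ N} x) = c j"
      using dyadic_cell[OF x, of N] by blast
    have "real (Suc j) / 2 ^ N = real j / 2 ^ N + 1 / 2 ^ N" by (simp add: field_simps)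
    then have "\<bar>real (j + e) / 2 ^ N - x\<bar> \<le> 1 / 2 ^ N"
      using j(2,3) e by (cases e) (auto simp: abs_le_iff)
    moreover have "real (j + e) / 2 ^ N \<in> {0..1}"
      by (rule dyadic_in_unit) (use j(1) e in auto)
    ultimately show ?thesis
      using j(4)[of "\<lambda>j. F (real (j + e) / 2 ^ N)"] by (auto simp: step_fun_def)
  qed
  show ?thesis
  proof (rule integral_dominated_convergence[where w = "\<lambda>x. B * \<bar>g x\<bar>"])
    show "AE x in UI. (\<lambda>N. step_fun N (\<lambda>j. F (real (j + e) / 2 ^ N)) x * g x) \<longlonglongrightarrow> F x * g x"
    proof (rule AE_I2, rule tendsto_mult_right)
      fix x :: real assume "x \<in> space UI"
      then have x: "x \<in> {0<..<1}" by simp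
      from ex[OF x] obtain y where y: "\<And>N. y N \<in> {0..1}" "\<And>N. \<bar>y N - x\<bar> \<le> 1 / 2 ^ N"
        "\<And>N. step_fun N (\<lambda>j. F (real (j + e) / 2 ^ N)) x = F (y N)" by metis
      have "(\<lambda>N. 1 / 2 ^ N :: real) \<longlonglongrightarrow> 0"
        using LIMSEQ_power_zero[of "1/2 :: real"] by (simp add: power_divide)
      then have "(\<lambda>N. y N - x) \<longlonglongrightarrow> 0"
        by (rule Lim_null_comparison[rotated]) (use y(2) in simp)
      then have "y \<longlonglongrightarrow> x" by (simp add: LIM_zero_iff)
      then have "(\<lambda>N. F (y N)) \<longlonglongrightarrow> F x"
        using F y(1) x by (auto simp: continuous_on_sequentially o_def)
      then show "(\<lambda>N. step_fun N (\<lambda>j. F (real (j + e) / 2 ^ N)) x) \<longlonglongrightarrow> F x"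
        using y(3) by simp
    qed
    show "AE x in UI. norm (step_fun N (\<lambda>j. F (real (j + e) / 2 ^ N)) x * g x) \<le> B * \<bar>g x\<bar>" for N
    proof (rule AE_I2)
      fix x :: real assume "x \<in> space UI"
      then have x: "x \<in> {0<..<1}" by simp
      from ex[OF x, of N] B(2) show "norm (step_fun N (\<lambda>j. F (real (j + e) / 2 ^ N)) x * g x) \<le> B * \<bar>g x\<bar>"
        by (auto simp: abs_mult intro!: mult_right_mono)
    qed
    show "(\<lambda>x. F x * g x) \<in> borel_measurable UI"
      using cont_meas_UI[OF F] g by (intro borel_measurable_times) auto
    show "(\<lambda>x. step_fun N (\<lambda>j. F (real (j + e) / 2 ^ N)) x * g x) \<in> borel_measurable UI" for N
      using step_fun_L2[of N] g by (intro borel_measurable_times) (auto simp: L2_def)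
    show "integrable UI (\<lambda>x. B * \<bar>g x\<bar>)" using g by simp
  qed
qed

lemma incr_FTC:
  assumes F: "\<And>x. (F has_real_derivative F' x) (at x)" and c: "continuous_on UNIV F'"
    and ab: "0 \<le> a" "a \<le> b" "b \<le> 1"
  shows "incr F' a b = F b - F a"
proof -
  have "incr F' a b = (LINT x|lebesgue. indicator {0<..<1} x * (indicator {a<..b} x * F' x))"
    unfolding incr_def by (subst integral_restrict_space) auto
  also have "\<dots> = (LINT x|lebesgue. indicator {a<..<b} x * F' x)"
  proof (rule integral_cong_AE)
    have m: "F' \<in> borel_measurable lebesgue"
      using c by (intro measurable_completion) (simp add: borel_measurable_continuous_onI)
    have i: "(\<lambda>x. indicator S x :: real) \<in> borel_measurable lebesgue" if "S \<in> sets borel" for S :: "real set"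
      by (intro measurable_completion) (use that in simp)
    show "(\<lambda>x. indicator {0<..<1} x * (indicator {a<..b} x * F' x)) \<in> borel_measurable lebesgue"
      by (intro borel_measurable_times m i) auto
    show "(\<lambda>x. indicator {a<..<b} x * F' x) \<in> borel_measurable lebesgue"
      by (intro borel_measurable_times m i) auto
    show "AE x in lebesgue. indicator {0<..<1} x * (indicator {a<..b} x * F' x) = indicator {a<..<b} x * F' x"
      using AE_completion[OF AE_lborel_singleton[of b]]
      by eventually_elim (use ab in \<open>auto simp: indicator_def\<close>)
  qed
  also have "\<dots> = integral\<^sup>L (lebesgue_on {a<..<b}) F'"
    by (subst integral_restrict_space) auto
  also have "\<dots> = integral {a<..<b} F'"
  proof (rule lebesgue_integral_eq_integral)
    have "integrable (lebesgue_on {a..b}) F'"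
      by (rule continuous_imp_integrable_real) (rule continuous_on_subset[OF c], simp)
    then have "set_integrable lebesgue {a..b} F'"
      by (simp add: integrable_restrict_space set_integrable_def)
    then have "set_integrable lebesgue {a<..<b} F'"
      by (rule set_integrable_subset) auto
    then show "integrable (lebesgue_on {a<..<b}) F'"
      by (simp add: integrable_restrict_space set_integrable_def)
  qed auto
  also have "\<dots> = integral {a..b} F'" by (rule integral_open_interval_real[symmetric])
  also have "\<dots> = F b - F a"
    by (intro integral_unique fundamental_theorem_of_calculus ab)
       (meson F has_field_derivative_at_within has_real_derivative_iff_has_vector_derivative)
  finally show ?thesis .
qed

text \<open>Integration by parts is exact for step functions: with f sampled at the right end and
  \<phi> at the left end of each cell, the sum telescopes to boundary values of f \<phi>, which are
  zero. Only the limit on both sides remains.\<close>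

lemma weak_derivativeI_incr:
  assumes f: "continuous_on {0..1} f" and g: "g \<in> L2 UI"
    and inc: "\<And>a b. 0 \<le> a \<Longrightarrow> a \<le> b \<Longrightarrow> b \<le> 1 \<Longrightarrow> incr g a b = f b - f a"
  shows "has_weak_derivative f g"
  unfolding has_weak_derivative_def
proof (intro allI impI)
  fix \<phi> :: "real \<Rightarrow> real" assume t: "test_function \<phi>"
  then obtain D where D: "\<And>x. (\<phi> has_real_derivative D x) (at x)" "continuous_on UNIV D"
    unfolding test_function_def C1_differentiable_on_def
    by (auto simp: has_real_derivative_iff_has_vector_derivative)
  have dD: "deriv \<phi> = D" using D(1) DERIV_imp_deriv by blast
  have c\<phi>: "continuous_on {0..1} \<phi>"
    using D(1) by (intro DERIV_continuous_on) (auto intro: has_field_derivative_at_within)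
  have cD: "continuous_on {0..1} D" using D(2) continuous_on_subset by blast
  have z: "\<phi> 0 = 0" "\<phi> 1 = 0" using t by (auto simp: test_function_def)
  let ?t = "\<lambda>N j. real j / 2 ^ N"
  have Suc1: "real (j + 1) = real (Suc j)" for j :: nat by simp
  have eq: "(LINT x|UI. step_fun N (\<lambda>j. f (?t N (j + 1))) x * D x) =
     - (LINT x|UI. step_fun N (\<lambda>j. \<phi> (?t N (j + 0))) x * g x)" for N
  proof -
    have "(LINT x|UI. step_fun N (\<lambda>j. f (?t N (j + 1))) x * D x) +
       (LINT x|UI. step_fun N (\<lambda>j. \<phi> (?t N (j + 0))) x * g x) =
       (\<Sum>j<2 ^ N. f (?t N (Suc j)) * incr D (?t N j) (?t N (Suc j)) + \<phi> (?t N j) * incr g (?t N j) (?t N (Suc j)))"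
      using cont_integrable_UI[OF cD] L2_UI_integrable[OF g]
      by (simp add: integral_step_fun sum.distrib del: of_nat_Suc)
    also have "\<dots> = (\<Sum>j<2 ^ N. f (?t N (Suc j)) * \<phi> (?t N (Suc j)) - f (?t N j) * \<phi> (?t N j))"
    proof (rule sum.cong[OF refl])
      fix j assume "j \<in> {..<2 ^ N :: nat}"
      then have j: "0 \<le> ?t N j" "?t N j \<le> ?t N (Suc j)" "?t N (Suc j) \<le> 1"
        using dyadic_in_unit[of "Suc j" N] by (auto simp: field_simps)
      show "f (?t N (Suc j)) * incr D (?t N j) (?t N (Suc j)) + \<phi> (?t N j) * incr g (?t N j) (?t N (Suc j)) =
        f (?t N (Suc j)) * \<phi> (?t N (Suc j)) - f (?t N j) * \<phi> (?t N j)"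
        unfolding inc[OF j] incr_FTC[OF D j] by (simp add: algebra_simps)
    qed
    also have "\<dots> = 0"
      by (subst sum_lessThan_telescope) (simp add: z)
    finally show ?thesis by simp
  qed
  have "(\<lambda>N. LINT x|UI. step_fun N (\<lambda>j. f (?t N (j + 1))) x * D x)
     \<longlonglongrightarrow> (LINT x|UI. f x * D x)"
    by (rule step_fun_tendsto[OF f cont_integrable_UI[OF cD]]) simp
  moreover have "(\<lambda>N. - (LINT x|UI. step_fun N (\<lambda>j. \<phi> (?t N (j + 0))) x * g x))
     \<longlonglongrightarrow> - (LINT x|UI. \<phi> x * g x)"
    by (intro tendsto_minus step_fun_tendsto[OF c\<phi> L2_UI_integrable[OF g]]) simp
  ultimately have "(LINT x|UI. f x * D x) = - (LINT x|UI. \<phi> x * g x)"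
    unfolding eq by (rule LIMSEQ_unique)
  then show "(LINT x|UI. f x * deriv \<phi> x) = - (LINT x|UI. g x * \<phi> x)"
    by (simp add: dD mult.commute)
qed

section \<open>Dyadic difference quotients as a martingale\<close>

lemma incr_from_0:
  assumes "integrable UI g" "0 \<le> a" "a \<le> b"
  shows "incr g a b = incr g 0 b - incr g 0 a"
  using incr_combine[OF assms] by simp

lemma incr_dyadic_step_fun:
  assumes "k \<le> 2 ^ N"
  shows "incr (step_fun N (\<lambda>j. 2 ^ N * (f (real (Suc j) / 2 ^ N) - f (real j / 2 ^ N)))) 0 (real k / 2 ^ N) = f (real k / 2 ^ N) - f 0"
    (is "incr ?g _ _ = _")
proof -
  have "incr ?g 0 (real k / 2 ^ N) = (\<Sum>j<k. incr ?g (real j / 2 ^ N) (real (Suc j) / 2 ^ N))"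
    by (rule incr_sum_dyadic[symmetric, OF L2_UI_integrable[OF step_fun_L2]])
  also have "\<dots> = (\<Sum>j<k. f (real (Suc j) / 2 ^ N) - f (real j / 2 ^ N))"
    by (rule sum.cong[OF refl], subst incr_step_fun) (use assms in auto)
  also have "\<dots> = f (real k / 2 ^ N) - f 0"
    by (subst sum_lessThan_telescope[of "\<lambda>j. f (real j / 2 ^ N)"]) simp
  finally show ?thesis .
qed

text \<open>The derivative of the piecewise linear interpolant of f at level N;
  \<open>dyad N f f\<close> is its squared L2 norm.\<close>

definition dstep :: "(real \<Rightarrow> real) \<Rightarrow> nat \<Rightarrow> real \<Rightarrow> real" where
  "dstep f N = step_fun N (\<lambda>j. 2 ^ N * (f (real (Suc j) / 2 ^ N) - f (real j / 2 ^ N)))"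

lemma dstep_L2: "dstep f N \<in> L2 UI"
  unfolding dstep_def by (rule step_fun_L2)

lemma incr_dstep_0:
  assumes "N \<le> N'" "k \<le> 2 ^ N"
  shows "incr (dstep f N') 0 (real k / 2 ^ N) = f (real k / 2 ^ N) - f 0"
proof -
  have e: "real k / 2 ^ N = real (k * 2 ^ (N' - N)) / 2 ^ N'"
    using assms(1) by (simp add: field_simps flip: power_add)
  have "k * 2 ^ (N' - N) \<le> 2 ^ N * 2 ^ (N' - N)" using assms(2) by (rule mult_right_mono) simp
  also have "\<dots> = 2 ^ N'" using assms(1) by (simp flip: power_add)
  finally show ?thesis unfolding e dstep_def by (rule incr_dyadic_step_fun)
qed

text \<open>Martingale property: over a cell of level N every finer quotient integrates to the same
  increment of f, so pairing with the coarse quotient sees only the coarse energy. Squared L2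
  distances between levels are therefore differences of energies.\<close>

lemma integral_dstep_mult:
  assumes "N \<le> N'"
  shows "(LINT x|UI. dstep f N x * dstep f N' x) = dyad N f f"
proof -
  have i: "integrable UI (dstep f N')" by (rule L2_UI_integrable[OF dstep_L2])
  have "(LINT x|UI. dstep f N x * dstep f N' x) =
    (\<Sum>j<2 ^ N. 2 ^ N * (f (real (Suc j) / 2 ^ N) - f (real j / 2 ^ N)) * incr (dstep f N') (real j / 2 ^ N) (real (Suc j) / 2 ^ N))"
    unfolding dstep_def[of f N] by (rule integral_step_fun[OF i])
  also have "\<dots> = (\<Sum>j<2 ^ N. 2 ^ N * (f (real (Suc j) / 2 ^ N) - f (real j / 2 ^ N)) * (f (real (Suc j) / 2 ^ N) - f (real j / 2 ^ N)))"
  proof (rule sum.cong[OF refl])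
    fix j assume "j \<in> {..<2 ^ N :: nat}"
    then have j: "Suc j \<le> 2 ^ N" "j \<le> 2 ^ N" by auto
    have "incr (dstep f N') (real j / 2 ^ N) (real (Suc j) / 2 ^ N) = f (real (Suc j) / 2 ^ N) - f (real j / 2 ^ N)"
      by (subst incr_from_0[OF i]) (auto simp: incr_dstep_0[OF assms j(1)] incr_dstep_0[OF assms j(2)] divide_right_mono simp del: of_nat_Suc)
    then show "2 ^ N * (f (real (Suc j) / 2 ^ N) - f (real j / 2 ^ N)) * incr (dstep f N') (real j / 2 ^ N) (real (Suc j) / 2 ^ N) = 2 ^ N * (f (real (Suc j) / 2 ^ N) - f (real j / 2 ^ N)) * (f (real (Suc j) / 2 ^ N) - f (real j / 2 ^ N))"
      by simp
  qed
  also have "\<dots> = dyad N f f"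
    by (simp add: dyad_def sum_distrib_left mult.assoc)
  finally show ?thesis .
qed

lemma integral_dstep_diff_square:
  assumes "N \<le> N'"
  shows "(LINT x|UI. (dstep f N' x - dstep f N x)\<^sup>2) = dyad N' f f - dyad N f f"
proof -
  have "(LINT x|UI. (dstep f N' x - dstep f N x)\<^sup>2) =
    (LINT x|UI. dstep f N' x * dstep f N' x + dstep f N x * dstep f N x - 2 * (dstep f N x * dstep f N' x))"
    by (simp add: power2_eq_square algebra_simps)
  also have "\<dots> = dyad N' f f + dyad N f f - 2 * dyad N f f"
    using L2_integrable_mult[OF dstep_L2 dstep_L2, of f N f N'] L2_integrable_mult[OF dstep_L2 dstep_L2, of f N f N]
      L2_integrable_mult[OF dstep_L2 dstep_L2, of f N' f N'] assms
    by (simp add: integral_dstep_mult)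
  finally show ?thesis by simp
qed

lemma L1_le_L2:
  assumes "g \<in> L2 UI"
  shows "(LINT x|UI. \<bar>g x\<bar>)\<^sup>2 \<le> (LINT x|UI. (g x)\<^sup>2)"
proof -
  have "(\<lambda>x. \<bar>g x\<bar>) \<in> L2 UI" using assms by (auto simp: L2_def)
  from incr_square_le[OF this, of 0 1] show ?thesis by (simp add: incr_0_1)
qed

lemma abs_incr_le:
  assumes "integrable UI g"
  shows "\<bar>incr g a b\<bar> \<le> (LINT x|UI. \<bar>g x\<bar>)"
proof -
  have "\<bar>incr g a b\<bar> \<le> (LINT x|UI. \<bar>indicator {a<..b} x * g x\<bar>)"
    unfolding incr_def by (rule integral_abs_bound)
  also have "\<dots> \<le> (LINT x|UI. \<bar>g x\<bar>)"
    using assms ind_integrable_UI[OF assms]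
    by (intro integral_mono integrable_abs) (auto simp: indicator_def)
  finally show ?thesis .
qed

text \<open>The dyadic difference quotients form an $L^2$-bounded martingale; a subsequence with summable
  $L^1$-increments converges almost everywhere, and its limit is the derivative.\<close>

lemma dyad_bounded_imp_derivative:
  assumes f: "continuous_on {0..1} f" and C: "\<And>N. dyad N f f \<le> C"
  obtains h where "h \<in> L2 UI"
    "\<And>a b. 0 \<le> a \<Longrightarrow> a \<le> b \<Longrightarrow> b \<le> 1 \<Longrightarrow> incr h a b = f b - f a"
    "(LINT x|UI. (h x)\<^sup>2) \<le> C"
proof -
  let ?M = UI
  let ?d = "\<lambda>N. dyad N f f"
  have inc: "incseq ?d" by (simp add: incseq_def dyad_mono)
  obtain L where L: "?d \<longlonglongrightarrow> L" "\<And>N. ?d N \<le> L"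
    using incseq_convergent[OF inc] C by metis
  have LC: "L \<le> C" by (rule LIMSEQ_le_const2[OF L(1)]) (use C in blast)
  \<comment> \<open>The tolerance is a square: Cauchy-Schwarz turns an energy gap of
    \<open>(1/4) ^ k\<close> into an L1 increment of at most \<open>(1/2) ^ k\<close>, which is
    summable.\<close>
  have "\<exists>N. L - ?d N < (1/4) ^ k" for k :: nat
  proof -
    have "L - (1/4) ^ k < L" by simp
    from order_tendstoD(1)[OF L(1) this] obtain N where "L - (1/4) ^ k < ?d N"
      by (auto simp: eventually_sequentially)
    then show ?thesis by (intro exI[of _ N]) linarith
  qed
  then obtain n' where n': "\<And>k. L - ?d (n' k) < (1/4) ^ k" by metis
  \<comment> \<open>The partial sums make the levels monotone, and the summand k drives them to
    infinity.\<close>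
  define n where "n k = k + (\<Sum>i\<le>k. n' i)" for k
  have n_ge: "n' k \<le> n k" for k
    unfolding n_def using member_le_sum[of k "{..k}" n'] by simp
  have n_k: "k \<le> n k" for k by (simp add: n_def)
  have n_mono: "n k \<le> n (Suc k)" for k by (simp add: n_def)
  have n: "L - ?d (n k) < (1/4) ^ k" for k
    using n'[of k] dyad_mono[OF n_ge[of k], of f] by linarith
  define s where "s k = dstep f (n k)" for k
  define D where "D k x = s (Suc k) x - s k x" for k x
  have sL2: "s k \<in> L2 ?M" for k by (simp add: s_def dstep_L2)
  have DL2: "D k \<in> L2 ?M" for k unfolding D_def by (rule L2_diff[OF sL2 sL2])
  have si: "integrable ?M (s k)" for k by (rule L2_UI_integrable[OF sL2])
  have Di: "integrable ?M (D k)" for k by (rule L2_UI_integrable[OF DL2])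
  have D1: "(LINT x|?M. \<bar>D k x\<bar>) \<le> (1/2) ^ k" for k
  proof (rule power2_le_imp_le)
    have "(LINT x|?M. \<bar>D k x\<bar>)\<^sup>2 \<le> (LINT x|?M. (D k x)\<^sup>2)" by (rule L1_le_L2[OF DL2])
    also have "\<dots> = ?d (n (Suc k)) - ?d (n k)"
      unfolding D_def s_def by (rule integral_dstep_diff_square[OF n_mono])
    also have "\<dots> \<le> (1/4) ^ k" using n[of k] L(2)[of "n (Suc k)"] by linarith
    also have "\<dots> = ((1/2) ^ k)\<^sup>2" by (simp add: power2_eq_square flip: power_mult_distrib)
    finally show "(LINT x|?M. \<bar>D k x\<bar>)\<^sup>2 \<le> ((1/2) ^ k)\<^sup>2" .
  qed simp
  have sumD: "summable (\<lambda>k. LINT x|?M. norm (D k x))"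
    by (rule summable_comparison_test[of _ "\<lambda>k. (1/2) ^ k"])
      (use D1 in \<open>auto intro!: exI[of _ 0] integral_nonneg_AE simp: summable_geometric_iff\<close>)
  have AEs: "AE x in ?M. summable (\<lambda>k. norm (D k x))"
  proof -
    have "(\<integral>\<^sup>+ x. (\<Sum>k. ennreal (norm (D k x))) \<partial>?M) = (\<Sum>k. \<integral>\<^sup>+ x. ennreal (norm (D k x)) \<partial>?M)"
      using Di by (intro nn_integral_suminf) auto
    also have "\<dots> = (\<Sum>k. ennreal (LINT x|?M. norm (D k x)))"
      by (intro suminf_cong nn_integral_eq_integral) (use Di in auto)
    also have "\<dots> = ennreal (\<Sum>k. LINT x|?M. norm (D k x))"
      by (rule suminf_ennreal2[OF _ sumD]) simp
    finally have "(\<integral>\<^sup>+ x. (\<Sum>k. ennreal (norm (D k x))) \<partial>?M) \<noteq> \<infinity>" by simp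
    then have "AE x in ?M. (\<Sum>k. ennreal (norm (D k x))) \<noteq> \<infinity>"
      using Di by (intro nn_integral_PInf_AE) auto
    then show ?thesis
      by eventually_elim (auto intro!: summable_suminf_not_top)
  qed
  define w where "w x = \<bar>s 0 x\<bar> + (\<Sum>k. norm (D k x))" for x
  have wi: "integrable ?M w"
    unfolding w_def using si
    by (intro Bochner_Integration.integrable_add integrable_abs integrable_suminf integrable_norm Di)
       (use AEs sumD in auto)
  define h where "h x = s 0 x + (\<Sum>k. D k x)" for x
  have hm: "h \<in> borel_measurable ?M"
    unfolding h_def using si Di by (intro borel_measurable_add borel_measurable_suminf) auto
  have s_eq: "s k x = s 0 x + (\<Sum>i<k. D i x)" for k x
    unfolding D_def by (subst sum_lessThan_telescope) simp
  have lim: "AE x in ?M. (\<lambda>k. s k x) \<longlonglongrightarrow> h x"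
    using AEs
  proof eventually_elim
    case (elim x)
    then have "(\<lambda>k. D k x) sums (\<Sum>k. D k x)" by (rule summable_sums[OF summable_norm_cancel])
    then have "(\<lambda>k. s 0 x + (\<Sum>i<k. D i x)) \<longlonglongrightarrow> h x"
      unfolding h_def sums_def by (intro tendsto_intros)
    then show ?case by (simp only: s_eq[symmetric])
  qed
  have bound: "AE x in ?M. norm (s k x) \<le> w x" for k
    using AEs
  proof eventually_elim
    case (elim x)
    have "\<bar>\<Sum>i<k. D i x\<bar> \<le> (\<Sum>i<k. norm (D i x))" using norm_sum[of "\<lambda>i. D i x"] by simp
    also have "\<dots> \<le> (\<Sum>k. norm (D k x))" by (rule sum_le_suminf[OF elim]) auto
    finally show ?case using s_eq[of k x] unfolding w_def real_norm_def by linarith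
  qed
  have hb: "AE x in ?M. norm (h x) \<le> w x"
    using AEs
  proof eventually_elim
    case (elim x)
    have "norm (\<Sum>k. D k x) \<le> (\<Sum>k. norm (D k x))" by (rule summable_norm[OF elim])
    then show ?case unfolding h_def w_def by simp
  qed
  have hi: "integrable ?M h"
    by (rule Bochner_Integration.integrable_bound[OF wi hm]) (use hb in \<open>auto elim!: eventually_mono\<close>)
  have L1: "(\<lambda>k. LINT x|?M. \<bar>s k x - h x\<bar>) \<longlonglongrightarrow> (LINT x|?M. 0)"
  proof (rule integral_dominated_convergence[where w = "\<lambda>x. 2 * w x"])
    show "AE x in ?M. (\<lambda>k. \<bar>s k x - h x\<bar>) \<longlonglongrightarrow> 0"
      using lim by eventually_elim (simp add: tendsto_rabs_zero LIM_zero)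
    show "AE x in ?M. norm \<bar>s k x - h x\<bar> \<le> 2 * w x" for k
      using bound[of k] hb by eventually_elim simp
    show "(\<lambda>x. \<bar>s k x - h x\<bar>) \<in> borel_measurable ?M" for k
      using si[of k] hm by auto
  qed (use wi in auto)
  \<comment> \<open>Fatou's lemma along the subsequence bounds the norm of the limit.\<close>
  have hsq: "(\<integral>\<^sup>+ x. ennreal ((h x)\<^sup>2) \<partial>?M) \<le> ennreal C"
  proof -
    have "(\<integral>\<^sup>+ x. ennreal ((h x)\<^sup>2) \<partial>?M) = (\<integral>\<^sup>+ x. liminf (\<lambda>k. ennreal ((s k x)\<^sup>2)) \<partial>?M)"
    proof (rule nn_integral_cong_AE)
      show "AE x in ?M. ennreal ((h x)\<^sup>2) = liminf (\<lambda>k. ennreal ((s k x)\<^sup>2))"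
        using lim
      proof eventually_elim
        case (elim x)
        then have "(\<lambda>k. ennreal ((s k x)\<^sup>2)) \<longlonglongrightarrow> ennreal ((h x)\<^sup>2)" by (intro tendsto_intros)
        then show ?case by (intro lim_imp_Liminf[symmetric]) auto
      qed
    qed
    also have "\<dots> \<le> liminf (\<lambda>k. \<integral>\<^sup>+ x. ennreal ((s k x)\<^sup>2) \<partial>?M)"
      using si by (intro nn_integral_liminf) auto
    also have "\<dots> \<le> ennreal C"
    proof (rule order_trans[OF Liminf_le_Limsup Limsup_bounded], simp, rule always_eventually, intro allI)
      fix k
      have "(\<integral>\<^sup>+ x. ennreal ((s k x)\<^sup>2) \<partial>?M) = ennreal (LINT x|?M. (s k x)\<^sup>2)"
        by (rule nn_integral_eq_integral) (use sL2[of k] in \<open>auto simp: L2_def\<close>)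
      also have "(LINT x|?M. (s k x)\<^sup>2) = ?d (n k)"
        unfolding s_def power2_eq_square by (rule integral_dstep_mult) simp
      finally show "(\<integral>\<^sup>+ x. ennreal ((s k x)\<^sup>2) \<partial>?M) \<le> ennreal C" using C by (simp add: ennreal_leI)
    qed
    finally show ?thesis .
  qed
  have hint: "integrable ?M (\<lambda>x. (h x)\<^sup>2)"
    by (rule integrableI_bounded) (use hm hsq in \<open>auto simp: less_top[symmetric] top_unique\<close>)
  have C0: "0 \<le> C" using C[of 0] dyad_nonneg[of 0 f] by linarith
  have hC: "(LINT x|?M. (h x)\<^sup>2) \<le> C"
  proof -
    have "ennreal (LINT x|?M. (h x)\<^sup>2) \<le> ennreal C"
      using hsq nn_integral_eq_integral[OF hint] by simp
    then show ?thesis using C0 by (simp add: ennreal_le_iff)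
  qed
  have inc0: "incr h 0 x = f x - f 0" if x: "0 \<le> x" "x \<le> 1" for x
  proof -
    \<comment> \<open>The point x is rounded down to the grid of level \<open>n k\<close>, on which
      the increments of \<open>s k\<close> are exactly those of f.\<close>
    define j where "j k = nat \<lfloor>2 ^ n k * x\<rfloor>" for k
    define y where "y k = real (j k) / 2 ^ n k" for k
    have rj: "real (j k) = of_int \<lfloor>2 ^ n k * x\<rfloor>" for k using x by (simp add: j_def)
    have "real (j k) \<le> 2 ^ n k * x" for k unfolding rj by simp
    also have "2 ^ n k * x \<le> 2 ^ n k" for k using x by simp
    finally have jk: "j k \<le> 2 ^ n k" for k by simp
    have y01: "y k \<in> {0..1}" for k unfolding y_def by (rule dyadic_in_unit[OF jk])
    have yx: "\<bar>y k - x\<bar> \<le> (1/2) ^ k" for k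
    proof -
      have a: "real (j k) \<le> 2 ^ n k * x" "2 ^ n k * x < real (j k) + 1" unfolding rj by linarith+
      have "y k * 2 ^ n k = real (j k)" by (simp add: y_def)
      then have "(y k - x) * 2 ^ n k = real (j k) - 2 ^ n k * x" by (simp add: algebra_simps)
      then have "\<bar>y k - x\<bar> * 2 ^ n k = \<bar>real (j k) - 2 ^ n k * x\<bar>"
        by (metis abs_mult abs_numeral power_abs)
      also have "\<dots> \<le> 1" using a by linarith
      finally have "\<bar>y k - x\<bar> \<le> 1 / 2 ^ n k" by (simp add: field_simps)
      also have "\<dots> \<le> 1 / 2 ^ k" using n_k[of k] by (simp add: field_simps)
      finally show ?thesis by (simp add: power_divide)
    qed
    have "(\<lambda>k. y k - x) \<longlonglongrightarrow> 0"
      by (rule Lim_null_comparison[OF _ LIMSEQ_power_zero[of "1/2 :: real"]]) (use yx in auto)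
    then have yl: "y \<longlonglongrightarrow> x" by (simp add: LIM_zero_iff)
    have fy: "(\<lambda>k. f (y k)) \<longlonglongrightarrow> f x"
      using f y01 yl x by (auto simp: continuous_on_sequentially o_def)
    have e: "incr (s k) 0 (y k) = f (y k) - f 0" for k
      unfolding s_def y_def by (rule incr_dstep_0[OF order_refl jk])
    have "(\<lambda>k. incr (s k) 0 (y k) - incr h 0 (y k)) \<longlonglongrightarrow> 0"
    proof (rule Lim_null_comparison)
      show "(\<lambda>k. LINT x|?M. \<bar>s k x - h x\<bar>) \<longlonglongrightarrow> 0" using L1 by simp
      show "\<forall>\<^sub>F k in sequentially. norm (incr (s k) 0 (y k) - incr h 0 (y k)) \<le> (LINT x|?M. \<bar>s k x - h x\<bar>)"
        using abs_incr_le[of "\<lambda>x. s k x - h x" 0 "y k" for k] si hi by (auto simp: incr_diff)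
    qed
    moreover have "(\<lambda>k. incr h 0 (y k)) \<longlonglongrightarrow> incr h 0 x" by (rule incr_tendsto[OF hi _ yl]) simp
    ultimately have "(\<lambda>k. (incr (s k) 0 (y k) - incr h 0 (y k)) + incr h 0 (y k)) \<longlonglongrightarrow> 0 + incr h 0 x"
      by (rule tendsto_add)
    then have "(\<lambda>k. f (y k) - f 0) \<longlonglongrightarrow> incr h 0 x" by (simp add: e)
    moreover have "(\<lambda>k. f (y k) - f 0) \<longlonglongrightarrow> f x - f 0" by (intro tendsto_intros fy)
    ultimately show ?thesis by (rule LIMSEQ_unique)
  qed
  show ?thesis
  proof (rule that[of h])
    show "h \<in> L2 ?M" using hm hint by (simp add: L2_def)
    show "incr h a b = f b - f a" if "0 \<le> a" "a \<le> b" "b \<le> 1" for a b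
      using that incr_from_0[OF hi, of a b] inc0[of a] inc0[of b] by simp
  qed (rule hC)
qed

text \<open>Dynkin's lemma carries the vanishing integrals from half-open intervals to all Borel
  sets, and a Lebesgue set differs from a Borel set by part of a null set. Applied to a difference,
  this says that increments determine a derivative almost everywhere.\<close>

lemma AE_zero_if_incr_zero:
  assumes k: "integrable UI k"
    and z: "\<And>a b. 0 \<le> a \<Longrightarrow> a \<le> b \<Longrightarrow> b \<le> 1 \<Longrightarrow> incr k a b = 0"
  shows "AE x in UI. k x = 0"
proof -
  interpret finite_measure UI by (rule finite_measure_UI)
  let ?M = UI
  have im: "(\<lambda>x. indicator A x :: real) \<in> borel_measurable ?M" if "A \<in> sets borel" for A :: "real set"
    by (rule borel_meas_UI) (use that in simp)
  have ii: "integrable ?M (\<lambda>x. indicator A x * k x :: real)" if "A \<in> sets borel" for A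
  proof (rule Bochner_Integration.integrable_bound[OF k])
    show "(\<lambda>x. indicator A x * k x :: real) \<in> borel_measurable ?M"
      using k im[OF that] by (intro borel_measurable_times) auto
  qed (auto simp: indicator_def)
  have bor: "(LINT x|?M. indicator A x * k x) = 0" if A: "A \<in> sets borel" for A :: "real set"
  proof -
    have st: "Int_stable (range (\<lambda>(a, b). {a<..b::real}))"
    proof (rule Int_stableI)
      fix I J assume "I \<in> range (\<lambda>(a, b). {a<..b::real})" "J \<in> range (\<lambda>(a, b). {a<..b::real})"
      then obtain a b c d where "I = {a<..b}" "J = {c<..d}" by auto
      then have "I \<inter> J = (\<lambda>(a, b). {a<..b}) (max a c, min b d)" by auto
      then show "I \<inter> J \<in> range (\<lambda>(a, b). {a<..b::real})" by blast
    qed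
    have "A \<in> sigma_sets UNIV (range (\<lambda>(a, b). {a<..b::real}))"
      using A by (simp add: borel_sigma_sets_Ioc)
    from st subset_UNIV[of "range (\<lambda>(a, b). {a<..b::real})", folded Pow_UNIV] this show ?thesis
    proof (induction rule: sigma_sets_induct_disjoint)
      case (basic A)
      then obtain a b where A: "A = {a<..b}" by auto
      have "(LINT x|?M. indicator A x * k x) = incr k (max 0 a) (min 1 b)"
        unfolding A incr_def by (rule Bochner_Integration.integral_cong) (auto simp: indicator_def)
      also have "\<dots> = 0"
      proof (cases "max 0 a \<le> min 1 b")
        case True then show ?thesis by (intro z) auto
      next
        case False
        then have "{max 0 a<..min 1 b} = {}" by auto
        then show ?thesis by (simp only: incr_def) simp
      qed
      finally show ?case .
    next
      case empty show ?case by simp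
    next
      case (compl A)
      then have "A \<in> sets borel" by (simp add: borel_sigma_sets_Ioc)
      have "(LINT x|?M. indicator (UNIV - A) x * k x) = (LINT x|?M. k x - indicator A x * k x)"
        by (rule Bochner_Integration.integral_cong) (auto simp: indicator_def)
      also have "\<dots> = incr k 0 1 - (LINT x|?M. indicator A x * k x)"
        using k ii[OF \<open>A \<in> sets borel\<close>] by (simp add: incr_0_1)
      finally show ?case using compl z[of 0 1] by simp
    next
      case (union A)
      have Ab: "A i \<in> sets borel" for i using union(2) by (auto simp: borel_sigma_sets_Ioc)
      have sm: "(\<lambda>i. indicator (A i) x :: real) sums indicator (\<Union>i. A i) x" for x
        by (rule indicator_sums) (use union(1) in \<open>auto simp: disjoint_family_on_def\<close>)
      have "(\<lambda>n. LINT x|?M. (\<Sum>i<n. indicator (A i) x) * k x) \<longlonglongrightarrow> (LINT x|?M. indicator (\<Union>i. A i) x * k x)"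
      proof (rule integral_dominated_convergence[where w = "\<lambda>x. \<bar>k x\<bar>"])
        show "AE x in ?M. (\<lambda>n. (\<Sum>i<n. indicator (A i) x) * k x) \<longlonglongrightarrow> indicator (\<Union>i. A i) x * k x"
          using sm by (intro AE_I2 tendsto_mult_right) (simp add: sums_def)
        show "AE x in ?M. norm ((\<Sum>i<n. indicator (A i) x) * k x) \<le> \<bar>k x\<bar>" for n
        proof (rule AE_I2)
          fix x
          have "(\<Sum>i<n. indicator (A i) x :: real) \<le> indicator (\<Union>i. A i) x"
            using sum_le_suminf[OF sums_summable[OF sm], of "{..<n}" x] sums_unique[OF sm, of x] by simp
          also have "\<dots> \<le> 1" by (simp add: indicator_def)
          finally have "\<bar>\<Sum>i<n. indicator (A i) x :: real\<bar> \<le> 1" by (simp add: sum_nonneg)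
          then show "norm ((\<Sum>i<n. indicator (A i) x) * k x) \<le> \<bar>k x\<bar>"
            by (simp add: abs_mult mult_left_le_one_le)
        qed
        show "(\<lambda>x. indicator (\<Union>i. A i) x * k x) \<in> borel_measurable ?M"
          using ii[of "\<Union>i. A i"] Ab by auto
        show "(\<lambda>x. (\<Sum>i<n. indicator (A i) x) * k x) \<in> borel_measurable ?M" for n
          using k im[OF Ab] by (intro borel_measurable_times borel_measurable_sum) auto
      qed (use k in auto)
      moreover have "(LINT x|?M. (\<Sum>i<n. indicator (A i) x) * k x) = 0" for n
      proof -
        have "(LINT x|?M. (\<Sum>i<n. indicator (A i) x) * k x) = (\<Sum>i<n. LINT x|?M. indicator (A i) x * k x)"
          unfolding sum_distrib_right by (rule Bochner_Integration.integral_sum) (rule ii[OF Ab])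
        then show ?thesis using union by simp
      qed
      ultimately show ?case by (simp add: LIMSEQ_const_iff)
    qed
  qed
  show ?thesis
  proof (rule density_zero[OF k])
    fix A assume "A \<in> sets ?M"
    then obtain A' where A': "A' \<in> sets lebesgue" "A = A' \<inter> {0<..<1}"
      by (auto simp: sets_restrict_space)
    from sets_completionE[OF A'(1)] obtain S N N' where S: "A' = S \<union> N" "N \<subseteq> N'" "N' \<in> null_sets lborel" "S \<in> sets lborel"
      by metis
    have "AE x in lebesgue. x \<notin> N'" by (rule AE_completion[OF AE_not_in[OF S(3)]])
    then have ae: "AE x in ?M. x \<notin> N'" by (subst AE_restrict_space_iff) (auto elim: eventually_mono)
    have "set_lebesgue_integral ?M A k = (LINT x|?M. indicator S x * k x)"
      unfolding set_lebesgue_integral_def real_scaleR_def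
    proof (rule integral_cong_AE)
      show "AE x in ?M. indicator A x * k x = indicator S x * k x"
        using ae AE_space by eventually_elim (use S(1,2) A'(2) in \<open>auto simp: indicator_def\<close>)
      show "(\<lambda>x. indicator A x * k x) \<in> borel_measurable ?M"
        using k \<open>A \<in> sets ?M\<close> by (intro borel_measurable_times borel_measurable_indicator) auto
      show "(\<lambda>x. indicator S x * k x) \<in> borel_measurable ?M"
        using ii[of S] S(4) by auto
    qed
    also have "\<dots> = 0" using S(4) by (intro bor) simp
    finally show "set_lebesgue_integral ?M A k = 0" .
  qed
qed

section \<open>From weak derivatives to increments\<close>

lemma DERIV_affine:
  assumes "(f has_real_derivative D) (at (m * (x - a)))"
  shows "((\<lambda>x. f (m * (x - a))) has_real_derivative m * D) (at x)"
proof -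
  have "((\<lambda>x. m * (x - a)) has_real_derivative m) (at x)" by (auto intro!: derivative_eq_intros)
  from DERIV_chain'[OF this assms] show ?thesis by (simp add: mult.commute)
qed

lemma has_derivative_pos_part_square:
  "((\<lambda>x::real. (max 0 x)\<^sup>2) has_real_derivative 2 * max 0 x) (at x)"
proof -
  consider "x > 0" | "x < 0" | "x = 0" by linarith
  then show ?thesis
  proof cases
    case 1
    have "((\<lambda>x::real. x\<^sup>2) has_real_derivative 2 * x) (at x)" by (auto intro!: derivative_eq_intros)
    then have "((\<lambda>x::real. (max 0 x)\<^sup>2) has_real_derivative 2 * x) (at x)"
      by (rule has_field_derivative_transform_within_open[of _ _ _ "{0<..}"]) (use 1 in auto)
    with 1 show ?thesis by simp
  next
    case 2
    have "((\<lambda>x::real. 0) has_real_derivative 0) (at x)" by simp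
    then have "((\<lambda>x::real. (max 0 x)\<^sup>2) has_real_derivative 0) (at x)"
      by (rule has_field_derivative_transform_within_open[of _ _ _ "{..<0}"]) (use 2 in auto)
    with 2 show ?thesis by simp
  next
    case 3
    have "((\<lambda>h. ((max 0 (0 + h))\<^sup>2 - (max 0 (0::real))\<^sup>2) / h) \<longlongrightarrow> 0) (at 0)"
    proof (rule Lim_null_comparison[of _ "\<lambda>h. \<bar>h\<bar>"])
      show "\<forall>\<^sub>F h in at (0::real). norm (((max 0 (0 + h))\<^sup>2 - (max 0 (0::real))\<^sup>2) / h) \<le> \<bar>h\<bar>"
        by (rule always_eventually) (auto simp: max_def power2_eq_square)
      show "((\<lambda>h::real. \<bar>h\<bar>) \<longlongrightarrow> 0) (at 0)" by (rule tendsto_rabs_zero) simp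
    qed
    then show ?thesis using 3 by (simp add: DERIV_def)
  qed
qed

text \<open>A C1 step from 0 to 1 across the unit interval, whose derivative \<open>tent\<close> is
  the hat of height 2. Squared positive parts are smooth enough because test functions are only
  required to be C1.\<close>

definition ramp :: "real \<Rightarrow> real" where
  "ramp x = 2 * (max 0 x)\<^sup>2 - 4 * (max 0 (x - 1/2))\<^sup>2 + 2 * (max 0 (x - 1))\<^sup>2"

definition tent :: "real \<Rightarrow> real" where
  "tent x = 4 * max 0 x - 8 * max 0 (x - 1/2) + 4 * max 0 (x - 1)"

lemma ramp_deriv: "(ramp has_real_derivative tent x) (at x)"
proof -
  have 1: "((\<lambda>x. (max 0 (x - c))\<^sup>2) has_real_derivative 2 * max 0 (x - c)) (at x)" for c
    using DERIV_affine[of "\<lambda>x. (max 0 x)\<^sup>2" _ 1 x c] has_derivative_pos_part_square[of "x - c"] by simp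
  have "((\<lambda>x. 2 * (max 0 x)\<^sup>2 - 4 * (max 0 (x - 1/2))\<^sup>2 + 2 * (max 0 (x - 1))\<^sup>2) has_real_derivative
     2 * (2 * max 0 x) - 4 * (2 * max 0 (x - 1/2)) + 2 * (2 * max 0 (x - 1))) (at x)"
    by (intro DERIV_add DERIV_diff DERIV_cmult 1 has_derivative_pos_part_square)
  then show ?thesis by (simp add: ramp_def[abs_def] tent_def)
qed

lemma ramp_le_0: "x \<le> 0 \<Longrightarrow> ramp x = 0"
  by (simp add: ramp_def max_def)

lemma ramp_ge_1: "x \<ge> 1 \<Longrightarrow> ramp x = 1"
  by (simp add: ramp_def max_def power2_eq_square algebra_simps)

lemma tent_nonneg: "0 \<le> tent x"
  by (auto simp: tent_def max_def)

lemma tent_outside: "x \<le> 0 \<or> x \<ge> 1 \<Longrightarrow> tent x = 0"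
  by (auto simp: tent_def max_def)

lemma ramp_bounds: "0 \<le> ramp x" "ramp x \<le> 1"
proof -
  have m: "ramp a \<le> ramp b" if "a \<le> b" for a b
    by (rule DERIV_nonneg_imp_nondecreasing[OF that]) (use ramp_deriv tent_nonneg in blast)
  show "0 \<le> ramp x" using m[of "min 0 x" x] ramp_le_0[of "min 0 x"] by simp
  show "ramp x \<le> 1" using m[of x "max 1 x"] ramp_ge_1[of "max 1 x"] by simp
qed

text \<open>An approximate identity from the right: the rescaled hat has integral 1 and lives on
  [a, a + 1/n].\<close>

lemma tent_concentrates:
  assumes f: "continuous_on {0..1} f" and a: "0 < a" "a < 1"
  shows "(\<lambda>n. LINT x|UI. f x * (real n * tent (real n * (x - a)))) \<longlonglongrightarrow> f a"
proof (rule LIMSEQ_I)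
  fix e :: real assume "0 < e"
  then have e2: "0 < e / 2" by simp
  from f a have "continuous (at a within {0..1}) f" by (auto simp: continuous_on_eq_continuous_within)
  then obtain d where d: "0 < d" "\<And>x. x \<in> {0..1} \<Longrightarrow> \<bar>x - a\<bar> < d \<Longrightarrow> \<bar>f x - f a\<bar> < e / 2"
    unfolding continuous_within_eps_delta dist_real_def using e2 by metis
  obtain n0 :: nat where n0: "1 / min d (1 - a) < real n0" using reals_Archimedean2 by blast
  show "\<exists>no. \<forall>n\<ge>no. norm ((LINT x|UI. f x * (real n * tent (real n * (x - a)))) - f a) < e"
  proof (intro exI[of _ n0] allI impI)
    fix n assume "n0 \<le> n"
    with n0 have nn: "1 / min d (1 - a) < real n" by linarith
    have mp: "0 < min d (1 - a)" using d(1) a by simp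
    then have n0': "0 < real n" using nn by (meson less_trans zero_less_divide_1_iff)
    have "1 < real n * min d (1 - a)" using nn mp by (simp add: field_simps)
    then have nd: "1 < real n * d" and na: "1 < real n * (1 - a)"
      using n0' by (smt (verit, best) mult_left_mono)+
    define T where "T x = real n * tent (real n * (x - a))" for x
    have cT: "continuous_on S T" for S
      unfolding T_def tent_def by (intro continuous_intros)
    have dT: "((\<lambda>x. ramp (real n * (x - a))) has_real_derivative T x) (at x)" for x
      unfolding T_def by (rule DERIV_affine[OF ramp_deriv])
    have "incr T 0 1 = ramp (real n * (1 - a)) - ramp (real n * (0 - a))"
      by (rule incr_FTC[OF dT cT]) auto
    also have "\<dots> = 1" using na a by (simp add: ramp_ge_1 ramp_le_0)
    finally have T1: "(LINT x|UI. T x) = 1" by (simp add: incr_0_1)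
    have iT: "integrable UI T" by (rule cont_integrable_UI[OF cT])
    have ifT: "integrable UI (\<lambda>x. f x * T x)"
      by (intro cont_integrable_UI continuous_intros f cT)
    have "(LINT x|UI. f x * T x) - f a = (LINT x|UI. f x * T x - f a * T x)"
      using iT ifT T1 by simp
    also have "\<bar>\<dots>\<bar> \<le> (LINT x|UI. \<bar>f x * T x - f a * T x\<bar>)"
      by (rule integral_abs_bound)
    also have "\<dots> \<le> (LINT x|UI. e / 2 * T x)"
    proof (rule integral_mono)
      fix x assume "x \<in> space UI"
      then have x: "x \<in> {0..1}" by simp
      have Tn: "0 \<le> T x" using n0' tent_nonneg by (simp add: T_def)
      show "\<bar>f x * T x - f a * T x\<bar> \<le> e / 2 * T x"
      proof (cases "\<bar>x - a\<bar> < d")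
        case True
        have "\<bar>f x * T x - f a * T x\<bar> = \<bar>f x - f a\<bar> * T x"
          using Tn by (simp add: abs_mult flip: left_diff_distrib)
        also have "\<dots> \<le> e / 2 * T x" using d(2)[OF x True] Tn by (intro mult_right_mono) auto
        finally show ?thesis .
      next
        case False
        have "real n * (x - a) \<le> 0 \<or> 1 \<le> real n * (x - a)"
        proof (cases "x \<le> a")
          case True then show ?thesis using n0' by (simp add: mult_nonneg_nonpos)
        next
          case F: False
          with False have "d \<le> x - a" by simp
          then have "real n * d \<le> real n * (x - a)" using n0' by simp
          with nd show ?thesis by simp
        qed
        then have "T x = 0" by (simp add: T_def tent_outside)
        then show ?thesis by simp
      qed
    qed (use iT ifT in auto)
    also have "\<dots> = e / 2" using T1 by simp
    finally show "norm ((LINT x|UI. f x * (real n * tent (real n * (x - a)))) - f a) < e"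
      using \<open>0 < e\<close> by (simp add: T_def)
  qed
qed

text \<open>The difference of two steep ramps at a and b is a test function close to the indicator
  of the interval, and its derivative concentrates at a and b, where continuity of f takes
  over.\<close>

lemma weak_derivative_incr:
  assumes f: "continuous_on {0..1} f" and g: "g \<in> L2 UI" and w: "has_weak_derivative f g"
    and ab: "0 \<le> a" "a \<le> b" "b \<le> 1"
  shows "incr g a b = f b - f a"
proof -
  let ?M = UI
  have gi: "integrable ?M g" by (rule L2_UI_integrable[OF g])
  have int: "incr g a b = f b - f a" if ab: "0 < a" "a < b" "b < 1" for a b
  proof -
    define \<phi> where "\<phi> n x = ramp (real n * (x - a)) - ramp (real n * (x - b))" for n x
    define D where "D n x = real n * tent (real n * (x - a)) - real n * tent (real n * (x - b))" for n x
    have d1: "((\<lambda>x. ramp (real n * (x - c))) has_real_derivative real n * tent (real n * (x - c))) (at x)" for n c x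
      by (rule DERIV_affine[OF ramp_deriv])
    have dphi: "(\<phi> n has_real_derivative D n x) (at x)" for n x
      unfolding \<phi>_def[abs_def] D_def by (intro DERIV_diff d1)
    have cD: "continuous_on S (D n)" for n S
      unfolding D_def[abs_def] tent_def by (intro continuous_intros)
    obtain n0 :: nat where n0: "1 / (1 - b) < real n0" using reals_Archimedean2 by blast
    have ev: "(LINT x|?M. f x * D n x) = - (LINT x|?M. g x * \<phi> n x)" if n: "n > n0" for n
    proof -
      have np: "0 < real n" using n by simp
      have nb: "1 / real n < 1 - b"
      proof -
        have "1 / (1 - b) < real n" using n0 n by linarith
        then show ?thesis using ab np by (simp add: field_simps)
      qed
      have "test_function (\<phi> n)"
        unfolding test_function_def
      proof (intro conjI exI allI impI)
        show "\<phi> n C1_differentiable_on UNIV"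
          unfolding C1_differentiable_on_def using dphi cD
          by (intro exI[of _ "D n"]) (auto simp: has_real_derivative_iff_has_vector_derivative)
        show "0 < a" "b + 1 / real n < 1" using ab nb by auto
        fix x assume "x \<notin> {a..b + 1 / real n}"
        then consider "x < a" | "b + 1 / real n < x" by fastforce
        then show "\<phi> n x = 0"
        proof cases
          case 1
          then have "real n * (x - a) \<le> 0" "real n * (x - b) \<le> 0"
            using ab np by (auto intro!: mult_nonneg_nonpos)
          then show ?thesis by (simp add: \<phi>_def ramp_le_0)
        next
          case 2
          then have "1 \<le> real n * (x - b)" using np by (simp add: field_simps)
          moreover have "real n * (x - b) \<le> real n * (x - a)" using ab np by simp
          ultimately show ?thesis by (simp add: \<phi>_def ramp_ge_1)
        qed
      qed
      moreover have "deriv (\<phi> n) = D n" using dphi DERIV_imp_deriv by blast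
      ultimately show ?thesis using w[unfolded has_weak_derivative_def, rule_format, of "\<phi> n"] by simp
    qed
    have "(\<lambda>n. LINT x|?M. f x * D n x) \<longlonglongrightarrow> f a - f b"
    proof -
      have "integrable ?M (\<lambda>x. f x * (real n * tent (real n * (x - c))))" for n c
        unfolding tent_def by (intro cont_integrable_UI continuous_intros f)
      then have "(LINT x|?M. f x * D n x) = (LINT x|?M. f x * (real n * tent (real n * (x - a)))) -
         (LINT x|?M. f x * (real n * tent (real n * (x - b))))" for n
        by (simp add: D_def right_diff_distrib)
      then show ?thesis using ab by (auto intro!: tendsto_diff tent_concentrates f)
    qed
    moreover have "(\<lambda>n. LINT x|?M. g x * \<phi> n x) \<longlonglongrightarrow> incr g a b"
      unfolding incr_def
    proof (rule integral_dominated_convergence[where w = "\<lambda>x. \<bar>g x\<bar>"])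
      have lim: "(\<lambda>n. ramp (real n * (x - c))) \<longlonglongrightarrow> (if c < x then 1 else 0)" for c x
      proof (cases "c < x")
        case True
        obtain m :: nat where m: "1 / (x - c) < real m" using reals_Archimedean2 by blast
        have "ramp (real n * (x - c)) = 1" if "n \<ge> m" for n
        proof -
          have "1 / (x - c) \<le> real n" using m that by linarith
          then show ?thesis using True by (intro ramp_ge_1) (simp add: field_simps)
        qed
        then show ?thesis using True
          by (intro tendsto_eventually) (auto simp: eventually_sequentially)
      next
        case False
        then show ?thesis by (simp add: ramp_le_0 mult_nonneg_nonpos)
      qed
      show "AE x in ?M. (\<lambda>n. g x * \<phi> n x) \<longlonglongrightarrow> indicator {a<..b} x * g x"
      proof (rule AE_I2)
        fix x
        have "(\<lambda>n. g x * \<phi> n x) \<longlonglongrightarrow> g x * ((if a < x then 1 else 0) - (if b < x then 1 else 0))"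
          unfolding \<phi>_def by (intro tendsto_intros lim)
        also have "g x * ((if a < x then 1 else 0) - (if b < x then 1 else 0)) = indicator {a<..b} x * g x"
          using ab by (auto simp: indicator_def)
        finally show "(\<lambda>n. g x * \<phi> n x) \<longlonglongrightarrow> indicator {a<..b} x * g x" .
      qed
      show "AE x in ?M. norm (g x * \<phi> n x) \<le> \<bar>g x\<bar>" for n
      proof (rule AE_I2)
        fix x
        have "\<bar>\<phi> n x\<bar> \<le> 1"
          using ramp_bounds[of "real n * (x - a)"] ramp_bounds[of "real n * (x - b)"]
          unfolding \<phi>_def by linarith
        then show "norm (g x * \<phi> n x) \<le> \<bar>g x\<bar>" by (simp add: abs_mult mult_left_le)
      qed
      have "continuous_on {0..1} (\<phi> n)" for n
        unfolding \<phi>_def[abs_def] ramp_def by (intro continuous_intros)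
      then show "(\<lambda>x. g x * \<phi> n x) \<in> borel_measurable ?M" for n
        using gi cont_meas_UI by (intro borel_measurable_times) auto
    qed (use gi ind_integrable_UI[OF gi] in auto)
    then have "(\<lambda>n. - (LINT x|?M. g x * \<phi> n x)) \<longlonglongrightarrow> - incr g a b" by (rule tendsto_minus)
    then have "(\<lambda>n. LINT x|?M. f x * D n x) \<longlonglongrightarrow> - incr g a b"
      by (rule Lim_transform_eventually)
         (use ev in \<open>auto simp: eventually_sequentially intro!: exI[of _ "Suc n0"]\<close>)
    ultimately have "f a - f b = - incr g a b" by (rule LIMSEQ_unique)
    then show ?thesis by simp
  qed
  show ?thesis
  proof (cases "a = b")
    case True then show ?thesis by (simp add: incr_def)
  next
    case False
    \<comment> \<open>Test functions vanish near 0 and 1, so a general interval is approached from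
      inside, both ends moving towards the midpoint by the fraction \<open>t n\<close>.\<close>
    define t where "t n = 1 / real (n + 2)" for n
    have t: "0 < t n" "t n < 1" for n by (auto simp: t_def)
    have t0: "t \<longlonglongrightarrow> 0"
      using LIMSEQ_ignore_initial_segment[OF lim_1_over_n, of 2] by (simp add: t_def[abs_def])
    define A where "A n = (1 - t n) * a + t n * ((a + b) / 2)" for n
    define B where "B n = (1 - t n) * b + t n * ((a + b) / 2)" for n
    have AB: "0 < A n" "A n < B n" "B n < 1" for n
    proof -
      have ab': "a < b" using False ab by simp
      have "0 \<le> (1 - t n) * a" using t[of n] ab by simp
      moreover have "0 < t n * ((a + b) / 2)" using t[of n] ab ab' by simp
      ultimately show "0 < A n" unfolding A_def by linarith
      have "B n - A n = (1 - t n) * (b - a)" by (simp add: A_def B_def algebra_simps)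
      also have "\<dots> > 0" using t[of n] ab' by simp
      finally show "A n < B n" by simp
      have "(1 - t n) * b \<le> 1 - t n" using t[of n] ab by (simp add: mult_left_le)
      moreover have "t n * ((a + b) / 2) < t n" using t[of n] ab ab' by simp
      ultimately show "B n < 1" unfolding B_def by linarith
    qed
    have Al: "A \<longlonglongrightarrow> (1 - 0) * a + 0 * ((a + b) / 2)" unfolding A_def by (intro tendsto_intros t0)
    have Bl: "B \<longlonglongrightarrow> (1 - 0) * b + 0 * ((a + b) / 2)" unfolding B_def by (intro tendsto_intros t0)
    have "(\<lambda>n. incr g (A n) (B n)) \<longlonglongrightarrow> incr g a b"
      by (rule incr_tendsto[OF gi]) (use Al Bl in simp_all)
    moreover have "(\<lambda>n. f (B n) - f (A n)) \<longlonglongrightarrow> f b - f a"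
    proof (rule tendsto_diff)
      have in01: "A n \<in> {0..1}" "B n \<in> {0..1}" for n using AB[of n] by auto
      show "(\<lambda>n. f (B n)) \<longlonglongrightarrow> f b" "(\<lambda>n. f (A n)) \<longlonglongrightarrow> f a"
        using f ab Al Bl in01 by (auto simp: continuous_on_sequentially o_def)
    qed
    ultimately show ?thesis using int[OF AB] LIMSEQ_unique by simp
  qed
qed

lemma H1_weak_derivative:
  assumes "f \<in> H1"
  shows "weak_derivative f \<in> L2 UI" "has_weak_derivative f (weak_derivative f)"
proof -
  have "\<exists>g. g \<in> L2 UI \<and> has_weak_derivative f g" using assms by (auto simp: H1_def)
  from someI_ex[OF this]
  show "weak_derivative f \<in> L2 UI" "has_weak_derivative f (weak_derivative f)"
    by (auto simp: weak_derivative_def)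
qed

lemma H1_dyad_le:
  assumes "continuous_on {0..1} f" "f \<in> H1"
  shows "dyad N f f \<le> (LINT x|UI. (weak_derivative f x)\<^sup>2)"
  using assms H1_weak_derivative[OF assms(2)] by (intro dyad_le_L2 weak_derivative_incr)

text \<open>The dyadic energies increase to some L, and the derivative built from the difference
  quotients has squared norm at most L. It has the same increments as the weak derivative, so the
  two agree almost everywhere and no energy is lost.\<close>

lemma H1_dyad_tendsto:
  assumes f: "continuous_on {0..1} f" and H: "f \<in> H1"
  shows "(\<lambda>N. dyad N f f) \<longlonglongrightarrow> (LINT x|UI. (weak_derivative f x)\<^sup>2)"
proof -
  let ?M = UI
  let ?g = "weak_derivative f"
  note g = H1_weak_derivative[OF H]
  obtain L where L: "(\<lambda>N. dyad N f f) \<longlonglongrightarrow> L" "\<And>N. dyad N f f \<le> L"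
    using incseq_convergent[of "\<lambda>N. dyad N f f"] H1_dyad_le[OF f H] by (metis incseq_def dyad_mono)
  obtain h where h: "h \<in> L2 ?M" "\<And>a b. 0 \<le> a \<Longrightarrow> a \<le> b \<Longrightarrow> b \<le> 1 \<Longrightarrow> incr h a b = f b - f a"
    "(LINT x|?M. (h x)\<^sup>2) \<le> L"
    using dyad_bounded_imp_derivative[OF f L(2)] by metis
  have gi: "integrable ?M ?g" and hi: "integrable ?M h" using g(1) h(1) by (auto intro: L2_UI_integrable)
  have "AE x in ?M. ?g x - h x = 0"
    by (rule AE_zero_if_incr_zero) (use gi hi h(2) weak_derivative_incr[OF f g] in \<open>auto simp: incr_diff\<close>)
  then have "(LINT x|?M. (?g x)\<^sup>2) = (LINT x|?M. (h x)\<^sup>2)"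
    using gi hi by (intro integral_cong_AE) (auto elim: eventually_mono)
  with h(3) have "(LINT x|?M. (?g x)\<^sup>2) \<le> L" by simp
  moreover have "L \<le> (LINT x|?M. (?g x)\<^sup>2)"
    by (rule LIMSEQ_le_const2[OF L(1)]) (use H1_dyad_le[OF f H] in blast)
  ultimately show ?thesis using L(1) by simp
qed

lemma dyad_bounded_imp_H1:
  assumes f: "continuous_on {0..1} f" and C: "\<And>N. dyad N f f \<le> C"
  shows "f \<in> H1"
proof -
  obtain h where h: "h \<in> L2 UI" "\<And>a b. 0 \<le> a \<Longrightarrow> a \<le> b \<Longrightarrow> b \<le> 1 \<Longrightarrow> incr h a b = f b - f a"
    using dyad_bounded_imp_derivative[OF f C] by metis
  then have "has_weak_derivative f h" by (intro weak_derivativeI_incr f)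
  then show ?thesis using h(1) cont_L2_UI[OF f] by (auto simp: H1_def)
qed

text \<open>The bound supplies a derivative of squared norm at most C; Cauchy-Schwarz between x and
  y does the rest.\<close>

lemma dyad_bounded_imp_Hoelder:
  assumes f: "continuous_on {0..1} f" and C: "\<And>N. dyad N f f \<le> C" and xy: "x \<in> {0..1}" "y \<in> {0..1}"
  shows "(f x - f y)\<^sup>2 \<le> \<bar>x - y\<bar> * C"
proof -
  have *: "(f b - f a)\<^sup>2 \<le> (b - a) * C" if ab: "0 \<le> a" "a \<le> b" "b \<le> 1" for a b
  proof -
    obtain h where h: "h \<in> L2 UI"
      "\<And>a b. 0 \<le> a \<Longrightarrow> a \<le> b \<Longrightarrow> b \<le> 1 \<Longrightarrow> incr h a b = f b - f a"
      "(LINT x|UI. (h x)\<^sup>2) \<le> C"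
      using dyad_bounded_imp_derivative[OF f C] by metis
    have "incr (\<lambda>x. (h x)\<^sup>2) a b \<le> incr (\<lambda>x. (h x)\<^sup>2) 0 1"
      by (rule incr_mono) (use h(1) ab in \<open>auto simp: L2_def\<close>)
    with h(3) have "incr (\<lambda>x. (h x)\<^sup>2) a b \<le> C" by (simp add: incr_0_1)
    then have "(b - a) * incr (\<lambda>x. (h x)\<^sup>2) a b \<le> (b - a) * C" using ab by (intro mult_left_mono) auto
    with incr_square_le[OF h(1) ab] h(2)[OF ab] show ?thesis by simp
  qed
  show ?thesis using *[of x y] *[of y x] xy by (cases "x \<le> y") (auto simp: power2_commute)
qed

section \<open>Geometry of the gasket\<close>

lemma three_arith:
  fixes i :: 3
  shows "i + 1 + 1 = i + 2" "i + 1 + 2 = i" "i + 2 + 1 = i" "i + 2 + 2 = i + 1"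
    "i + 1 \<noteq> i" "i + 2 \<noteq> i" "i + 1 \<noteq> i + 2" "i \<noteq> i + 1" "i \<noteq> i + 2" "i + 2 \<noteq> i + 1"
  by (cases i rule: exhaust_3[THEN disjE]; force)+

lemma three_cases:
  fixes i j :: 3
  obtains "i = j" | "j = i + 1" | "j = i + 2"
  using exhaust_3[of i] exhaust_3[of j] by (elim disjE; simp)

lemma three_diff:
  fixes c i :: 3
  shows "c - i - 1 = c - i + 2" "c - i - 2 = c - i + 1"
    "c - (i + 1) = c - i + 2" "c - (i + 2) = c - i + 1"
  using exhaust_3[of i] exhaust_3[of c] by (elim disjE; simp)+

lemma sum_three: "(\<Sum>j\<in>UNIV. f j) = f i + f (i + 1) + f (i + 2)" for f :: "3 \<Rightarrow> 'a::ab_group_add"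
proof -
  have "UNIV = {i, i + 1, i + 2}" using three_cases[of i] by blast
  moreover have "sum f {i, i + 1, i + 2} = f i + f (i + 1) + f (i + 2)"
    by (simp add: three_arith add.assoc)
  ultimately show ?thesis by (simp only:)
qed

text \<open>With letters modulo $3$, the symmetric group consists of the maps $i \mapsto c + i$ and $i \mapsto c - i$.\<close>

definition rot :: "3 \<Rightarrow> 3 \<Rightarrow> 3" where "rot c i = c + i"
definition mirror :: "3 \<Rightarrow> 3 \<Rightarrow> 3" where "mirror c i = c - i"

lemma rot_comp: "rot c \<circ> mirror d = mirror (c + d)" "mirror c \<circ> rot d = mirror (c - d)"
  "mirror c \<circ> mirror d = rot (c - d)"
  by (auto simp: rot_def mirror_def fun_eq_iff)

lemma bij_rot: "bij (rot c)" and bij_mirror: "bij (mirror c)"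
  by (auto simp: rot_def mirror_def bij_def inj_def surj_def intro: exI[of _ "_ - c"] exI[of _ "c - _"])

definition three_sym :: "(3 \<Rightarrow> 3) \<Rightarrow> bool" where
  "three_sym \<pi> \<longleftrightarrow> (\<exists>c. \<pi> = rot c \<or> \<pi> = mirror c)"

lemma three_sym_bij: "three_sym \<pi> \<Longrightarrow> bij \<pi>"
  by (auto simp: three_sym_def bij_rot bij_mirror)

lemma three_sym_intros [simp]: "three_sym (rot c)" "three_sym (mirror c)"
  by (auto simp: three_sym_def)

locale ssg =
  fixes \<alpha> :: real and p :: "3 \<Rightarrow> real^2" and K :: "(real^2) set"
  assumes \<alpha>0: "0 < \<alpha>" and \<alpha>1: "\<alpha> < 1" and equi: "equilateral p" and gasket: "is_stretched_gasket \<alpha> p K"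
begin

abbreviation G where "G \<equiv> ssg_map \<alpha> p"
abbreviation W where "W \<equiv> ssg_word_map \<alpha> p"
abbreviation e where "e \<equiv> edge_param \<alpha> p []"

definition ratio :: real where "ratio = (1 - \<alpha>) / 2"

lemma ratio: "0 < ratio" "ratio < 1/2" "1 - 2 * ratio = \<alpha>"
  using \<alpha>0 \<alpha>1 by (auto simp: ratio_def field_simps)

lemma G_eq: "G i x = ratio *\<^sub>R x + (1 - ratio) *\<^sub>R p i"
  by (simp add: ssg_map_def ratio_def algebra_simps)

lemma G_p: "G i (p i) = p i"
  by (simp add: ssg_map_def)

lemma e_eq: "e i t = t *\<^sub>R G (i + 1) (p (i + 2)) + (1 - t) *\<^sub>R G (i + 2) (p (i + 1))"
  by (simp add: edge_param_def ssg_word_map_def)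

lemma e_0: "e i 0 = G (i + 2) (p (i + 1))" and e_1: "e i 1 = G (i + 1) (p (i + 2))"
  by (simp_all add: e_eq)

lemma W_Nil [simp]: "W [] = id" and W_Cons: "W (i # w) = G i \<circ> W w"
  by (simp_all add: ssg_word_map_def)

lemma edge_param_Cons: "edge_param \<alpha> p (j # w) i = G j \<circ> edge_param \<alpha> p w i"
  by (simp add: edge_param_def ssg_word_map_def fun_eq_iff)

lemma dist_G: "dist (G i x) (G i y) = ratio * dist x y"
proof -
  have "G i x - G i y = ratio *\<^sub>R (x - y)" by (simp add: G_eq algebra_simps)
  then show ?thesis using ratio by (simp add: dist_norm)
qed

lemma inj_G: "G i x = G i y \<longleftrightarrow> x = y"
  using dist_G[of i x y] ratio by (metis dist_eq_0_iff mult_eq_0_iff less_irrefl)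

lemma G_cont: "continuous_on S (G i)"
  unfolding ssg_map_def by (intro continuous_intros)

lemma e_cont: "continuous_on S (e i)"
  unfolding e_eq[abs_def] by (intro continuous_intros)

text \<open>Barycentric coordinates. For the centroid c of a triangle with unit sides, p i - c has
  squared norm 1/3 and inner product -1/6 with each other p j - c, which explains the constants 1/3
  and 2.\<close>

definition bary :: "3 \<Rightarrow> real^2 \<Rightarrow> real" where
  "bary i x = 1/3 + 2 * ((x - (1/3) *\<^sub>R (\<Sum>j\<in>UNIV. p j)) \<bullet> (p i - (1/3) *\<^sub>R (\<Sum>j\<in>UNIV. p j)))"

lemma bary_affine:
  assumes "a + b = 1"
  shows "bary i (a *\<^sub>R x + b *\<^sub>R y) = a * bary i x + b * bary i y"
proof -
  let ?c = "(1/3) *\<^sub>R (\<Sum>j\<in>UNIV. p j)"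
  have b: "b = 1 - a" using assms by simp
  have "a *\<^sub>R x + b *\<^sub>R y - c = a *\<^sub>R (x - c) + b *\<^sub>R (y - c)" for c
    by (simp add: b algebra_simps)
  then have "bary i (a *\<^sub>R x + b *\<^sub>R y) = 1/3 + 2 * (a * ((x - ?c) \<bullet> (p i - ?c)) + b * ((y - ?c) \<bullet> (p i - ?c)))"
    by (simp only: bary_def inner_add_left inner_scaleR_left)
  moreover have "1/3 + 2 * (a * X + b * Y) = a * (1/3 + 2 * X) + b * (1/3 + 2 * Y)" for X Y :: real
    by (simp add: b field_simps)
  ultimately show ?thesis by (simp only: bary_def)
qed

lemma bary_p: "bary i (p j) = (if i = j then 1 else 0)"
proof -
  define u where "u = p (i + 1) - p i"
  define v where "v = p (i + 2) - p i"
  have n: "dist (p i) (p j) = 1" if "i \<noteq> j" for i j using equi that by (auto simp: equilateral_def)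
  have uu: "u \<bullet> u = 1" using n[of i "i + 1"] by (simp add: u_def dist_norm norm_minus_commute dot_square_norm three_arith)
  have vv: "v \<bullet> v = 1" using n[of i "i + 2"] by (simp add: v_def dist_norm norm_minus_commute dot_square_norm three_arith)
  have "(u - v) \<bullet> (u - v) = 1" using n[of "i + 1" "i + 2"] by (simp add: u_def v_def dist_norm dot_square_norm three_arith)
  then have uv: "u \<bullet> v = 1/2" using uu vv by (simp add: inner_diff_left inner_diff_right inner_commute)
  have c: "(1/3) *\<^sub>R (\<Sum>j\<in>UNIV. p j) = p i + (1/3) *\<^sub>R (u + v)"
  proof -
    have "(\<Sum>j\<in>UNIV. p j) = (1 + 1 + 1 :: real) *\<^sub>R p i + (u + v)"
      unfolding sum_three[of p i] u_def v_def scaleR_add_left by simp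
    then show ?thesis by (simp add: scaleR_add_right)
  qed
  have p: "p (i + 1) = p i + u" "p (i + 2) = p i + v" by (simp_all add: u_def v_def)
  have vu: "v \<bullet> u = 1/2" using uv by (simp add: inner_commute)
  show ?thesis
    by (cases i j rule: three_cases)
       (simp_all add: bary_def c p three_arith inner_add_left inner_add_right inner_diff_left inner_diff_right uu vv uv vu)
qed

lemma bary_sum: "(\<Sum>i\<in>UNIV. bary i x) = 1"
proof -
  let ?c = "(1/3) *\<^sub>R (\<Sum>j\<in>UNIV. p j)"
  have z: "(\<Sum>i\<in>UNIV. p i - ?c) = 0" by (simp add: sum_subtractf scaleR_add_left[symmetric])
  have "(\<Sum>i\<in>UNIV. bary i x) = (\<Sum>i::3\<in>UNIV. 1/3) + 2 * (\<Sum>i\<in>UNIV. (x - ?c) \<bullet> (p i - ?c))"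
    unfolding bary_def sum.distrib sum_distrib_left ..
  also have "(\<Sum>i\<in>UNIV. (x - ?c) \<bullet> (p i - ?c)) = 0"
    unfolding inner_sum_right[symmetric] z by simp
  finally show ?thesis by simp
qed

lemma bary_G: "bary i (G j x) = ratio * bary i x + (if i = j then 1 - ratio else 0)"
  unfolding G_eq by (subst bary_affine) (auto simp: bary_p)

lemma bary_e: "bary i (e i t) = 0" "bary (i + 1) (e i t) = t * (1 - ratio) + (1 - t) * ratio"
  "bary (i + 2) (e i t) = t * ratio + (1 - t) * (1 - ratio)"
  unfolding e_eq by (subst bary_affine; simp add: bary_G bary_p three_arith)+

lemma bary_cont: "continuous_on S (bary i)"
  unfolding bary_def by (intro continuous_intros)

lemma K_compact: "compact K" and K_ne: "K \<noteq> {}"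
  and K_eq: "K = (\<Union>i. G i ` K) \<union> (\<Union>i. edge \<alpha> p [] i)"
  using gasket by (auto simp: is_stretched_gasket_def)

lemma K_closed: "closed K" using K_compact by (rule compact_imp_closed)

lemma G_K: "x \<in> K \<Longrightarrow> G i x \<in> K"
  by (subst K_eq) auto

lemma W_K: "x \<in> K \<Longrightarrow> W w x \<in> K"
  by (induction w) (auto simp: W_Cons G_K)

text \<open>The vertex is the fixed point of the contraction \<open>G i\<close>, whose iterates from
  any point of K stay in the closed set K.\<close>

lemma p_K: "p i \<in> K"
proof -
  obtain x where x: "x \<in> K" using K_ne by auto
  have K: "(G i ^^ n) x \<in> K" for n by (induction n) (auto simp: x G_K)
  have d: "dist ((G i ^^ n) x) (p i) = ratio ^ n * dist x (p i)" for n
  proof (induction n)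
    case (Suc n)
    have "dist ((G i ^^ Suc n) x) (p i) = dist (G i ((G i ^^ n) x)) (G i (p i))" by (simp add: G_p)
    then show ?case unfolding dist_G Suc by simp
  qed simp
  have "(\<lambda>n. ratio ^ n * dist x (p i)) \<longlonglongrightarrow> 0 * dist x (p i)"
    using ratio by (intro tendsto_mult tendsto_const LIMSEQ_power_zero) auto
  then have "(\<lambda>n. (G i ^^ n) x) \<longlonglongrightarrow> p i" by (subst tendsto_dist_iff) (simp add: d)
  then show ?thesis by (rule closed_sequentially[OF K_closed K])
qed

lemma e_K: "t \<in> {0..1} \<Longrightarrow> e i t \<in> K"
proof -
  assume t: "t \<in> {0..1}"
  then consider "t = 0" | "t = 1" | "t \<in> {0<..<1}" by fastforce
  then show ?thesis
  proof cases
    case 3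
    then have "e i t \<in> edge \<alpha> p [] i" by (simp add: edge_def)
    then show ?thesis using K_eq by blast
  qed (auto simp: e_0 e_1 G_K p_K)
qed

lemma edge_param_K: "t \<in> {0..1} \<Longrightarrow> edge_param \<alpha> p w i t \<in> K"
  by (induction w) (auto simp: edge_param_Cons e_K G_K)

lemma K_cases:
  assumes "x \<in> K"
  obtains i y where "y \<in> K" "x = G i y" | i t where "t \<in> {0<..<1}" "x = e i t"
  using assms by (subst (asm) K_eq) (auto simp: edge_def)

text \<open>A minimum principle places K inside the triangle. If the minimum m is attained in a
  cell, self-similarity gives m >= ratio * m, hence m >= 0; on the edges the coordinates are
  explicit.\<close>

lemma bary_nonneg:
  assumes "x \<in> K" shows "0 \<le> bary i x"
proof -
  obtain x0 where x0: "x0 \<in> K" "\<And>y. y \<in> K \<Longrightarrow> bary i x0 \<le> bary i y"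
    using continuous_attains_inf[OF K_compact K_ne bary_cont] by blast
  have "0 \<le> bary i x0"
    using x0(1)
  proof (cases rule: K_cases)
    case (1 j y)
    have "ratio * bary i x0 \<le> ratio * bary i y" using x0(2)[OF 1(1)] ratio by simp
    also have "\<dots> \<le> bary i x0" using ratio by (simp add: 1 bary_G)
    finally have "0 \<le> (1 - ratio) * bary i x0" by (simp add: algebra_simps)
    then show ?thesis using ratio by (simp add: zero_le_mult_iff)
  next
    case (2 j t)
    then show ?thesis using ratio by (cases j i rule: three_cases) (auto simp: bary_e)
  qed
  with x0(2)[OF assms] show ?thesis by linarith
qed

text \<open>In cell i the coordinate i is at least \<open>1 - ratio\<close>, which exceeds 1/2
  because \<alpha> > 0. Nonnegative coordinates with sum 1 allow this for one index only.\<close>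

lemma cell_unique:
  assumes "x \<in> K" "y \<in> K" "G i x = G j y" shows "i = j" "x = y"
proof -
  show "i = j"
  proof (rule ccontr)
    assume ij: "i \<noteq> j"
    have s: "(\<Sum>k\<in>UNIV. bary k (G i x)) = 1" by (rule bary_sum)
    have "bary i (G i x) \<ge> 1 - ratio" "bary j (G j y) \<ge> 1 - ratio"
      using ratio bary_nonneg[OF assms(1), of i] bary_nonneg[OF assms(2), of j] by (simp_all add: bary_G)
    moreover have "bary i (G i x) + bary j (G i x) \<le> (\<Sum>k\<in>UNIV. bary k (G i x))"
      using sum_mono2[of UNIV "{i, j}" "\<lambda>k. bary k (G i x)"] ij bary_nonneg[OF G_K[OF assms(1)]] by simp
    ultimately show False using ratio assms(3) s by simp
  qed
  with assms(3) show "x = y" by (simp add: inj_G)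
qed

text \<open>On an open edge no coordinate reaches \<open>1 - ratio\<close>, the least value of
  coordinate j in cell j.\<close>

lemma edge_not_cell:
  assumes "t \<in> {0<..<1}" "y \<in> K" shows "e i t \<noteq> G j y"
proof
  assume "e i t = G j y"
  then have "bary j (e i t) \<ge> 1 - ratio" using ratio bary_nonneg[OF assms(2), of j] by (simp add: bary_G)
  moreover have "t * (1 - ratio) + (1 - t) * ratio < 1 - ratio" "t * ratio + (1 - t) * (1 - ratio) < 1 - ratio"
  proof -
    have "(1 - t) * ratio < (1 - t) * (1 - ratio)" "t * ratio < t * (1 - ratio)" using assms(1) ratio by auto
    then show "t * (1 - ratio) + (1 - t) * ratio < 1 - ratio" "t * ratio + (1 - t) * (1 - ratio) < 1 - ratio"
      by (simp_all add: algebra_simps)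
  qed
  ultimately show False using ratio by (cases i j rule: three_cases) (auto simp: bary_e)
qed

lemma bary_e_pos:
  assumes "t \<in> {0<..<1}" "j \<noteq> i" shows "0 < bary j (e i t)"
  using assms ratio by (cases i j rule: three_cases) (auto simp: bary_e intro!: add_pos_pos)

lemma edge_unique:
  assumes "t \<in> {0<..<1}" "t' \<in> {0<..<1}" "e i t = e j t'" shows "i = j" "t = t'"
proof -
  show ij: "i = j" using bary_e(1)[of i t] bary_e_pos[OF assms(2), of i j] assms(3) by force
  have "t * (1 - ratio) + (1 - t) * ratio = t' * (1 - ratio) + (1 - t') * ratio"
    using bary_e(2)[of i t] bary_e(2)[of i t'] assms(3) ij by simp
  then have "(t - t') * (1 - 2 * ratio) = 0" by (simp add: algebra_simps)
  then show "t = t'" using ratio by simp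
qed

subsection \<open>Gluing functions along the edges\<close>

text \<open>One function per cell, joined affinely along the edges. Points of K have a unique
  address, so the choices are forced on K; off K the value is of no interest. Edge i is run through
  from cell i + 2 to cell i + 1.\<close>

definition paste :: "(3 \<Rightarrow> real^2 \<Rightarrow> real) \<Rightarrow> real^2 \<Rightarrow> real" where
  "paste f x = (if \<exists>i y. y \<in> K \<and> x = G i y
     then (case SOME (i, y). y \<in> K \<and> x = G i y of (i, y) \<Rightarrow> f i y)
     else (case SOME (i, t). t \<in> {0<..<1} \<and> x = e i t of (i, t) \<Rightarrow>
       f (i + 2) (p (i + 1)) + t * (f (i + 1) (p (i + 2)) - f (i + 2) (p (i + 1)))))"

lemma paste_G:
  assumes "y \<in> K" shows "paste f (G i y) = f i y"
proof -
  have "(SOME (i', y'). y' \<in> K \<and> G i y = G i' y') = (i, y)"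
    by (rule some_equality) (use assms cell_unique in \<open>auto, metis+\<close>)
  then show ?thesis unfolding paste_def using assms by auto
qed

lemma paste_e:
  assumes "t \<in> {0..1}"
  shows "paste f (e i t) = f (i + 2) (p (i + 1)) + t * (f (i + 1) (p (i + 2)) - f (i + 2) (p (i + 1)))"
proof -
  consider "t = 0" | "t = 1" | "t \<in> {0<..<1}" using assms by fastforce
  then show ?thesis
  proof cases
    case 3
    have "(SOME (i', t'). t' \<in> {0<..<1} \<and> e i t = e i' t') = (i, t)"
    proof (rule some_equality)
      show "case (i, t) of (i', t') \<Rightarrow> t' \<in> {0<..<1} \<and> e i t = e i' t'" using 3 by simp
      fix z assume "case z of (i', t') \<Rightarrow> t' \<in> {0<..<1} \<and> e i t = e i' t'"
      then show "z = (i, t)" using edge_unique[OF 3] by (cases z) force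
    qed
    moreover have "\<not> (\<exists>j y. y \<in> K \<and> e i t = G j y)" using edge_not_cell[OF 3] by blast
    ultimately show ?thesis unfolding paste_def by auto
  qed (simp_all add: e_0 e_1 paste_G p_K)
qed

lemma paste_p: "paste f (p i) = f i (p i)"
  using paste_G[OF p_K, of f i i] by (simp add: G_p)

lemma K_closed_cover: "K = (\<Union>i. G i ` K) \<union> (\<Union>i. e i ` {0..1})"
proof
  show "K \<subseteq> (\<Union>i. G i ` K) \<union> (\<Union>i. e i ` {0..1})"
  proof
    fix x assume "x \<in> K" then show "x \<in> (\<Union>i. G i ` K) \<union> (\<Union>i. e i ` {0..1})"
    proof (cases rule: K_cases)
      case (2 i t)
      then have "x \<in> e i ` {0..1}" by simp
      then show ?thesis by blast
    qed blast
  qed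
qed (auto simp: G_K e_K)

lemma paste_cont:
  assumes f: "\<And>i. continuous_on K (f i)" shows "continuous_on K (paste f)"
proof -
  have "continuous_on (G i ` K) (paste f)" for i
  proof -
    have inv: "(1 / ratio) *\<^sub>R (G i y - (1 - ratio) *\<^sub>R p i) = y" for y
      using ratio by (simp add: G_eq)
    have "continuous_on (G i ` K) (\<lambda>x. f i ((1 / ratio) *\<^sub>R (x - (1 - ratio) *\<^sub>R p i)))"
      by (rule continuous_on_compose2[OF f[of i]]) (auto simp: inv simp del: real_scaleR_def intro!: continuous_intros)
    then show ?thesis by (rule continuous_on_eq) (auto simp: paste_G inv)
  qed
  moreover have "continuous_on (e i ` {0..1}) (paste f)" for i
  proof -
    \<comment> \<open>The edge parameter is recovered from a coordinate that runs affinely from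
      \<open>ratio\<close> to \<open>1 - ratio\<close>, an interval of length \<alpha>.\<close>
    have inv: "(bary (i + 1) (e i t) - ratio) / \<alpha> = t" for t
    proof -
      have "t * (1 - ratio) + (1 - t) * ratio - ratio = t * (1 - 2 * ratio)" by (simp add: algebra_simps)
      then show ?thesis unfolding bary_e ratio(3) using \<alpha>0 by simp
    qed
    have "continuous_on (e i ` {0..1}) (\<lambda>x. f (i + 2) (p (i + 1)) + ((bary (i + 1) x - ratio) / \<alpha>) * (f (i + 1) (p (i + 2)) - f (i + 2) (p (i + 1))))"
      using \<alpha>0 by (intro continuous_intros bary_cont) auto
    then show ?thesis by (rule continuous_on_eq) (clarify, subst inv, subst paste_e, auto)
  qed
  moreover have "closed (G i ` K)" "closed (e i ` {0..1})" for i
    by (intro compact_imp_closed compact_continuous_image G_cont e_cont K_compact compact_Icc)+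
  ultimately have "continuous_on ((\<Union>i. G i ` K) \<union> (\<Union>i. e i ` {0..1})) (paste f)"
    by (intro continuous_on_closed_Un continuous_on_closed_Union closed_UN) auto
  then show ?thesis by (simp flip: K_closed_cover)
qed

subsection \<open>Symmetries\<close>

text \<open>The affine map of the plane that permutes the vertices by \<pi>; for a bijection it is a
  symmetry of the triangle.\<close>

definition sym :: "(3 \<Rightarrow> 3) \<Rightarrow> real^2 \<Rightarrow> real^2" where
  "sym \<pi> x = (\<Sum>i\<in>UNIV. bary i x *\<^sub>R p (\<pi> i))"

lemma sym_cont: "continuous_on S (sym \<pi>)"
  unfolding sym_def by (intro continuous_intros bary_cont)

lemma sym_affine: "a + b = 1 \<Longrightarrow> sym \<pi> (a *\<^sub>R x + b *\<^sub>R y) = a *\<^sub>R sym \<pi> x + b *\<^sub>R sym \<pi> y"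
  by (simp add: sym_def bary_affine scaleR_add_left sum.distrib scaleR_sum_right)

lemma sym_p: "sym \<pi> (p j) = p (\<pi> j)"
proof -
  have "sym \<pi> (p j) = (\<Sum>i\<in>UNIV. if i = j then p (\<pi> i) else 0)"
    unfolding sym_def bary_p by (intro sum.cong) auto
  then show ?thesis by simp
qed

lemma sym_G: "sym \<pi> (G j x) = G (\<pi> j) (sym \<pi> x)"
  unfolding G_eq by (subst sym_affine) (auto simp: sym_p)

lemma sym_rot_e: "sym (rot c) (e i t) = e (c + i) t"
  unfolding e_eq by (subst sym_affine) (auto simp: sym_G sym_p rot_def add.assoc)

text \<open>A reflection exchanges the roles of i + 1 and i + 2, so edges are run through
  backwards.\<close>

lemma sym_mirror_e: "sym (mirror c) (e i t) = e (c - i) (1 - t)"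
  unfolding e_eq by (subst sym_affine) (auto simp: sym_G sym_p mirror_def three_diff)

lemma sym_e:
  assumes "three_sym \<pi>"
  obtains "\<And>i t. sym \<pi> (e i t) = e (\<pi> i) t" | "\<And>i t. sym \<pi> (e i t) = e (\<pi> i) (1 - t)"
  using assms sym_rot_e sym_mirror_e unfolding three_sym_def rot_def mirror_def by blast

lemma bary_sym:
  assumes "bij \<pi>" shows "bary (\<pi> i) (sym \<pi> x) = bary i x"
proof -
  let ?c = "(1/3) *\<^sub>R (\<Sum>j\<in>UNIV. p j)"
  have "sym \<pi> x - c = (\<Sum>j\<in>UNIV. bary j x *\<^sub>R (p (\<pi> j) - c))" for c
    by (simp add: sym_def scaleR_diff_right sum_subtractf bary_sum flip: scaleR_sum_left)
  then have "bary (\<pi> i) (sym \<pi> x) = 1/3 + 2 * (\<Sum>j\<in>UNIV. bary j x * ((p (\<pi> j) - ?c) \<bullet> (p (\<pi> i) - ?c)))"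
    by (simp only: bary_def inner_sum_left inner_scaleR_left)
  also have "\<dots> = 1/3 + (\<Sum>j\<in>UNIV. bary j x * (bary (\<pi> i) (p (\<pi> j)) - 1/3))"
    unfolding bary_def[of "\<pi> i"] by (simp add: sum_distrib_left mult.left_commute mult.commute)
  also have "\<dots> = (\<Sum>j\<in>UNIV. if j = i then bary j x else 0)"
  proof -
    have "(\<Sum>j\<in>UNIV. bary j x * (bary (\<pi> i) (p (\<pi> j)) - 1/3)) = (\<Sum>j\<in>UNIV. (if j = i then bary j x else 0) - bary j x / 3)"
      using assms by (intro sum.cong) (auto simp: bary_p bij_def inj_eq algebra_simps)
    then show ?thesis by (simp add: sum_subtractf bary_sum flip: sum_divide_distrib)
  qed
  finally show ?thesis by simp
qed

lemma sym_comp: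
  assumes "bij \<tau>" shows "sym \<pi> (sym \<tau> x) = sym (\<pi> \<circ> \<tau>) x"
proof -
  have "sym \<pi> (sym \<tau> x) = (\<Sum>i\<in>UNIV. bary (\<tau> i) (sym \<tau> x) *\<^sub>R p (\<pi> (\<tau> i)))"
    unfolding sym_def[of \<pi>] by (rule sum.reindex_bij_betw[OF assms, symmetric])
  then show ?thesis by (simp add: bary_sym[OF assms] sym_def[of "\<pi> \<circ> \<tau>"])
qed

text \<open>A maximum principle for the distance of \<open>sym \<pi> x\<close> from K: in a cell the
  distance shrinks by \<open>ratio\<close>, and edges go to edges, so the maximum is 0.\<close>

lemma sym_K:
  assumes \<pi>: "three_sym \<pi>" and x: "x \<in> K" shows "sym \<pi> x \<in> K"
proof -
  let ?h = "\<lambda>x. infdist (sym \<pi> x) K"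
  have "continuous_on K ?h" by (intro continuous_on_infdist sym_cont)
  from continuous_attains_sup[OF K_compact K_ne this]
  obtain x0 where x0: "x0 \<in> K" "\<And>y. y \<in> K \<Longrightarrow> ?h y \<le> ?h x0" by blast
  have "?h x0 \<le> 0"
    using x0(1)
  proof (cases rule: K_cases)
    case (1 j y)
    obtain k where k: "k \<in> K" "infdist (sym \<pi> y) K = dist (sym \<pi> y) k"
      using infdist_attains_inf[OF K_closed K_ne] by blast
    have "?h x0 \<le> dist (G (\<pi> j) (sym \<pi> y)) (G (\<pi> j) k)"
      unfolding 1(2) sym_G by (rule infdist_le[OF G_K[OF k(1)]])
    also have "\<dots> = ratio * ?h y" by (simp add: dist_G k(2))
    also have "\<dots> \<le> ratio * ?h x0" using x0(2)[OF 1(1)] ratio by simp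
    finally have "(1 - ratio) * ?h x0 \<le> 0" by (simp add: algebra_simps)
    then show ?thesis using ratio by (simp add: mult_le_0_iff)
  next
    case (2 j t)
    have "sym \<pi> x0 \<in> K" using sym_e[OF \<pi>] 2 by (metis atLeastAtMost_iff diff_ge_0_iff_ge diff_le_eq e_K greaterThanLessThan_iff le_add_same_cancel1 less_eq_real_def)
    then show ?thesis by simp
  qed
  with x0(2)[OF x] have "?h x = 0" using infdist_nonneg[of "sym \<pi> x" K] by linarith
  then show ?thesis using in_closed_iff_infdist_zero[OF K_closed K_ne] by blast
qed

end

section \<open>The energy as a limit of discrete energies\<close>

lemma sum_words_Suc:
  "(\<Sum>w | length w = Suc m. f w) = (\<Sum>i\<in>UNIV. \<Sum>w | length w = m. f (i # w))" for f :: "'a::finite list \<Rightarrow> real"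
proof -
  have "(\<Sum>i\<in>UNIV. \<Sum>w | length w = m. f (i # w)) = (\<Sum>(i, w)\<in>UNIV \<times> {w. length w = m}. f (i # w))"
    by (rule sum.cartesian_product)
  also have "\<dots> = (\<Sum>w | length w = Suc m. f w)"
    by (rule sum.reindex_bij_witness[of _ "\<lambda>w. (hd w, tl w)" "\<lambda>(i, w). i # w"]) (auto simp: length_Suc_conv)
  finally show ?thesis by simp
qed

section \<open>Sequences of resistances and one step of the network\<close>

definition matching :: "(nat \<Rightarrow> real) \<Rightarrow> (nat \<Rightarrow> real) \<Rightarrow> bool" where
  "matching r \<rho> \<longleftrightarrow> (\<forall>i\<ge>1. matching_pair (r i) (\<rho> i))"

lemma matching_shift: "matching r \<rho> \<Longrightarrow> matching (r \<circ> Suc) (\<rho> \<circ> Suc)"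
  by (auto simp: matching_def)

lemma matching_pos:
  assumes "matching r \<rho>" "1 \<le> i"
  shows "0 < r i" "0 < \<rho> i" "5/3 * r i + \<rho> i = 1" "r i \<le> 3/5" "\<rho> i \<le> 1"
  using assms by (auto simp: matching_def matching_pair_def dest!: spec[of _ i])

lemma res_delta_Suc: "res_delta r (Suc m) = r 1 * res_delta (r \<circ> Suc) m"
proof -
  have "res_delta r (Suc m) = r 1 * (\<Prod>i=Suc 1..Suc m. r i)"
    unfolding res_delta_def by (subst prod.atLeast_Suc_atMost) auto
  also have "(\<Prod>i=Suc 1..Suc m. r i) = res_delta (r \<circ> Suc) m"
    unfolding res_delta_def by (subst prod.shift_bounds_cl_Suc_ivl) simp
  finally show ?thesis .
qed

lemma res_gamma_eq: "res_gamma r \<rho> (Suc k) = res_delta r k * \<rho> (Suc k)"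
  by (simp add: res_gamma_def res_delta_def)

lemma res_gamma_Suc: "res_gamma r \<rho> (Suc (Suc k)) = r 1 * res_gamma (r \<circ> Suc) (\<rho> \<circ> Suc) (Suc k)"
  by (simp add: res_gamma_eq res_delta_Suc)

lemma res_delta_pos: "matching r \<rho> \<Longrightarrow> 0 < res_delta r m"
  unfolding res_delta_def by (intro prod_pos) (auto intro: matching_pos)

lemma res_gamma_pos: "matching r \<rho> \<Longrightarrow> 0 < res_gamma r \<rho> (Suc m)"
  by (simp add: res_gamma_eq res_delta_pos matching_pos)

text \<open>The tangent to the convex function t^2 / r at t = r * c. With c read as the current
  through the resistance r, equality is Ohm's law.\<close>

lemma square_ge_tangent: "0 < r \<Longrightarrow> 2 * c * t - r * c\<^sup>2 \<le> 1 / r * t\<^sup>2" for r c t :: real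
proof -
  assume r: "0 < r"
  have "0 \<le> (t - r * c)\<^sup>2 / r" using r by simp
  also have "\<dots> = 1 / r * t\<^sup>2 - (2 * c * t - r * c\<^sup>2)"
    using r by (simp add: power2_eq_square field_simps)
  finally show ?thesis by simp
qed

text \<open>The $\Delta$-$Y$ transform. The tangent points are the potential differences of the harmonic extension.\<close>

lemma network_inequality:
  fixes a b c r \<rho> :: real
  assumes r: "0 < r" "0 < \<rho>" "5/3 * r + \<rho> = 1"
  shows "(b - c)\<^sup>2 + (c - a)\<^sup>2 + (a - b)\<^sup>2 \<le>
    1 / r * (((xb - xc)\<^sup>2 + (xc - a)\<^sup>2 + (a - xb)\<^sup>2) + ((yc - ya)\<^sup>2 + (ya - b)\<^sup>2 + (b - yc)\<^sup>2)
      + ((za - zb)\<^sup>2 + (zb - c)\<^sup>2 + (c - za)\<^sup>2))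
    + 1 / \<rho> * ((yc - zb)\<^sup>2 + (za - xc)\<^sup>2 + (xb - ya)\<^sup>2)"
proof -
  define T where "T q d t = 2 * d * t - q * d\<^sup>2" for q d t :: real
  have T: "T q d t \<le> 1 / q * t\<^sup>2" if "0 < q" for q d t
    unfolding T_def by (rule square_ge_tangent[OF that])
  \<comment> \<open>The slopes inserted here are the currents of the harmonic extension. Kirchhoff's
    law makes the six inner values cancel, and by the matching condition the rest is the energy of
    a, b, c.\<close>
  have "(b - c)\<^sup>2 + (c - a)\<^sup>2 + (a - b)\<^sup>2 =
     T r ((b - c) / 3) (xb - xc) + T r ((2 * c + b - 3 * a) / 3) (xc - a) + T r ((3 * a - 2 * b - c) / 3) (a - xb)
   + (T r ((c - a) / 3) (yc - ya) + T r ((2 * a + c - 3 * b) / 3) (ya - b) + T r ((3 * b - 2 * c - a) / 3) (b - yc))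
   + (T r ((a - b) / 3) (za - zb) + T r ((2 * b + a - 3 * c) / 3) (zb - c) + T r ((3 * c - 2 * a - b) / 3) (c - za))
   + (T \<rho> (b - c) (yc - zb) + T \<rho> (c - a) (za - xc) + T \<rho> (a - b) (xb - ya))"
  proof -
    have rho: "\<rho> = 1 - 5/3 * r" using r(3) by simp
    show ?thesis unfolding T_def rho by (simp add: power2_eq_square field_simps)
  qed
  also have "\<dots> \<le> 1 / r * (xb - xc)\<^sup>2 + 1 / r * (xc - a)\<^sup>2 + 1 / r * (a - xb)\<^sup>2
   + (1 / r * (yc - ya)\<^sup>2 + 1 / r * (ya - b)\<^sup>2 + 1 / r * (b - yc)\<^sup>2)
   + (1 / r * (za - zb)\<^sup>2 + 1 / r * (zb - c)\<^sup>2 + 1 / r * (c - za)\<^sup>2)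
   + (1 / \<rho> * (yc - zb)\<^sup>2 + 1 / \<rho> * (za - xc)\<^sup>2 + 1 / \<rho> * (xb - ya)\<^sup>2)"
    by (intro add_mono T r)
  finally show ?thesis by (simp only: distrib_left)
qed

lemma three_numerals: "(3::3) = 0" "(4::3) = 1"
  using three_arith(2)[of 0] three_arith(4)[of 0] by simp_all

lemma comp_add: "(\<lambda>x. f x + g x) \<circ> h = (\<lambda>x. (f \<circ> h) x + (g \<circ> h) x)"
  and comp_scale: "(\<lambda>x. (c::real) * k x) \<circ> h = (\<lambda>x. c * (k \<circ> h) x)"
  by auto

context ssg begin

text \<open>Discretizing also the edges dyadically makes each \<open>B m\<close> depend on finitely many values only,
  so that the energy, their supremum, is lower semicontinuous under pointwise convergence.\<close>

primrec B :: "nat \<Rightarrow> (nat \<Rightarrow> real) \<Rightarrow> (nat \<Rightarrow> real) \<Rightarrow> (real^2 \<Rightarrow> real) \<Rightarrow> (real^2 \<Rightarrow> real) \<Rightarrow> real" where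
  "B 0 r \<rho> u v = (\<Sum>i\<in>UNIV. (u (p (i + 1)) - u (p (i + 2))) * (v (p (i + 1)) - v (p (i + 2))))"
| "B (Suc m) r \<rho> u v = 1 / r 1 * (\<Sum>i\<in>UNIV. B m (r \<circ> Suc) (\<rho> \<circ> Suc) (u \<circ> G i) (v \<circ> G i))
     + 1 / \<rho> 1 * (\<Sum>i\<in>UNIV. dyad m (u \<circ> e i) (v \<circ> e i))"

lemma B_commute: "B m r \<rho> u v = B m r \<rho> v u"
proof (induction m arbitrary: r \<rho> u v)
  case 0 show ?case by (simp add: mult.commute)
next
  case (Suc m)
  show ?case unfolding B.simps
    by (intro arg_cong2[where f = "(+)"] arg_cong2[where f = "(*)"] sum.cong refl Suc dyad_commute)
qed

lemma B_add_left: "B m r \<rho> (\<lambda>x. u x + u' x) v = B m r \<rho> u v + B m r \<rho> u' v"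
proof (induction m arbitrary: r \<rho> u u' v)
  case 0 show ?case by (simp add: algebra_simps flip: sum.distrib)
next
  case (Suc m)
  show ?case by (simp only: B.simps comp_add Suc dyad_add_left sum.distrib distrib_left add_ac)
qed

lemma B_scale_left: "B m r \<rho> (\<lambda>x. c * u x) v = c * B m r \<rho> u v"
proof (induction m arbitrary: r \<rho> u v)
  case 0 show ?case by (simp add: sum_distrib_left algebra_simps)
next
  case (Suc m)
  show ?case
    by (simp only: B.simps comp_scale Suc dyad_scale_left sum_distrib_left[symmetric] distrib_left mult.left_commute[of _ c])
qed

lemma B_add_right: "B m r \<rho> u (\<lambda>x. v x + v' x) = B m r \<rho> u v + B m r \<rho> u v'"
  using B_add_left B_commute by metis

lemma B_scale_right: "B m r \<rho> u (\<lambda>x. c * v x) = c * B m r \<rho> u v"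
  using B_scale_left B_commute by metis

lemma B_diff_left: "B m r \<rho> (\<lambda>x. u x - u' x) v = B m r \<rho> u v - B m r \<rho> u' v"
  using B_add_left[of m r \<rho> u "\<lambda>x. (-1) * u' x" v] B_scale_left[of m r \<rho> "-1" u' v] by simp

lemma B_diff_right: "B m r \<rho> u (\<lambda>x. v x - v' x) = B m r \<rho> u v - B m r \<rho> u v'"
  using B_diff_left B_commute by metis

lemma B_cong:
  assumes "\<And>x. x \<in> K \<Longrightarrow> u x = u' x" "\<And>x. x \<in> K \<Longrightarrow> v x = v' x"
  shows "B m r \<rho> u v = B m r \<rho> u' v'"
  using assms
proof (induction m arbitrary: r \<rho> u v u' v')
  case 0 then show ?case by (simp add: p_K)
next
  case (Suc m)
  have "B m (r \<circ> Suc) (\<rho> \<circ> Suc) (u \<circ> G i) (v \<circ> G i) = B m (r \<circ> Suc) (\<rho> \<circ> Suc) (u' \<circ> G i) (v' \<circ> G i)" for i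
    by (rule Suc.IH) (simp_all add: Suc.prems G_K)
  moreover have "dyad m (u \<circ> e i) (v \<circ> e i) = dyad m (u' \<circ> e i) (v' \<circ> e i)" for i
    by (rule dyad_cong) (simp_all add: Suc.prems e_K del: atLeastAtMost_iff)
  ultimately show ?case by simp
qed

lemma B_nonneg: "matching r \<rho> \<Longrightarrow> 0 \<le> B m r \<rho> u u"
proof (induction m arbitrary: r \<rho> u)
  case 0 show ?case by (simp add: sum_nonneg)
next
  case (Suc m)
  have "0 < r 1" "0 < \<rho> 1" using matching_pos[OF Suc.prems, of 1] by auto
  then show ?case
    unfolding B.simps
    by (intro add_nonneg_nonneg mult_nonneg_nonneg sum_nonneg dyad_nonneg Suc.IH[OF matching_shift[OF Suc.prems]]) auto
qed

text \<open>At level 0 \<open>dyad\<close> sees only the two ends of an edge, so this is the network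
  inequality.\<close>

lemma B_le_B1:
  assumes "matching r \<rho>" shows "B 0 r \<rho> u u \<le> B (Suc 0) r \<rho> u u"
proof -
  note m = matching_pos[OF assms order_refl]
  show ?thesis
    using network_inequality[OF m(1-3), where a = "u (p 0)" and b = "u (p 1)" and c = "u (p 2)" and
        xb = "u (G 0 (p 1))" and xc = "u (G 0 (p 2))" and ya = "u (G 1 (p 0))" and yc = "u (G 1 (p 2))" and
        za = "u (G 2 (p 0))" and zb = "u (G 2 (p 1))"]
    unfolding B.simps sum_three[of _ 0] dyad_0 o_def e_0 e_1
    by (simp add: G_p power2_eq_square three_numerals add_ac)
qed

lemma B_mono_Suc: "matching r \<rho> \<Longrightarrow> B m r \<rho> u u \<le> B (Suc m) r \<rho> u u"
proof (induction m arbitrary: r \<rho> u)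
  case 0 then show ?case by (rule B_le_B1)
next
  case (Suc m)
  have "0 < r 1" "0 < \<rho> 1" using matching_pos[OF Suc.prems, of 1] by auto
  then show ?case
    unfolding B.simps(2)[of "Suc m"] B.simps(2)[of m r]
    by (intro add_mono mult_left_mono sum_mono dyad_mono_Suc Suc.IH[OF matching_shift[OF Suc.prems]]) auto
qed

lemma B_mono: "matching r \<rho> \<Longrightarrow> m \<le> m' \<Longrightarrow> B m r \<rho> u u \<le> B m' r \<rho> u u"
  by (rule lift_Suc_mono_le[of "\<lambda>m. B m r \<rho> u u", OF B_mono_Suc])

lemma sum_bij: "bij \<pi> \<Longrightarrow> (\<Sum>i\<in>UNIV. f (\<pi> i)) = (\<Sum>i\<in>UNIV. f i)" for f :: "3 \<Rightarrow> real"
  by (rule sum.reindex_bij_betw)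

lemma B_sym: "three_sym \<pi> \<Longrightarrow> B m r \<rho> (u \<circ> sym \<pi>) (v \<circ> sym \<pi>) = B m r \<rho> u v"
proof (induction m arbitrary: r \<rho> u v)
  case 0
  let ?f = "\<lambda>i. (u (p (i + 1)) - u (p (i + 2))) * (v (p (i + 1)) - v (p (i + 2)))"
  have "(u (p (\<pi> (i + 1))) - u (p (\<pi> (i + 2)))) * (v (p (\<pi> (i + 1))) - v (p (\<pi> (i + 2)))) = ?f (\<pi> i)" for i
    using 0 unfolding three_sym_def rot_def mirror_def
    by (auto simp: three_diff add.assoc) (simp add: algebra_simps)
  then show ?case using sum_bij[OF three_sym_bij[OF 0], of ?f] by (simp add: sym_p)
next
  case (Suc m)
  have c: "(u \<circ> sym \<pi>) \<circ> G i = (u \<circ> G (\<pi> i)) \<circ> sym \<pi>" for u :: "real^2 \<Rightarrow> real" and i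
    by (auto simp: sym_G)
  have d: "dyad m (u \<circ> sym \<pi> \<circ> e i) (v \<circ> sym \<pi> \<circ> e i) = dyad m (u \<circ> e (\<pi> i)) (v \<circ> e (\<pi> i))" for i
  proof (rule sym_e[OF Suc.prems])
    assume "\<And>i t. sym \<pi> (e i t) = e (\<pi> i) t"
    then show ?thesis by (simp add: o_def)
  next
    assume "\<And>i t. sym \<pi> (e i t) = e (\<pi> i) (1 - t)"
    then show ?thesis using dyad_reverse[of m "u \<circ> e (\<pi> i)" "v \<circ> e (\<pi> i)"] by (simp add: o_def)
  qed
  show ?case
    unfolding B.simps c Suc.IH[OF Suc.prems] d
      sum_bij[OF three_sym_bij[OF Suc.prems], of "\<lambda>i. B m (r \<circ> Suc) (\<rho> \<circ> Suc) (u \<circ> G i) (v \<circ> G i)"]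
      sum_bij[OF three_sym_bij[OF Suc.prems], of "\<lambda>i. dyad m (u \<circ> e i) (v \<circ> e i)"] ..
qed

section \<open>Functions of finite energy\<close>

lemma u_G_cont: "continuous_on K u \<Longrightarrow> continuous_on K (u \<circ> G i)"
  by (rule continuous_on_compose[OF G_cont], erule continuous_on_subset) (auto simp: G_K)

lemma u_e_cont: "continuous_on K u \<Longrightarrow> continuous_on {0..1} (u \<circ> e i)"
  by (rule continuous_on_compose[OF e_cont], erule continuous_on_subset) (auto simp: e_K)

definition fin_energy :: "(nat \<Rightarrow> real) \<Rightarrow> (nat \<Rightarrow> real) \<Rightarrow> (real^2 \<Rightarrow> real) set" where
  "fin_energy r \<rho> = {u. continuous_on K u \<and> (\<exists>C. \<forall>m. B m r \<rho> u u \<le> C)}"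

text \<open>On \<open>fin_energy\<close> the limit exists: for equal arguments by monotonicity, for
  different ones by polarization.\<close>

definition En :: "(nat \<Rightarrow> real) \<Rightarrow> (nat \<Rightarrow> real) \<Rightarrow> (real^2 \<Rightarrow> real) \<Rightarrow> (real^2 \<Rightarrow> real) \<Rightarrow> real" where
  "En r \<rho> u v = lim (\<lambda>m. B m r \<rho> u v)"

lemma fin_energy_cont: "u \<in> fin_energy r \<rho> \<Longrightarrow> continuous_on K u"
  by (simp add: fin_energy_def)

lemma En_square:
  assumes "matching r \<rho>" "u \<in> fin_energy r \<rho>"
  shows "(\<lambda>m. B m r \<rho> u u) \<longlonglongrightarrow> En r \<rho> u u" "B m r \<rho> u u \<le> En r \<rho> u u"
proof -
  obtain C where "\<And>m. B m r \<rho> u u \<le> C" using assms(2) by (auto simp: fin_energy_def)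
  then obtain L where L: "(\<lambda>m. B m r \<rho> u u) \<longlonglongrightarrow> L" "\<And>m. B m r \<rho> u u \<le> L"
    using incseq_convergent[of "\<lambda>m. B m r \<rho> u u"] by (metis incseq_def B_mono[OF assms(1)])
  then show "(\<lambda>m. B m r \<rho> u u) \<longlonglongrightarrow> En r \<rho> u u" "B m r \<rho> u u \<le> En r \<rho> u u"
    by (simp_all add: En_def limI)
qed

lemma fin_energyI:
  assumes "continuous_on K u" "\<And>m. B m r \<rho> u u \<le> C"
  shows "u \<in> fin_energy r \<rho>"
  using assms by (auto simp: fin_energy_def)

lemma En_nonneg: "matching r \<rho> \<Longrightarrow> u \<in> fin_energy r \<rho> \<Longrightarrow> 0 \<le> En r \<rho> u u"
  using En_square(2) B_nonneg order_trans by metis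

lemma B_parallelogram:
  "B m r \<rho> (\<lambda>x. u x + v x) (\<lambda>x. u x + v x) + B m r \<rho> (\<lambda>x. u x - v x) (\<lambda>x. u x - v x) = 2 * B m r \<rho> u u + 2 * B m r \<rho> v v"
  by (simp add: B_add_left B_add_right B_diff_left B_diff_right)

lemma fin_energy_add:
  assumes m: "matching r \<rho>" and u: "u \<in> fin_energy r \<rho>" and v: "v \<in> fin_energy r \<rho>"
  shows "(\<lambda>x. u x + v x) \<in> fin_energy r \<rho>"
proof (rule fin_energyI)
  show "continuous_on K (\<lambda>x. u x + v x)" using u v by (intro continuous_intros fin_energy_cont)
  show "B k r \<rho> (\<lambda>x. u x + v x) (\<lambda>x. u x + v x) \<le> 2 * En r \<rho> u u + 2 * En r \<rho> v v" for k
    using B_parallelogram[of k r \<rho> u v] B_nonneg[OF m, of k "\<lambda>x. u x - v x"]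
      En_square(2)[OF m u, of k] En_square(2)[OF m v, of k] by linarith
qed

lemma fin_energy_scale: "u \<in> fin_energy r \<rho> \<Longrightarrow> (\<lambda>x. c * u x) \<in> fin_energy r \<rho>"
proof -
  assume u: "u \<in> fin_energy r \<rho>"
  then obtain C where C: "\<And>m. B m r \<rho> u u \<le> C" by (auto simp: fin_energy_def)
  show ?thesis
  proof (rule fin_energyI)
    show "continuous_on K (\<lambda>x. c * u x)" using u by (intro continuous_intros fin_energy_cont)
    show "B k r \<rho> (\<lambda>x. c * u x) (\<lambda>x. c * u x) \<le> c * (c * C)" for k
      unfolding B_scale_left B_scale_right using mult_left_mono[OF C, of "c * c"] by (simp add: mult.assoc)
  qed
qed

lemma fin_energy_diff:
  "matching r \<rho> \<Longrightarrow> u \<in> fin_energy r \<rho> \<Longrightarrow> v \<in> fin_energy r \<rho> \<Longrightarrow> (\<lambda>x. u x - v x) \<in> fin_energy r \<rho>"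
  using fin_energy_add[of r \<rho> u "\<lambda>x. (-1) * v x"] fin_energy_scale[of v r \<rho> "-1"] by simp

lemma fin_energy_sym:
  assumes "three_sym \<pi>" "u \<in> fin_energy r \<rho>" shows "u \<circ> sym \<pi> \<in> fin_energy r \<rho>"
proof -
  obtain C where "\<And>m. B m r \<rho> u u \<le> C" using assms by (auto simp: fin_energy_def)
  then show ?thesis using sym_K[OF assms(1)]
    by (intro fin_energyI[of _ _ _ C] continuous_on_compose sym_cont continuous_on_subset[OF fin_energy_cont[OF assms(2)]])
       (auto simp: B_sym[OF assms(1)])
qed

lemma B_polarize: "B m r \<rho> u v = (B m r \<rho> (\<lambda>x. u x + v x) (\<lambda>x. u x + v x) - B m r \<rho> (\<lambda>x. u x - v x) (\<lambda>x. u x - v x)) / 4"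
  by (simp add: B_add_left B_add_right B_diff_left B_diff_right B_commute[of _ _ _ v u])

lemma En_polarize:
  assumes m: "matching r \<rho>" and u: "u \<in> fin_energy r \<rho>" and v: "v \<in> fin_energy r \<rho>"
  shows "(\<lambda>m. B m r \<rho> u v) \<longlonglongrightarrow> (En r \<rho> (\<lambda>x. u x + v x) (\<lambda>x. u x + v x) - En r \<rho> (\<lambda>x. u x - v x) (\<lambda>x. u x - v x)) / 4"
  unfolding B_polarize[of _ _ _ u v]
  by (intro tendsto_intros En_square fin_energy_add fin_energy_diff m u v) simp

lemma En_tendsto:
  assumes "matching r \<rho>" "u \<in> fin_energy r \<rho>" "v \<in> fin_energy r \<rho>"
  shows "(\<lambda>m. B m r \<rho> u v) \<longlonglongrightarrow> En r \<rho> u v"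
  using En_polarize[OF assms] by (simp add: En_def limI)

text \<open>All other terms of the recursion are nonnegative, so a single cell carries at most the
  total energy, rescaled by r 1.\<close>

lemma fin_energy_cell:
  assumes m: "matching r \<rho>" and u: "u \<in> fin_energy r \<rho>"
  shows "u \<circ> G i \<in> fin_energy (r \<circ> Suc) (\<rho> \<circ> Suc)" "B k (r \<circ> Suc) (\<rho> \<circ> Suc) (u \<circ> G i) (u \<circ> G i) \<le> r 1 * En r \<rho> u u"
proof -
  have pos: "0 < r 1" "0 < \<rho> 1" using matching_pos[OF m, of 1] by auto
  have le: "B k (r \<circ> Suc) (\<rho> \<circ> Suc) (u \<circ> G i) (u \<circ> G i) \<le> r 1 * En r \<rho> u u" for k
  proof -
    have "B k (r \<circ> Suc) (\<rho> \<circ> Suc) (u \<circ> G i) (u \<circ> G i) \<le> (\<Sum>i\<in>UNIV. B k (r \<circ> Suc) (\<rho> \<circ> Suc) (u \<circ> G i) (u \<circ> G i))"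
      by (rule member_le_sum) (auto intro: B_nonneg matching_shift m)
    moreover have "0 \<le> 1 / \<rho> 1 * (\<Sum>i\<in>UNIV. dyad k (u \<circ> e i) (u \<circ> e i))"
      using pos by (intro mult_nonneg_nonneg sum_nonneg dyad_nonneg) auto
    ultimately have "1 / r 1 * B k (r \<circ> Suc) (\<rho> \<circ> Suc) (u \<circ> G i) (u \<circ> G i) \<le> B (Suc k) r \<rho> u u"
      using pos by (simp add: divide_right_mono add_increasing2)
    also have "\<dots> \<le> En r \<rho> u u" by (rule En_square[OF m u])
    finally show ?thesis using pos by (simp add: field_simps)
  qed
  then show "B k (r \<circ> Suc) (\<rho> \<circ> Suc) (u \<circ> G i) (u \<circ> G i) \<le> r 1 * En r \<rho> u u" .
  show "u \<circ> G i \<in> fin_energy (r \<circ> Suc) (\<rho> \<circ> Suc)"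
    by (rule fin_energyI[OF u_G_cont[OF fin_energy_cont[OF u]] le])
qed

lemma fin_energy_edge:
  assumes m: "matching r \<rho>" and u: "u \<in> fin_energy r \<rho>"
  shows "dyad k (u \<circ> e i) (u \<circ> e i) \<le> \<rho> 1 * En r \<rho> u u"
proof -
  have pos: "0 < r 1" "0 < \<rho> 1" using matching_pos[OF m, of 1] by auto
  have "dyad k (u \<circ> e i) (u \<circ> e i) \<le> (\<Sum>i\<in>UNIV. dyad k (u \<circ> e i) (u \<circ> e i))"
    by (rule member_le_sum) (auto intro: dyad_nonneg)
  moreover have "0 \<le> 1 / r 1 * (\<Sum>i\<in>UNIV. B k (r \<circ> Suc) (\<rho> \<circ> Suc) (u \<circ> G i) (u \<circ> G i))"
    using pos by (intro mult_nonneg_nonneg sum_nonneg B_nonneg matching_shift m) auto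
  ultimately have "1 / \<rho> 1 * dyad k (u \<circ> e i) (u \<circ> e i) \<le> B (Suc k) r \<rho> u u"
    using pos by (simp add: divide_right_mono add_increasing)
  also have "\<dots> \<le> En r \<rho> u u" by (rule En_square[OF m u])
  finally show ?thesis using pos by (simp add: field_simps)
qed

section \<open>Comparison with the energy defined by weak derivatives\<close>

lemma fin_energy_H1:
  assumes "matching r \<rho>" "u \<in> fin_energy r \<rho>" shows "u \<circ> edge_param \<alpha> p w i \<in> H1"
  using assms
proof (induction w arbitrary: u r \<rho>)
  case Nil
  show ?case by (rule dyad_bounded_imp_H1[OF u_e_cont[OF fin_energy_cont[OF Nil(2)]] fin_energy_edge[OF Nil]])
next
  case (Cons j w)
  from Cons.IH[OF matching_shift[OF Cons.prems(1)] fin_energy_cell(1)[OF Cons.prems]]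
  show ?case by (simp add: edge_param_Cons o_assoc)
qed

text \<open>The energy as originally defined, cut off at level m, with exact edge integrals. It
  obeys the recursion of \<open>B\<close> with the dyadic sums replaced by their limits, and is
  therefore caught between \<open>B m\<close> and \<open>En\<close>.\<close>

definition Apart :: "nat \<Rightarrow> (nat \<Rightarrow> real) \<Rightarrow> (nat \<Rightarrow> real) \<Rightarrow> (real^2 \<Rightarrow> real) \<Rightarrow> real" where
  "Apart m r \<rho> u = 1 / res_delta r m * Q \<alpha> p m u + (\<Sum>k<m. 1 / res_gamma r \<rho> (Suc k) * DI \<alpha> p (Suc k) u)"

lemma Q_Suc: "Q \<alpha> p (Suc m) u = (\<Sum>i\<in>UNIV. Q \<alpha> p m (u \<circ> G i))"
  by (simp add: Q_def sum_words_Suc W_Cons o_assoc)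

lemma DI_Suc: "DI \<alpha> p (Suc (Suc k)) u = (\<Sum>i\<in>UNIV. DI \<alpha> p (Suc k) (u \<circ> G i))"
  by (simp add: DI_def sum_words_Suc edge_param_Cons o_assoc)

lemma DI_1: "DI \<alpha> p (Suc 0) u = (\<Sum>i\<in>UNIV. LINT x|UI. (weak_derivative (u \<circ> e i) x)\<^sup>2)"
  by (simp add: DI_def)

lemma Q_0: "Q \<alpha> p 0 u = B 0 r \<rho> u u"
  by (simp add: Q_def Q0_def sum_three[of _ 0] power2_eq_square three_numerals)

lemma Apart_Suc:
  "Apart (Suc m) r \<rho> u = 1 / r 1 * (\<Sum>i\<in>UNIV. Apart m (r \<circ> Suc) (\<rho> \<circ> Suc) (u \<circ> G i))
    + 1 / \<rho> 1 * (\<Sum>i\<in>UNIV. LINT x|UI. (weak_derivative (u \<circ> e i) x)\<^sup>2)"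
proof -
  have g1: "res_gamma r \<rho> (Suc 0) = \<rho> 1" by (simp add: res_gamma_def)
  have "(\<Sum>k<Suc m. 1 / res_gamma r \<rho> (Suc k) * DI \<alpha> p (Suc k) u) =
    1 / \<rho> 1 * DI \<alpha> p (Suc 0) u + (\<Sum>k<m. 1 / res_gamma r \<rho> (Suc (Suc k)) * DI \<alpha> p (Suc (Suc k)) u)"
    by (subst sum.lessThan_Suc_shift) (simp add: g1)
  also have "(\<Sum>k<m. 1 / res_gamma r \<rho> (Suc (Suc k)) * DI \<alpha> p (Suc (Suc k)) u) =
    1 / r 1 * (\<Sum>i\<in>UNIV. \<Sum>k<m. 1 / res_gamma (r \<circ> Suc) (\<rho> \<circ> Suc) (Suc k) * DI \<alpha> p (Suc k) (u \<circ> G i))"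
    unfolding res_gamma_Suc DI_Suc
    by (subst sum.swap) (simp add: sum_distrib_left mult.assoc)
  finally show ?thesis
    unfolding Apart_def res_delta_Suc Q_Suc DI_1 sum.distrib
    by (simp add: sum_distrib_left distrib_left)
qed

lemma B_le_Apart:
  assumes "matching r \<rho>" "continuous_on K u" "\<And>w i. u \<circ> edge_param \<alpha> p w i \<in> H1"
  shows "B m r \<rho> u u \<le> Apart m r \<rho> u"
  using assms
proof (induction m arbitrary: r \<rho> u)
  case 0 then show ?case by (simp add: Apart_def res_delta_def Q_0[of _ r \<rho>] del: B.simps)
next
  case (Suc m)
  have pos: "0 < r 1" "0 < \<rho> 1" using matching_pos[OF Suc.prems(1), of 1] by auto
  have "B m (r \<circ> Suc) (\<rho> \<circ> Suc) (u \<circ> G i) (u \<circ> G i) \<le> Apart m (r \<circ> Suc) (\<rho> \<circ> Suc) (u \<circ> G i)" for i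
  proof (rule Suc.IH[OF matching_shift[OF Suc.prems(1)]])
    show "continuous_on K (u \<circ> G i)"
      by (rule u_G_cont[OF Suc.prems(2)])
    show "u \<circ> G i \<circ> edge_param \<alpha> p w j \<in> H1" for w j
      using Suc.prems(3)[of "i # w" j] by (simp only: edge_param_Cons o_assoc)
  qed
  moreover have "dyad m (u \<circ> e i) (u \<circ> e i) \<le> (LINT x|UI. (weak_derivative (u \<circ> e i) x)\<^sup>2)" for i
    by (rule H1_dyad_le[OF u_e_cont[OF Suc.prems(2)] Suc.prems(3)])
  ultimately show ?case
    unfolding Apart_Suc B.simps using pos by (intro add_mono mult_left_mono sum_mono) auto
qed

text \<open>In the limit the recursion of \<open>B\<close> becomes the exact recursion of
  \<open>Apart\<close>, now satisfied by \<open>En\<close>. The comparison thus descends to level 0,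
  where it reads \<open>B 0\<close> <= \<open>En\<close>.\<close>

lemma Apart_le_En:
  assumes "matching r \<rho>" "u \<in> fin_energy r \<rho>" shows "Apart m r \<rho> u \<le> En r \<rho> u u"
  using assms
proof (induction m arbitrary: r \<rho> u)
  case 0
  then show ?case using En_square(2)[OF 0, of 0] by (simp add: Apart_def res_delta_def Q_0[of _ r \<rho>] del: B.simps)
next
  case (Suc m)
  have pos: "0 < r 1" "0 < \<rho> 1" using matching_pos[OF Suc.prems(1), of 1] by auto
  let ?D = "\<lambda>i. LINT x|UI. (weak_derivative (u \<circ> e i) x)\<^sup>2"
  note m' = matching_shift[OF Suc.prems(1)] and f' = fin_energy_cell(1)[OF Suc.prems]
  have "(\<lambda>k. B (Suc k) r \<rho> u u) \<longlonglongrightarrow> 1 / r 1 * (\<Sum>i\<in>UNIV. En (r \<circ> Suc) (\<rho> \<circ> Suc) (u \<circ> G i) (u \<circ> G i)) + 1 / \<rho> 1 * (\<Sum>i\<in>UNIV. ?D i)"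
    unfolding B.simps
  proof (intro tendsto_intros En_square(1)[OF m' f'])
    show "(\<lambda>k. dyad k (u \<circ> e i) (u \<circ> e i)) \<longlonglongrightarrow> ?D i" for i
      by (rule H1_dyad_tendsto[OF u_e_cont[OF fin_energy_cont[OF Suc.prems(2)]] fin_energy_H1[OF Suc.prems]])
  qed
  moreover have "(\<lambda>k. B (Suc k) r \<rho> u u) \<longlonglongrightarrow> En r \<rho> u u"
    by (rule LIMSEQ_Suc[OF En_square(1)[OF Suc.prems]])
  ultimately have "En r \<rho> u u = 1 / r 1 * (\<Sum>i\<in>UNIV. En (r \<circ> Suc) (\<rho> \<circ> Suc) (u \<circ> G i) (u \<circ> G i)) + 1 / \<rho> 1 * (\<Sum>i\<in>UNIV. ?D i)"
    by (rule LIMSEQ_unique[symmetric])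
  also have "\<dots> \<ge> Apart (Suc m) r \<rho> u"
    unfolding Apart_Suc using pos by (intro add_mono mult_left_mono sum_mono Suc.IH[OF m' f']) auto
  finally show ?case .
qed

lemma Q_nonneg: "0 \<le> Q \<alpha> p m u"
  unfolding Q_def Q0_def by (intro sum_nonneg) auto

lemma DI_nonneg: "0 \<le> DI \<alpha> p m u"
  unfolding DI_def by (intro sum_nonneg integral_nonneg_AE) auto

text \<open>The bounds B m <= Apart m <= En force \<open>Apart m\<close> to converge to
  \<open>En\<close>. Its edge part is a bounded series of nonnegative terms, hence convergent, and
  the vertex part converges as the difference. Conversely, convergence of both parts bounds all
  \<open>B m\<close>.\<close>

lemma energy_domain_eq:
  assumes m: "matching r \<rho>" shows "energy_domain \<alpha> p K r \<rho> = fin_energy r \<rho>"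
    and "\<And>u. u \<in> fin_energy r \<rho> \<Longrightarrow> energy \<alpha> p r \<rho> u = En r \<rho> u u"
proof -
  define q where "q u = (\<lambda>k. 1 / res_delta r k * Q \<alpha> p k u)" for u
  define d where "d u = (\<lambda>k. 1 / res_gamma r \<rho> (Suc k) * DI \<alpha> p (Suc k) u)" for u
  have A: "Apart k r \<rho> u = q u k + (\<Sum>j<k. d u j)" for u k
    by (simp add: Apart_def q_def d_def)
  have q0: "0 \<le> q u k" for u k unfolding q_def using res_delta_pos[OF m, of k] Q_nonneg by simp
  have d0: "0 \<le> d u k" for u k unfolding d_def using res_gamma_pos[OF m, of k] DI_nonneg by simp
  have fwd: "convergent (q u) \<and> summable (d u) \<and> lim (q u) + (\<Sum>k. d u k) = En r \<rho> u u" if u: "u \<in> fin_energy r \<rho>" for u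
  proof -
    have AE: "(\<lambda>k. Apart k r \<rho> u) \<longlonglongrightarrow> En r \<rho> u u"
      by (rule tendsto_sandwich[OF _ _ En_square(1)[OF m u] tendsto_const])
         (auto intro!: always_eventually B_le_Apart m fin_energy_cont[OF u] fin_energy_H1[OF m u] Apart_le_En u)
    have s: "summable (d u)"
    proof (rule summableI_nonneg_bounded[OF d0])
      show "(\<Sum>j<k. d u j) \<le> En r \<rho> u u" for k
        using Apart_le_En[OF m u, of k] q0[of u k] unfolding A by linarith
    qed
    have "q u = (\<lambda>k. Apart k r \<rho> u - (\<Sum>j<k. d u j))" by (simp add: A)
    moreover have "(\<lambda>k. Apart k r \<rho> u - (\<Sum>j<k. d u j)) \<longlonglongrightarrow> En r \<rho> u u - (\<Sum>k. d u k)"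
      by (intro tendsto_diff AE summable_LIMSEQ s)
    ultimately have "q u \<longlonglongrightarrow> En r \<rho> u u - (\<Sum>k. d u k)" by simp
    then show ?thesis using s by (auto simp: convergent_def limI)
  qed
  show "energy \<alpha> p r \<rho> u = En r \<rho> u u" if "u \<in> fin_energy r \<rho>" for u
    using fwd[OF that] by (simp only: energy_def q_def d_def)
  show "energy_domain \<alpha> p K r \<rho> = fin_energy r \<rho>"
  proof (intro equalityI subsetI)
    fix u assume u: "u \<in> fin_energy r \<rho>"
    then show "u \<in> energy_domain \<alpha> p K r \<rho>"
      using fwd[OF u] fin_energy_cont[OF u] fin_energy_H1[OF m u]
      by (simp only: energy_domain_def q_def d_def mem_Collect_eq simp_thms)
  next
    fix u assume u: "u \<in> energy_domain \<alpha> p K r \<rho>"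
    then have c: "continuous_on K u" and H: "\<And>w i. u \<circ> edge_param \<alpha> p w i \<in> H1"
      and cq: "convergent (q u)" and sd: "summable (d u)"
      by (simp_all only: energy_domain_def q_def d_def mem_Collect_eq)
    from cq obtain L where "q u \<longlonglongrightarrow> L" by (auto simp: convergent_def)
    then have "Bseq (q u)" using convergent_imp_Bseq cq by blast
    then obtain C where C: "\<And>k. q u k \<le> C" unfolding Bseq_def by (metis abs_le_D1 real_norm_def)
    show "u \<in> fin_energy r \<rho>"
    proof (rule fin_energyI[OF c])
      show "B k r \<rho> u u \<le> C + (\<Sum>k. d u k)" for k
        using B_le_Apart[OF m c H, of k] C[of k] sum_le_suminf[OF sd, of "{..<k}"] d0[of u] unfolding A by force
    qed
  qed
qed

lemma energy_form_eq:
  assumes m: "matching r \<rho>" and u: "u \<in> fin_energy r \<rho>" and v: "v \<in> fin_energy r \<rho>"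
  shows "energy_form \<alpha> p r \<rho> u v = En r \<rho> u v"
proof -
  have "energy_form \<alpha> p r \<rho> u v = (En r \<rho> (\<lambda>x. u x + v x) (\<lambda>x. u x + v x) - En r \<rho> (\<lambda>x. u x - v x) (\<lambda>x. u x - v x)) / 4"
    unfolding energy_form_def using fin_energy_add[OF m u v] fin_energy_diff[OF m u v] by (simp add: energy_domain_eq(2)[OF m])
  also have "\<dots> = En r \<rho> u v" using LIMSEQ_unique[OF En_polarize[OF m u v] En_tendsto[OF m u v]] .
  finally show ?thesis .
qed

end

section \<open>Oscillation estimates\<close>

context ssg begin

lemma En_cell:
  assumes m: "matching r \<rho>" and u: "u \<in> fin_energy r \<rho>"
  shows "En (r \<circ> Suc) (\<rho> \<circ> Suc) (u \<circ> G i) (u \<circ> G i) \<le> r 1 * En r \<rho> u u"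
  by (rule LIMSEQ_le_const2[OF En_square(1)[OF matching_shift[OF m] fin_energy_cell(1)[OF m u]]])
     (use fin_energy_cell(2)[OF m u] in blast)

text \<open>One level down the energy drops by r 1 <= 3/5 <= 16/25; the last bound has a rational
  root.\<close>

lemma sqrt_En_cell:
  assumes m: "matching r \<rho>" and u: "u \<in> fin_energy r \<rho>"
  shows "sqrt (En (r \<circ> Suc) (\<rho> \<circ> Suc) (u \<circ> G i) (u \<circ> G i)) \<le> 4/5 * sqrt (En r \<rho> u u)"
proof -
  have E: "0 \<le> En r \<rho> u u" by (rule En_nonneg[OF m u])
  have "En (r \<circ> Suc) (\<rho> \<circ> Suc) (u \<circ> G i) (u \<circ> G i) \<le> r 1 * En r \<rho> u u" by (rule En_cell[OF m u])
  also have "\<dots> \<le> 16/25 * En r \<rho> u u" using matching_pos(4)[OF m, of 1] E by (intro mult_right_mono) auto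
  finally have "sqrt (En (r \<circ> Suc) (\<rho> \<circ> Suc) (u \<circ> G i) (u \<circ> G i)) \<le> sqrt (16/25 * En r \<rho> u u)" by simp
  also have "\<dots> = 4/5 * sqrt (En r \<rho> u u)"
    unfolding real_sqrt_mult using real_sqrt_abs[of "4/5"] by (simp add: power2_eq_square)
  finally show ?thesis .
qed

lemma vertex_diff:
  assumes m: "matching r \<rho>" and u: "u \<in> fin_energy r \<rho>"
  shows "\<bar>u (p i) - u (p j)\<bar> \<le> sqrt (En r \<rho> u u)"
proof -
  have *: "(u (p (k + 1)) - u (p (k + 2)))\<^sup>2 \<le> En r \<rho> u u" for k
  proof -
    have "(u (p (k + 1)) - u (p (k + 2)))\<^sup>2 \<le> (\<Sum>k\<in>UNIV. (u (p (k + 1)) - u (p (k + 2)))\<^sup>2)"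
      by (rule member_le_sum) auto
    also have "\<dots> = B 0 r \<rho> u u" by (simp add: power2_eq_square)
    also have "\<dots> \<le> En r \<rho> u u" by (rule En_square[OF m u])
    finally show ?thesis .
  qed
  have "(u (p i) - u (p j))\<^sup>2 \<le> En r \<rho> u u"
  proof (cases i j rule: three_cases)
    case 1 then show ?thesis using En_nonneg[OF m u] by simp
  next
    case 2 then show ?thesis using *[of "i + 2"] by (simp add: three_arith)
  next
    case 3 then show ?thesis using *[of "i + 1"] by (simp add: three_arith power2_commute)
  qed
  then show ?thesis using real_sqrt_le_mono real_sqrt_abs by metis
qed

lemma edge_diff:
  assumes m: "matching r \<rho>" and u: "u \<in> fin_energy r \<rho>" and t: "t \<in> {0..1}" "t' \<in> {0..1}"
  shows "\<bar>u (e i t) - u (e i t')\<bar> \<le> sqrt \<bar>t - t'\<bar> * sqrt (En r \<rho> u u)"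
proof -
  have "(u (e i t) - u (e i t'))\<^sup>2 \<le> \<bar>t - t'\<bar> * (\<rho> 1 * En r \<rho> u u)"
    using dyad_bounded_imp_Hoelder[OF u_e_cont[OF fin_energy_cont[OF u]] fin_energy_edge[OF m u] t] by simp
  also have "\<dots> \<le> \<bar>t - t'\<bar> * En r \<rho> u u"
    using matching_pos(2,5)[OF m, of 1] En_nonneg[OF m u] by (intro mult_left_mono) (auto simp: mult_left_le_one_le)
  finally have "sqrt ((u (e i t) - u (e i t'))\<^sup>2) \<le> sqrt (\<bar>t - t'\<bar> * En r \<rho> u u)" by (rule real_sqrt_le_mono)
  then show ?thesis by (simp add: real_sqrt_mult)
qed

text \<open>Points of K may have infinite addresses, so induction on the depth m only reaches points
  near x; continuity finishes the argument in \<open>osc_bound\<close>. The constant 5 reproduces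
  itself: 5 * 4/5 inside the cell plus 1 from the vertex of the cell to p i. A point on an edge
  costs at most 1 + 4/5 + 1.\<close>

lemma approx_osc:
  assumes "matching r \<rho>" "u \<in> fin_energy r \<rho>" "x \<in> K"
  shows "\<exists>y\<in>K. dist x y \<le> ratio ^ m * diameter K \<and> \<bar>u y - u (p i)\<bar> \<le> 5 * sqrt (En r \<rho> u u)"
  using assms
proof (induction m arbitrary: r \<rho> u x i)
  case 0
  show ?case
    using diameter_bounded_bound[OF compact_imp_bounded[OF K_compact] 0(3) p_K[of i]] p_K En_nonneg[OF 0(1,2)]
    by (intro bexI[of _ "p i"]) auto
next
  case (Suc m)
  note m = Suc.prems(1) and u = Suc.prems(2)
  let ?E = "sqrt (En r \<rho> u u)"
  have E: "0 \<le> ?E" using En_nonneg[OF m u] by simp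
  from Suc.prems(3) show ?case
  proof (cases rule: K_cases)
    case (1 j y)
    from Suc.IH[OF matching_shift[OF m] fin_energy_cell(1)[OF m u] 1(1), of j j]
    obtain z where z: "z \<in> K" "dist y z \<le> ratio ^ m * diameter K"
      "\<bar>u (G j z) - u (p j)\<bar> \<le> 5 * sqrt (En (r \<circ> Suc) (\<rho> \<circ> Suc) (u \<circ> G j) (u \<circ> G j))"
      unfolding o_apply G_p by blast
    have "\<bar>u (G j z) - u (p i)\<bar> \<le> 5 * ?E"
      using z(3) sqrt_En_cell[OF m u, of j] vertex_diff[OF m u, of j i] by linarith
    moreover have "dist x (G j z) \<le> ratio ^ Suc m * diameter K"
      using z(2) ratio(1) by (simp add: 1 dist_G)
    ultimately show ?thesis using z(1) by (intro bexI[of _ "G j z"]) (auto simp: G_K)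
  next
    case (2 j t)
    have "\<bar>u (e j t) - u (e j 1)\<bar> \<le> sqrt \<bar>t - 1\<bar> * ?E" by (rule edge_diff[OF m u]) (use 2 in auto)
    also have "\<dots> \<le> 1 * ?E" using 2 E by (intro mult_right_mono) auto
    finally have "\<bar>u (e j t) - u (G (j + 1) (p (j + 2)))\<bar> \<le> ?E" by (simp add: e_1)
    moreover have "\<bar>u (G (j + 1) (p (j + 2))) - u (p (j + 1))\<bar> \<le> 4/5 * ?E"
      using vertex_diff[OF matching_shift[OF m] fin_energy_cell(1)[OF m u], of "j + 1" "j + 2" "j + 1"] sqrt_En_cell[OF m u, of "j + 1"]
      by (simp add: G_p)
    moreover have "\<bar>u (p (j + 1)) - u (p i)\<bar> \<le> ?E" by (rule vertex_diff[OF m u])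
    ultimately have "\<bar>u x - u (p i)\<bar> \<le> 5 * ?E" using E unfolding 2(2) by linarith
    moreover have "0 \<le> ratio ^ Suc m * diameter K"
      using ratio diameter_ge_0[OF compact_imp_bounded[OF K_compact]] by simp
    ultimately show ?thesis using Suc.prems(3) by (intro bexI[of _ x]) auto
  qed
qed

lemma osc_bound:
  assumes m: "matching r \<rho>" and u: "u \<in> fin_energy r \<rho>" and x: "x \<in> K"
  shows "\<bar>u x - u (p i)\<bar> \<le> 5 * sqrt (En r \<rho> u u)"
proof -
  have "\<forall>n. \<exists>y. y \<in> K \<and> dist x y \<le> ratio ^ n * diameter K \<and> \<bar>u y - u (p i)\<bar> \<le> 5 * sqrt (En r \<rho> u u)"
    using approx_osc[OF m u x, of _ i] by blast
  then obtain y where y: "\<And>n. y n \<in> K" "\<And>n. dist x (y n) \<le> ratio ^ n * diameter K"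
    "\<And>n. \<bar>u (y n) - u (p i)\<bar> \<le> 5 * sqrt (En r \<rho> u u)" using choice by metis
  have "(\<lambda>n. ratio ^ n * diameter K) \<longlonglongrightarrow> 0 * diameter K"
    using ratio by (intro tendsto_mult tendsto_const LIMSEQ_power_zero) auto
  then have "(\<lambda>n. ratio ^ n * diameter K) \<longlonglongrightarrow> 0" by simp
  then have "y \<longlonglongrightarrow> x"
    by (subst tendsto_dist_iff, intro Lim_null_comparison[of "\<lambda>n. dist (y n) x" "\<lambda>n. ratio ^ n * diameter K"])
       (use y(2) in \<open>auto simp: dist_commute\<close>)
  then have "(\<lambda>n. u (y n)) \<longlonglongrightarrow> u x"
    using fin_energy_cont[OF u] y(1) x by (auto simp: continuous_on_sequentially o_def)
  then have "(\<lambda>n. \<bar>u (y n) - u (p i)\<bar>) \<longlonglongrightarrow> \<bar>u x - u (p i)\<bar>" by (intro tendsto_intros)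
  then show ?thesis by (rule LIMSEQ_le_const2) (use y(3) in blast)
qed

lemma osc_cell:
  assumes "matching r \<rho>" "u \<in> fin_energy r \<rho>" "x \<in> K"
  shows "\<bar>u (W w x) - u (W w (p i))\<bar> \<le> 5 * (4/5) ^ length w * sqrt (En r \<rho> u u)"
  using assms
proof (induction w arbitrary: r \<rho> u)
  case Nil then show ?case using osc_bound by simp
next
  case (Cons j w)
  note m = Cons.prems(1) and u = Cons.prems(2)
  have "\<bar>u (W (j # w) x) - u (W (j # w) (p i))\<bar> \<le> 5 * (4/5) ^ length w * sqrt (En (r \<circ> Suc) (\<rho> \<circ> Suc) (u \<circ> G j) (u \<circ> G j))"
  proof -
    have "u (W (j # w) z) = (u \<circ> G j) (W w z)" for z by (simp add: W_Cons)
    then show ?thesis by (simp only: Cons.IH[OF matching_shift[OF m] fin_energy_cell(1)[OF m u] Cons.prems(3)])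
  qed
  also have "\<dots> \<le> 5 * (4/5) ^ length w * (4/5 * sqrt (En r \<rho> u u))"
    by (intro mult_left_mono sqrt_En_cell m u) auto
  finally show ?case by (simp add: mult_ac)
qed

text \<open>No metric equicontinuity is needed for compactness: finitely many reference points suffice,
  simultaneously for all resistances.\<close>

lemma finite_net:
  "\<exists>F. finite F \<and> F \<subseteq> K \<and> (\<forall>r \<rho> u x. matching r \<rho> \<longrightarrow> u \<in> fin_energy r \<rho> \<longrightarrow> x \<in> K \<longrightarrow>
     (\<exists>y\<in>F. \<bar>u x - u y\<bar> \<le> 5 * (4/5) ^ m * sqrt (En r \<rho> u u)))"
proof (induction m)
  case 0
  show ?case using osc_bound p_K by (intro exI[of _ "{p 0}"]) auto
next
  case (Suc m)
  then obtain F where F: "finite F" "F \<subseteq> K"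
    "\<And>r \<rho> u x. matching r \<rho> \<Longrightarrow> u \<in> fin_energy r \<rho> \<Longrightarrow> x \<in> K \<Longrightarrow>
     \<exists>y\<in>F. \<bar>u x - u y\<bar> \<le> 5 * (4/5) ^ m * sqrt (En r \<rho> u u)" by metis
  define \<epsilon> :: real where "\<epsilon> = 5 * (4/5) ^ Suc m"
  have eps: "0 < \<epsilon>" by (simp add: \<epsilon>_def)
  \<comment> \<open>On edges only Hoelder continuity of order 1/2 is available, so the mesh 1/N must
    be at most \<epsilon>^2.\<close>
  obtain N0 :: nat where "1 / \<epsilon>\<^sup>2 < real N0" using reals_Archimedean2 by blast
  define N where "N = Suc N0"
  have N: "1 / real N \<le> \<epsilon>\<^sup>2" "0 < N"
  proof -
    have "1 / \<epsilon>\<^sup>2 < real N" using \<open>1 / \<epsilon>\<^sup>2 < real N0\<close> by (simp add: N_def)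
    then show "1 / real N \<le> \<epsilon>\<^sup>2" using eps by (simp add: field_simps N_def)
  qed (simp add: N_def)
  define F' where "F' = (\<Union>i. G i ` F) \<union> (\<Union>i. (\<lambda>k. e i (real k / real N)) ` {..N})"
  have "finite F'" using F(1) by (simp add: F'_def)
  moreover have "F' \<subseteq> K"
    using F(2) N(2) by (auto simp: F'_def intro!: G_K e_K)
  moreover have "\<exists>y\<in>F'. \<bar>u x - u y\<bar> \<le> \<epsilon> * sqrt (En r \<rho> u u)"
    if m: "matching r \<rho>" and u: "u \<in> fin_energy r \<rho>" and x: "x \<in> K" for r \<rho> u x
    using x
  proof (cases rule: K_cases)
    case (1 j z)
    from F(3)[OF matching_shift[OF m] fin_energy_cell(1)[OF m u] 1(1), of j]
    obtain y where y: "y \<in> F" "\<bar>u (G j z) - u (G j y)\<bar> \<le> 5 * (4/5) ^ m * sqrt (En (r \<circ> Suc) (\<rho> \<circ> Suc) (u \<circ> G j) (u \<circ> G j))"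
      by auto
    note y(2)
    also have "5 * (4/5) ^ m * sqrt (En (r \<circ> Suc) (\<rho> \<circ> Suc) (u \<circ> G j) (u \<circ> G j)) \<le> 5 * (4/5) ^ m * (4/5 * sqrt (En r \<rho> u u))"
      by (intro mult_left_mono sqrt_En_cell m u) auto
    finally have "\<bar>u (G j z) - u (G j y)\<bar> \<le> \<epsilon> * sqrt (En r \<rho> u u)" by (simp add: \<epsilon>_def mult_ac)
    then show ?thesis using y(1) 1 by (intro bexI[of _ "G j y"]) (auto simp: F'_def)
  next
    case (2 j t)
    define k where "k = nat \<lfloor>t * real N\<rfloor>"
    have rk: "real k = of_int \<lfloor>t * real N\<rfloor>" using 2 by (simp add: k_def)
    have k: "real k \<le> t * real N" "t * real N < real k + 1" unfolding rk by linarith+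
    have "real k \<le> real N" using k(1) 2 N(2) by (smt (verit) greaterThanLessThan_iff mult_left_le_one_le of_nat_0_le_iff)
    then have kN: "k \<le> N" by simp
    have "\<bar>t - real k / real N\<bar> \<le> 1 / real N"
    proof -
      have "0 \<le> t - real k / real N" using k(1) N(2) by (simp add: field_simps)
      moreover have "t < (real k + 1) / real N" using k(2) N(2) by (simp add: pos_less_divide_eq)
      then have "t - real k / real N \<le> 1 / real N" by (simp add: add_divide_distrib)
      ultimately show ?thesis by simp
    qed
    then have "sqrt \<bar>t - real k / real N\<bar> \<le> sqrt (\<epsilon>\<^sup>2)" using N(1) by (intro real_sqrt_le_mono) linarith
    then have s: "sqrt \<bar>t - real k / real N\<bar> \<le> \<epsilon>" using eps by simp
    have "\<bar>u (e j t) - u (e j (real k / real N))\<bar> \<le> sqrt \<bar>t - real k / real N\<bar> * sqrt (En r \<rho> u u)"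
      by (rule edge_diff[OF m u]) (use 2 kN N(2) in auto)
    also have "\<dots> \<le> \<epsilon> * sqrt (En r \<rho> u u)" using s En_nonneg[OF m u] by (intro mult_right_mono) auto
    finally show ?thesis using 2 kN by (intro bexI[of _ "e j (real k / real N)"]) (auto simp: F'_def)
  qed
  ultimately show ?case unfolding \<epsilon>_def by (intro exI[of _ F']) blast
qed

section \<open>Transplanting functions into cells\<close>

lemma dyad_zero: "dyad N (\<lambda>_. 0) g = 0" "dyad N g (\<lambda>_. 0) = 0"
  by (simp_all add: dyad_def)

lemma B_zero: "B m r \<rho> (\<lambda>_. 0) v = 0"
  using B_scale_left[of m r \<rho> 0 "\<lambda>_. 0" v] by simp

lemma B_paste:
  "B (Suc m) r \<rho> (paste f) v = 1 / r 1 * (\<Sum>i\<in>UNIV. B m (r \<circ> Suc) (\<rho> \<circ> Suc) (f i) (v \<circ> G i))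
   + 1 / \<rho> 1 * (\<Sum>i\<in>UNIV. dyad m (\<lambda>t. f (i + 2) (p (i + 1)) + t * (f (i + 1) (p (i + 2)) - f (i + 2) (p (i + 1)))) (v \<circ> e i))"
proof -
  have "B m (r \<circ> Suc) (\<rho> \<circ> Suc) (paste f \<circ> G i) (v \<circ> G i) = B m (r \<circ> Suc) (\<rho> \<circ> Suc) (f i) (v \<circ> G i)" for i
    by (rule B_cong) (simp_all add: paste_G)
  moreover have "dyad m (paste f \<circ> e i) (v \<circ> e i) =
    dyad m (\<lambda>t. f (i + 2) (p (i + 1)) + t * (f (i + 1) (p (i + 2)) - f (i + 2) (p (i + 1)))) (v \<circ> e i)" for i
    by (rule dyad_cong) (simp_all add: paste_e del: atLeastAtMost_iff)
  ultimately show ?thesis by (simp only: B.simps)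
qed

text \<open>Extension by zero out of cell i. If u vanishes at the vertices, the affine pieces on the
  joining edges are zero as well and cost no energy.\<close>

definition T :: "3 \<Rightarrow> (real^2 \<Rightarrow> real) \<Rightarrow> real^2 \<Rightarrow> real" where
  "T i u = paste (\<lambda>j. if j = i then u else (\<lambda>_. 0))"

definition vanish :: "(real^2 \<Rightarrow> real) \<Rightarrow> bool" where
  "vanish u \<longleftrightarrow> (\<forall>i. u (p i) = 0)"

lemma T_G: "y \<in> K \<Longrightarrow> T i u (G j y) = (if j = i then u y else 0)"
  by (simp add: T_def paste_G)

lemma T_e: "vanish u \<Longrightarrow> t \<in> {0..1} \<Longrightarrow> T i u (e j t) = 0"
  by (simp add: T_def paste_e vanish_def del: atLeastAtMost_iff)

lemma T_vanish: "vanish u \<Longrightarrow> vanish (T i u)"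
  by (simp add: T_def paste_p vanish_def)

lemma T_cont: "continuous_on K u \<Longrightarrow> continuous_on K (T i u)"
  unfolding T_def by (rule paste_cont) auto

text \<open>Only cell i contributes, and v enters through its restriction to that cell, whatever
  values this has at the vertices.\<close>

lemma B_T:
  assumes "vanish u"
  shows "B (Suc m) r \<rho> (T i u) v = 1 / r 1 * B m (r \<circ> Suc) (\<rho> \<circ> Suc) u (v \<circ> G i)"
proof -
  have "(\<Sum>j\<in>UNIV. B m (r \<circ> Suc) (\<rho> \<circ> Suc) (if j = i then u else (\<lambda>_. 0)) (v \<circ> G j)) =
    (\<Sum>j\<in>UNIV. if j = i then B m (r \<circ> Suc) (\<rho> \<circ> Suc) u (v \<circ> G i) else 0)"
    by (intro sum.cong) (auto simp: B_zero)
  moreover have "(if a then u else (\<lambda>_. 0)) (p k) = 0" for a k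
    using assms by (simp add: vanish_def)
  ultimately show ?thesis unfolding T_def B_paste by (simp add: dyad_zero)
qed

lemma T_fin_energy:
  assumes m: "matching r \<rho>" and u: "u \<in> fin_energy (r \<circ> Suc) (\<rho> \<circ> Suc)" "vanish u"
  shows "T i u \<in> fin_energy r \<rho>"
proof (rule fin_energyI)
  show "continuous_on K (T i u)" by (rule T_cont[OF fin_energy_cont[OF u(1)]])
  have 1: "B (Suc k) r \<rho> (T i u) (T i u) \<le> 1 / r 1 * En (r \<circ> Suc) (\<rho> \<circ> Suc) u u" for k
  proof -
    have "B k (r \<circ> Suc) (\<rho> \<circ> Suc) u (T i u \<circ> G i) = B k (r \<circ> Suc) (\<rho> \<circ> Suc) u u"
      by (rule B_cong) (simp_all add: T_G)
    then show ?thesis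
      unfolding B_T[OF u(2)] using En_square(2)[OF matching_shift[OF m] u(1), of k] matching_pos(1)[OF m, of 1]
      by (simp add: divide_right_mono)
  qed
  then show "B k r \<rho> (T i u) (T i u) \<le> 1 / r 1 * En (r \<circ> Suc) (\<rho> \<circ> Suc) u u" for k
    using B_mono_Suc[OF m, of k "T i u"] order_trans by blast
qed

lemma En_T:
  assumes m: "matching r \<rho>" and u: "u \<in> fin_energy (r \<circ> Suc) (\<rho> \<circ> Suc)" "vanish u" and v: "v \<in> fin_energy r \<rho>"
  shows "En r \<rho> (T i u) v = 1 / r 1 * En (r \<circ> Suc) (\<rho> \<circ> Suc) u (v \<circ> G i)"
proof (rule LIMSEQ_unique)
  show "(\<lambda>m. B (Suc m) r \<rho> (T i u) v) \<longlonglongrightarrow> En r \<rho> (T i u) v"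
    by (rule LIMSEQ_Suc[OF En_tendsto[OF m T_fin_energy[OF m u] v]])
  show "(\<lambda>m. B (Suc m) r \<rho> (T i u) v) \<longlonglongrightarrow> 1 / r 1 * En (r \<circ> Suc) (\<rho> \<circ> Suc) u (v \<circ> G i)"
    unfolding B_T[OF u(2)] by (intro tendsto_intros En_tendsto matching_shift m u fin_energy_cell(1) v)
qed

primrec Tw :: "3 list \<Rightarrow> (real^2 \<Rightarrow> real) \<Rightarrow> real^2 \<Rightarrow> real" where
  "Tw [] u = u"
| "Tw (i # w) u = T i (Tw w u)"

definition shift :: "nat \<Rightarrow> (nat \<Rightarrow> real) \<Rightarrow> nat \<Rightarrow> real" where
  "shift n r = (\<lambda>i. r (i + n))"

lemma shift_0 [simp]: "shift 0 r = r" and shift_Suc: "shift n (r \<circ> Suc) = shift (Suc n) r"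
  by (auto simp: shift_def)

lemma matching_shift_n: "matching r \<rho> \<Longrightarrow> matching (shift n r) (shift n \<rho>)"
  by (auto simp: matching_def shift_def)

lemma Tw_vanish: "vanish u \<Longrightarrow> vanish (Tw w u)"
  by (induction w) (auto intro: T_vanish)

lemma Tw_fin_energy:
  assumes "matching r \<rho>" "u \<in> fin_energy (shift (length w) r) (shift (length w) \<rho>)" "vanish u"
  shows "Tw w u \<in> fin_energy r \<rho>"
  using assms
proof (induction w arbitrary: r \<rho>)
  case (Cons i w)
  have "u \<in> fin_energy (shift (length w) (r \<circ> Suc)) (shift (length w) (\<rho> \<circ> Suc))"
    using Cons.prems(2) by (simp add: shift_Suc)
  from T_fin_energy[OF Cons.prems(1) Cons.IH[OF matching_shift[OF Cons.prems(1)] this Cons.prems(3)] Tw_vanish[OF Cons.prems(3)]]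
  show ?case by simp
qed simp

lemma Tw_W:
  "x \<in> K \<Longrightarrow> length w = length w' \<Longrightarrow> Tw w u (W w' x) = (if w = w' then u x else 0)"
proof (induction w arbitrary: w')
  case (Cons i w)
  then obtain j w'' where w': "w' = j # w''" by (cases w') auto
  show ?case using Cons W_K[OF Cons.prems(1)] by (auto simp: w' W_Cons T_G)
qed simp

text \<open>The scaling factors multiply up along the word. Even if v vanishes on V_0, its
  restriction to the cell need not, so the equation for u is required on all of
  \<open>fin_energy\<close>.\<close>

lemma En_Tw:
  assumes "matching r \<rho>" "u \<in> fin_energy (shift (length w) r) (shift (length w) \<rho>)" "vanish u" "v \<in> fin_energy r \<rho>"
  shows "En r \<rho> (Tw w u) v = 1 / res_delta r (length w) * En (shift (length w) r) (shift (length w) \<rho>) u (v \<circ> W w)"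
  using assms
proof (induction w arbitrary: r \<rho> v)
  case Nil then show ?case by (simp add: res_delta_def)
next
  case (Cons i w)
  have u': "u \<in> fin_energy (shift (length w) (r \<circ> Suc)) (shift (length w) (\<rho> \<circ> Suc))"
    using Cons.prems(2) by (simp add: shift_Suc)
  have Tu: "Tw w u \<in> fin_energy (r \<circ> Suc) (\<rho> \<circ> Suc)"
    by (rule Tw_fin_energy[OF matching_shift[OF Cons.prems(1)] u' Cons.prems(3)])
  have "En r \<rho> (Tw (i # w) u) v = 1 / r 1 * En (r \<circ> Suc) (\<rho> \<circ> Suc) (Tw w u) (v \<circ> G i)"
    using En_T[OF Cons.prems(1) Tu Tw_vanish[OF Cons.prems(3)] Cons.prems(4)] by simp
  also have "\<dots> = 1 / r 1 * (1 / res_delta (r \<circ> Suc) (length w) *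
     En (shift (length w) (r \<circ> Suc)) (shift (length w) (\<rho> \<circ> Suc)) u (v \<circ> G i \<circ> W w))"
    by (subst Cons.IH[OF matching_shift[OF Cons.prems(1)] u' Cons.prems(3) fin_energy_cell(1)[OF Cons.prems(1,4)]]) simp
  finally show ?case by (simp only: shift_Suc res_delta_Suc W_Cons o_assoc length_Cons
      mult.assoc[symmetric] times_divide_times_eq mult_1)
qed

lemma fin_energy_W:
  assumes "matching r \<rho>" "v \<in> fin_energy r \<rho>"
  shows "v \<circ> W w \<in> fin_energy (shift (length w) r) (shift (length w) \<rho>)"
  using assms
proof (induction w arbitrary: r \<rho> v)
  case (Cons i w)
  from Cons.IH[OF matching_shift[OF Cons.prems(1)] fin_energy_cell(1)[OF Cons.prems]]
  show ?case by (simp only: shift_Suc W_Cons o_assoc length_Cons)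
qed simp

section \<open>Harmonic functions\<close>

text \<open>\<open>harm r a i j\<close> is the value at $G_i(p_j)$ of the energy minimizing extension of the boundary values $a$,
  as computed by the $\Delta$-$Y$ transform.\<close>

definition harm :: "real \<Rightarrow> (3 \<Rightarrow> real) \<Rightarrow> 3 \<Rightarrow> 3 \<Rightarrow> real" where
  "harm r a i j = (if j = i then a i else (1 - r) * a i + r / 3 * (a j + (\<Sum>k\<in>UNIV. a k) - a i))"

lemma harm_values:
  "harm r a i i = a i" "harm r a i (i + 1) = (1 - r) * a i + r / 3 * (2 * a (i + 1) + a (i + 2))"
  "harm r a i (i + 2) = (1 - r) * a i + r / 3 * (a (i + 1) + 2 * a (i + 2))"
  by (simp_all add: harm_def sum_three[of a i] three_arith)

text \<open>The new values are convex combinations of the boundary values, with weights 1 - r, 2 r /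
  3 and r / 3.\<close>

lemma harm_range:
  assumes r: "0 < r" "r \<le> 3/5" and a: "\<And>k. lo \<le> a k" "\<And>k. a k \<le> hi"
  shows "lo \<le> harm r a i j" "harm r a i j \<le> hi"
proof -
  have 1: "lo \<le> (1 - r) * x + r / 3 * (y + 2 * z)" if "lo \<le> x" "lo \<le> y" "lo \<le> z" for x y z
  proof -
    have "(1 - r) * lo + r / 3 * (lo + 2 * lo) \<le> (1 - r) * x + r / 3 * (y + 2 * z)"
      using r that by (intro add_mono mult_left_mono) auto
    then show ?thesis by (simp add: algebra_simps)
  qed
  have 2: "(1 - r) * x + r / 3 * (y + 2 * z) \<le> hi" if "x \<le> hi" "y \<le> hi" "z \<le> hi" for x y z
  proof -
    have "(1 - r) * x + r / 3 * (y + 2 * z) \<le> (1 - r) * hi + r / 3 * (hi + 2 * hi)"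
      using r that by (intro add_mono mult_left_mono) auto
    then show ?thesis by (simp add: algebra_simps)
  qed
  have 3: "2 * y + z = z + 2 * y" for y z :: real by simp
  show "lo \<le> harm r a i j"
  proof (cases i j rule: three_cases)
    case c: 2 show ?thesis unfolding c harm_values 3 by (intro 1 a)
  next
    case c: 3 show ?thesis unfolding c harm_values by (intro 1 a)
  qed (simp add: harm_values a)
  show "harm r a i j \<le> hi"
  proof (cases i j rule: three_cases)
    case c: 2 show ?thesis unfolding c harm_values 3 by (intro 2 a)
  next
    case c: 3 show ?thesis unfolding c harm_values by (intro 2 a)
  qed (simp add: harm_values a)
qed

text \<open>Inside a cell each difference is r / 3 times a combination of boundary differences of
  size at most 3 * d. This contraction yields the uniform convergence of \<open>Hn\<close>.\<close>

lemma harm_osc: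
  assumes r: "0 < r" "r \<le> 3/5" and a: "\<And>j k. \<bar>a j - a k\<bar> \<le> d"
  shows "\<bar>harm r a i j - harm r a i k\<bar> \<le> 3/5 * d"
proof -
  have d: "0 \<le> d" using a[of 0 0] by simp
  have rd: "r * d \<le> 3/5 * d" using r d by (intro mult_right_mono) auto
  have m: "\<bar>r / 3 * x\<bar> \<le> 3/5 * d" if "\<bar>x\<bar> \<le> 3 * d" for x
  proof -
    have "\<bar>r / 3 * x\<bar> = r / 3 * \<bar>x\<bar>" using r by (simp add: abs_mult)
    also have "\<dots> \<le> r / 3 * (3 * d)" using that r by (intro mult_left_mono) auto
    finally show ?thesis using rd by simp
  qed
  note ai = a[of i "i + 1"] a[of i "i + 2"] a[of "i + 1" "i + 2"]
  have 1: "\<bar>harm r a i i - harm r a i (i + 1)\<bar> \<le> 3/5 * d"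
  proof -
    have "harm r a i i - harm r a i (i + 1) = r / 3 * (3 * a i - 2 * a (i + 1) - a (i + 2))"
      unfolding harm_values by (simp add: field_simps)
    moreover have "\<bar>3 * a i - 2 * a (i + 1) - a (i + 2)\<bar> \<le> 3 * d" using ai by linarith
    ultimately show ?thesis using m by (simp only:)
  qed
  have 2: "\<bar>harm r a i i - harm r a i (i + 2)\<bar> \<le> 3/5 * d"
  proof -
    have "harm r a i i - harm r a i (i + 2) = r / 3 * (3 * a i - a (i + 1) - 2 * a (i + 2))"
      unfolding harm_values by (simp add: field_simps)
    moreover have "\<bar>3 * a i - a (i + 1) - 2 * a (i + 2)\<bar> \<le> 3 * d" using ai by linarith
    ultimately show ?thesis using m by (simp only:)
  qed
  have 3: "\<bar>harm r a i (i + 1) - harm r a i (i + 2)\<bar> \<le> 3/5 * d"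
  proof -
    have "harm r a i (i + 1) - harm r a i (i + 2) = r / 3 * (a (i + 1) - a (i + 2))"
      unfolding harm_values by (simp add: field_simps)
    moreover have "\<bar>a (i + 1) - a (i + 2)\<bar> \<le> 3 * d" using ai d by linarith
    ultimately show ?thesis using m by (simp only:)
  qed
  show ?thesis
    using 1 2 3 d by (cases i j rule: three_cases; cases i k rule: three_cases) (auto simp: abs_minus_commute)
qed

text \<open>The case of equality in \<open>network_inequality\<close>: by \<open>d1\<close> to
  \<open>d4\<close> each potential drop is, up to sign, the resistance times the current that served
  there as slope, so Ohm's law holds throughout.\<close>

lemma harm_energy:
  assumes "5/3 * r + \<rho> = 1" "0 < r" "0 < \<rho>"
  shows "1 / r * (\<Sum>i\<in>UNIV. \<Sum>j\<in>UNIV. (harm r a i (j + 1) - harm r a i (j + 2))\<^sup>2)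
    + 1 / \<rho> * (\<Sum>i\<in>UNIV. (harm r a (i + 1) (i + 2) - harm r a (i + 2) (i + 1))\<^sup>2)
    = (\<Sum>i\<in>UNIV. (a (i + 1) - a (i + 2))\<^sup>2)"
proof -
  have d1: "harm r a i (i + 1) - harm r a i (i + 2) = r * ((a (i + 1) - a (i + 2)) / 3)" for i
    unfolding harm_values by (simp add: field_simps)
  have d2: "harm r a i (i + 2) - harm r a i i = r * ((a (i + 1) + 2 * a (i + 2) - 3 * a i) / 3)" for i
    unfolding harm_values by (simp add: field_simps)
  have d3: "harm r a i i - harm r a i (i + 1) = r * ((3 * a i - 2 * a (i + 1) - a (i + 2)) / 3)" for i
    unfolding harm_values by (simp add: field_simps)
  have d4: "harm r a (i + 1) (i + 2) - harm r a (i + 2) (i + 1) = \<rho> * (a (i + 1) - a (i + 2))" for i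
  proof -
    have rho: "\<rho> = 1 - 5/3 * r" using assms(1) by simp
    show ?thesis
      using harm_values(2)[of r a "i + 1"] harm_values(3)[of r a "i + 2"] unfolding three_arith rho by (simp add: field_simps)
  qed
  have in1: "(\<Sum>j\<in>UNIV. (harm r a i (j + 1) - harm r a i (j + 2))\<^sup>2) =
     r * (r * (((a (i + 1) - a (i + 2)) / 3)\<^sup>2 + ((a (i + 1) + 2 * a (i + 2) - 3 * a i) / 3)\<^sup>2 + ((3 * a i - 2 * a (i + 1) - a (i + 2)) / 3)\<^sup>2))" for i
    unfolding sum_three[of _ i] three_arith d1 d2 d3 by (simp only: power_mult_distrib power2_eq_square[of r] distrib_left mult.assoc)
  have "1 / r * (\<Sum>i\<in>UNIV. \<Sum>j\<in>UNIV. (harm r a i (j + 1) - harm r a i (j + 2))\<^sup>2)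
     = (\<Sum>i\<in>UNIV. r * (((a (i + 1) - a (i + 2)) / 3)\<^sup>2 + ((a (i + 1) + 2 * a (i + 2) - 3 * a i) / 3)\<^sup>2 + ((3 * a i - 2 * a (i + 1) - a (i + 2)) / 3)\<^sup>2))"
    unfolding in1 sum_distrib_left[symmetric] using assms(2) by simp
  moreover have "1 / \<rho> * (\<Sum>i\<in>UNIV. (harm r a (i + 1) (i + 2) - harm r a (i + 2) (i + 1))\<^sup>2) = (\<Sum>i\<in>UNIV. \<rho> * (a (i + 1) - a (i + 2))\<^sup>2)"
    unfolding d4 power_mult_distrib sum_distrib_left[symmetric] using assms(3) by (simp add: power2_eq_square)
  moreover have "(\<Sum>i\<in>UNIV. r * (((a (i + 1) - a (i + 2)) / 3)\<^sup>2 + ((a (i + 1) + 2 * a (i + 2) - 3 * a i) / 3)\<^sup>2 + ((3 * a i - 2 * a (i + 1) - a (i + 2)) / 3)\<^sup>2))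
     + (\<Sum>i\<in>UNIV. \<rho> * (a (i + 1) - a (i + 2))\<^sup>2) = (\<Sum>i\<in>UNIV. (a (i + 1) - a (i + 2))\<^sup>2)"
  proof -
    have rho: "\<rho> = 1 - 5/3 * r" using assms(1) by simp
    show ?thesis
      unfolding sum_three[of _ 0] three_arith rho by (simp add: three_numerals power2_eq_square field_simps)
  qed
  ultimately show ?thesis by simp
qed

text \<open>Harmonic refinement down to level m, barycentric interpolation inside the cells of that
  level.\<close>

primrec Hn :: "nat \<Rightarrow> (nat \<Rightarrow> real) \<Rightarrow> (3 \<Rightarrow> real) \<Rightarrow> real^2 \<Rightarrow> real" where
  "Hn 0 r a = (\<lambda>x. \<Sum>i\<in>UNIV. a i * bary i x)"
| "Hn (Suc m) r a = paste (\<lambda>i. Hn m (r \<circ> Suc) (harm (r 1) a i))"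

lemma Hn_cont: "continuous_on K (Hn m r a)"
proof (induction m arbitrary: r a)
  case 0 show ?case by (simp, intro continuous_intros bary_cont)
next
  case (Suc m) show ?case by (simp, rule paste_cont, rule Suc)
qed

lemma Hn_p: "Hn m r a (p i) = a i"
proof (induction m arbitrary: r a i)
  case 0
  have "(\<Sum>j\<in>UNIV. a j * bary j (p i)) = (\<Sum>j\<in>UNIV. if j = i then a j else 0)"
    by (intro sum.cong) (auto simp: bary_p)
  then show ?case by simp
next
  case (Suc m) show ?case by (simp add: paste_p Suc harm_values)
qed

definition small :: "(nat \<Rightarrow> real) \<Rightarrow> bool" where
  "small r \<longleftrightarrow> (\<forall>i\<ge>1. 0 < r i \<and> r i \<le> 3/5)"

lemma small_shift: "small r \<Longrightarrow> small (r \<circ> Suc)" and small_1: "small r \<Longrightarrow> 0 < r 1 \<and> r 1 \<le> 3/5"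
  and matching_small: "matching r \<rho> \<Longrightarrow> small r"
  by (auto simp: small_def dest: matching_pos)

lemma Hn_range:
  assumes "small r" "\<And>k. lo \<le> a k" "\<And>k. a k \<le> hi" "x \<in> K"
  shows "lo \<le> Hn m r a x \<and> Hn m r a x \<le> hi"
  using assms
proof (induction m arbitrary: r a x)
  case 0
  have "(\<Sum>i\<in>UNIV. lo * bary i x) \<le> (\<Sum>i\<in>UNIV. a i * bary i x)"
    "(\<Sum>i\<in>UNIV. a i * bary i x) \<le> (\<Sum>i\<in>UNIV. hi * bary i x)"
    by (intro sum_mono mult_right_mono bary_nonneg 0)+
  then show ?case by (simp add: bary_sum flip: sum_distrib_left)
next
  case (Suc m)
  note r = small_1[OF Suc.prems(1)]
  have h: "lo \<le> harm (r 1) a i j" "harm (r 1) a i j \<le> hi" for i j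
    by (rule harm_range; use r Suc.prems in auto)+
  from Suc.prems(4) show ?case
  proof (cases rule: K_cases)
    case (1 i y)
    have "lo \<le> Hn m (r \<circ> Suc) (harm (r 1) a i) y \<and> Hn m (r \<circ> Suc) (harm (r 1) a i) y \<le> hi"
      by (rule Suc.IH[OF small_shift[OF Suc.prems(1)] _ _ 1(1)]) (rule h)+
    then show ?thesis unfolding 1(2) Hn.simps paste_G[OF 1(1)] .
  next
    case (2 i t)
    let ?A = "harm (r 1) a (i + 2) (i + 1)" and ?B = "harm (r 1) a (i + 1) (i + 2)"
    have "Hn (Suc m) r a x = (1 - t) * ?A + t * ?B"
      using 2 by (simp add: paste_e Hn_p algebra_simps)
    moreover have "(1 - t) * lo + t * lo \<le> (1 - t) * ?A + t * ?B" "(1 - t) * ?A + t * ?B \<le> (1 - t) * hi + t * hi"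
      using 2 h by (auto intro!: add_mono mult_left_mono)
    ultimately show ?thesis by (simp add: algebra_simps)
  qed
qed

text \<open>On first-level edges only vertex values enter, so consecutive approximations agree
  there; inside a cell the claim recurs with the oscillation reduced to 3/5. At m = 0 both functions
  lie between the extreme boundary values.\<close>

lemma Hn_diff:
  assumes "small r" "\<And>j k. \<bar>a j - a k\<bar> \<le> d" "x \<in> K"
  shows "\<bar>Hn (Suc m) r a x - Hn m r a x\<bar> \<le> (3/5) ^ m * d"
  using assms
proof (induction m arbitrary: r a d x)
  case 0
  define lo where "lo = Min (range a)"
  define hi where "hi = Max (range a)"
  have b: "lo \<le> a k" "a k \<le> hi" for k by (auto simp: lo_def hi_def)
  have "lo \<in> range a" "hi \<in> range a" unfolding lo_def hi_def by (intro Min_in Max_in; simp)+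
  then have "hi - lo \<le> d" using 0(2) by (auto simp: abs_le_iff)
  moreover have "lo \<le> Hn k r a x \<and> Hn k r a x \<le> hi" for k
    by (rule Hn_range[OF 0(1) _ _ 0(3)]) (rule b)+
  from this[of "Suc 0"] this[of 0]
  have "\<bar>Hn (Suc 0) r a x - Hn 0 r a x\<bar> \<le> hi - lo" by linarith
  ultimately show ?case by (simp del: Hn.simps)
next
  case (Suc m)
  note r = small_1[OF Suc.prems(1)]
  have h: "\<bar>harm (r 1) a i j - harm (r 1) a i k\<bar> \<le> 3/5 * d" for i j k
    by (rule harm_osc; use r Suc.prems in auto)
  from Suc.prems(3) show ?case
  proof (cases rule: K_cases)
    case (1 i y)
    have "Hn (Suc (Suc m)) r a x - Hn (Suc m) r a x = Hn (Suc m) (r \<circ> Suc) (harm (r 1) a i) y - Hn m (r \<circ> Suc) (harm (r 1) a i) y"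
      unfolding 1(2) Hn.simps(2)[of "Suc m"] Hn.simps(2)[of m r] by (simp only: paste_G[OF 1(1)])
    also have "\<bar>\<dots>\<bar> \<le> (3/5) ^ m * (3/5 * d)"
      by (rule Suc.IH[OF small_shift[OF Suc.prems(1)] _ 1(1)]) (rule h)
    finally show ?thesis by (simp only: power_Suc2 mult.assoc)
  next
    case (2 i t)
    have t: "t \<in> {0..1}" using 2 by auto
    have "0 \<le> d" using Suc.prems(2)[of 0 0] by simp
    moreover have "Hn (Suc (Suc m)) r a x - Hn (Suc m) r a x = 0"
      unfolding 2(2) Hn.simps(2)[of "Suc m"] Hn.simps(2)[of m r] by (simp only: paste_e[OF t] Hn_p)
    ultimately show ?thesis by simp
  qed
qed

definition H :: "(nat \<Rightarrow> real) \<Rightarrow> (3 \<Rightarrow> real) \<Rightarrow> real^2 \<Rightarrow> real" where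
  "H r a x = lim (\<lambda>m. Hn m r a x)"

lemma H_limit:
  assumes r: "small r"
  shows "uniform_limit K (\<lambda>m. Hn m r a) (H r a) sequentially"
proof -
  define d where "d = (\<Sum>j\<in>UNIV. \<Sum>k\<in>UNIV. \<bar>a j - a k\<bar>)"
  have d: "\<bar>a j - a k\<bar> \<le> d" for j k
  proof -
    have "\<bar>a j - a k\<bar> \<le> (\<Sum>k\<in>UNIV. \<bar>a j - a k\<bar>)" by (rule member_le_sum) auto
    also have "\<dots> \<le> d" unfolding d_def by (rule member_le_sum[of j UNIV "\<lambda>j. \<Sum>k\<in>UNIV. \<bar>a j - a k\<bar>"]) (auto intro: sum_nonneg)
    finally show ?thesis .
  qed
  have "uniform_limit K (\<lambda>n x. \<Sum>i<n. Hn (Suc i) r a x - Hn i r a x) (\<lambda>x. \<Sum>i. Hn (Suc i) r a x - Hn i r a x) sequentially"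
  proof (rule Weierstrass_m_test)
    show "norm (Hn (Suc i) r a x - Hn i r a x) \<le> (3/5) ^ i * d" if "x \<in> K" for i x
      using Hn_diff[OF r d that] by simp
    show "summable (\<lambda>i. (3/5) ^ i * d)" by (intro summable_mult2 summable_geometric) simp
  qed
  then have "uniform_limit K (\<lambda>n x. Hn n r a x - Hn 0 r a x) (\<lambda>x. \<Sum>i. Hn (Suc i) r a x - Hn i r a x) sequentially"
    unfolding sum_lessThan_telescope[of "\<lambda>i. Hn i r a _"] .
  then have "uniform_limit K (\<lambda>n x. Hn n r a x - Hn 0 r a x + Hn 0 r a x) (\<lambda>x. (\<Sum>i. Hn (Suc i) r a x - Hn i r a x) + Hn 0 r a x) sequentially"
    by (intro uniform_limit_intros)
  then have u: "uniform_limit K (\<lambda>n. Hn n r a) (\<lambda>x. (\<Sum>i. Hn (Suc i) r a x - Hn i r a x) + Hn 0 r a x) sequentially"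
    by simp
  have "H r a x = (\<Sum>i. Hn (Suc i) r a x - Hn i r a x) + Hn 0 r a x" if "x \<in> K" for x
    unfolding H_def by (rule limI[OF tendsto_uniform_limitI[OF u that]])
  then show ?thesis using u by (subst uniform_limit_cong'[of K _ _ "H r a" ]) auto
qed

lemma H_tendsto: "small r \<Longrightarrow> x \<in> K \<Longrightarrow> (\<lambda>m. Hn m r a x) \<longlonglongrightarrow> H r a x"
  by (rule tendsto_uniform_limitI[OF H_limit])

lemma H_cont: "small r \<Longrightarrow> continuous_on K (H r a)"
  by (rule uniform_limit_theorem[OF _ H_limit]) (auto simp: Hn_cont)

lemma H_p: "small r \<Longrightarrow> H r a (p i) = a i"
  using H_tendsto[OF _ p_K, of r a i] by (simp add: Hn_p LIMSEQ_const_iff)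

lemma H_G:
  assumes "small r" "y \<in> K"
  shows "H r a (G i y) = H (r \<circ> Suc) (harm (r 1) a i) y"
proof (rule LIMSEQ_unique)
  show "(\<lambda>m. Hn (Suc m) r a (G i y)) \<longlonglongrightarrow> H r a (G i y)"
    by (rule LIMSEQ_Suc[OF H_tendsto[OF assms(1) G_K[OF assms(2)]]])
  show "(\<lambda>m. Hn (Suc m) r a (G i y)) \<longlonglongrightarrow> H (r \<circ> Suc) (harm (r 1) a i) y"
    using H_tendsto[OF small_shift[OF assms(1)] assms(2)] by (simp add: paste_G[OF assms(2)])
qed

lemma H_e:
  assumes "small r" "t \<in> {0..1}"
  shows "H r a (e i t) = harm (r 1) a (i + 2) (i + 1) + t * (harm (r 1) a (i + 1) (i + 2) - harm (r 1) a (i + 2) (i + 1))"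
proof (rule LIMSEQ_unique)
  show "(\<lambda>m. Hn (Suc m) r a (e i t)) \<longlonglongrightarrow> H r a (e i t)"
    by (rule LIMSEQ_Suc[OF H_tendsto[OF assms(1) e_K[OF assms(2)]]])
  show "(\<lambda>m. Hn (Suc m) r a (e i t)) \<longlonglongrightarrow> harm (r 1) a (i + 2) (i + 1) + t * (harm (r 1) a (i + 1) (i + 2) - harm (r 1) a (i + 2) (i + 1))"
    by (simp add: paste_e[OF assms(2)] Hn_p del: atLeastAtMost_iff)
qed

text \<open>On edges \<open>H\<close> is affine, so dyadic sums are exact at every level, and
  \<open>harm_energy\<close> conserves the total from level to level.\<close>

lemma B_H:
  assumes "matching r \<rho>"
  shows "B m r \<rho> (H r a) (H r a) = (\<Sum>i\<in>UNIV. (a (i + 1) - a (i + 2))\<^sup>2)"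
  using assms
proof (induction m arbitrary: r \<rho> a)
  case 0 then show ?case by (simp add: H_p matching_small power2_eq_square)
next
  case (Suc m)
  note sm = matching_small[OF Suc.prems]
  have 1: "B m (r \<circ> Suc) (\<rho> \<circ> Suc) (H r a \<circ> G i) (H r a \<circ> G i) = (\<Sum>j\<in>UNIV. (harm (r 1) a i (j + 1) - harm (r 1) a i (j + 2))\<^sup>2)" for i
    unfolding Suc.IH[OF matching_shift[OF Suc.prems], of "harm (r 1) a i", symmetric]
    by (rule B_cong) (simp_all add: H_G[OF sm])
  have 2: "dyad m (H r a \<circ> e i) (H r a \<circ> e i) = (harm (r 1) a (i + 1) (i + 2) - harm (r 1) a (i + 2) (i + 1))\<^sup>2" for i
    unfolding dyad_affine[of m "harm (r 1) a (i + 2) (i + 1)", symmetric]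
    by (rule dyad_cong) (simp_all add: H_e[OF sm] del: atLeastAtMost_iff)
  show ?case
    unfolding B.simps 1 2 by (rule harm_energy) (use matching_pos[OF Suc.prems, of 1] in auto)
qed

text \<open>A function of bounded energy vanishing on $V_0$ that is constant along all edges of the first level,
  so that its energy stays bounded even when the edge resistances tend to $0$.\<close>

definition bump :: "(nat \<Rightarrow> real) \<Rightarrow> real^2 \<Rightarrow> real" where
  "bump r = paste (\<lambda>i. if i = 2 then (\<lambda>_. 0) else H (r \<circ> Suc) (\<lambda>j. if j = 1 - i then 1 else 0))"

lemma three_facts: "(1::3) - 0 = 1" "(1::3) - 1 = 0" "(0::3) \<noteq> 1" "(1::3) \<noteq> 0" "(2::3) \<noteq> 0" "(2::3) \<noteq> 1" "(0::3) \<noteq> 2" "(1::3) \<noteq> 2"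
   "(0::3) + 1 = 1" "(0::3) + 2 = 2" "(1::3) + 1 = 2" "(1::3) + 2 = 0" "(2::3) + 1 = 0" "(2::3) + 2 = 1"
  using three_arith[of 0] three_arith[of 1] by (simp_all add: three_numerals)

text \<open>Edge 2 joins G 1 (p 0) to G 0 (p 1), the two points where the harmonic pieces have the
  value 1; both ends of each other edge carry 0.\<close>

lemma bump_edges:
  assumes r: "small r" and t: "t \<in> {0..1}" shows "bump r (e i t) = (if i = 2 then 1 else 0)"
proof -
  note s = small_shift[OF r]
  consider "i = 0" | "i = 1" | "i = 2" by (cases "0::3" i rule: three_cases) auto
  then show ?thesis
    unfolding bump_def paste_e[OF t] by cases (simp_all only: three_facts if_True if_False simp_thms H_p[OF s], simp_all)
qed

lemma bump_vanish:
  assumes r: "small r" shows "vanish (bump r)"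
  unfolding vanish_def
proof
  fix i :: 3
  note s = small_shift[OF r]
  consider "i = 0" | "i = 1" | "i = 2" by (cases "0::3" i rule: three_cases) auto
  then show "bump r (p i) = 0"
    unfolding bump_def paste_p by cases (simp_all only: three_facts if_True if_False simp_thms H_p[OF s])
qed

lemma bump_energy:
  assumes m: "matching r \<rho>"
  shows "bump r \<in> fin_energy r \<rho>" "En r \<rho> (bump r) (bump r) \<le> 4 / r 1"
proof -
  note r = matching_small[OF m]
  note s = small_shift[OF r]
  have c: "continuous_on K (bump r)"
    unfolding bump_def by (rule paste_cont) (auto intro: H_cont s)
  have B1: "B k (r \<circ> Suc) (\<rho> \<circ> Suc) (bump r \<circ> G i) (bump r \<circ> G i) = (if i = 2 then 0 else 2)" for i k
  proof (cases "i = 2")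
    case True
    have "B k (r \<circ> Suc) (\<rho> \<circ> Suc) (bump r \<circ> G i) (bump r \<circ> G i) = B k (r \<circ> Suc) (\<rho> \<circ> Suc) (\<lambda>_. 0) (\<lambda>_. 0)"
      by (rule B_cong) (simp_all add: bump_def paste_G True)
    with True show ?thesis by (simp add: B_zero)
  next
    case False
    let ?a = "\<lambda>j. if j = 1 - i then 1 else 0 :: real"
    have "B k (r \<circ> Suc) (\<rho> \<circ> Suc) (bump r \<circ> G i) (bump r \<circ> G i) = B k (r \<circ> Suc) (\<rho> \<circ> Suc) (H (r \<circ> Suc) ?a) (H (r \<circ> Suc) ?a)"
      by (rule B_cong) (simp_all add: bump_def paste_G False)
    also have "\<dots> = (\<Sum>j\<in>UNIV. (?a (j + 1) - ?a (j + 2))\<^sup>2)" by (rule B_H[OF matching_shift[OF m]])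
    also have "\<dots> = 2" unfolding sum_three[of _ "1 - i"] three_arith by (simp add: three_arith)
    finally show ?thesis using False by simp
  qed
  have D1: "dyad k (bump r \<circ> e i) (bump r \<circ> e i) = 0" for k i
  proof -
    have "dyad k (bump r \<circ> e i) (bump r \<circ> e i) = dyad k (\<lambda>t. (if i = 2 then 1 else 0) + t * 0) (\<lambda>t. (if i = 2 then 1 else 0) + t * 0)"
      by (rule dyad_cong) (simp_all add: bump_edges[OF r] del: atLeastAtMost_iff)
    then show ?thesis unfolding dyad_affine by simp
  qed
  \<comment> \<open>Two cells contribute 2 each, the edges nothing.\<close>
  have Bs: "B (Suc k) r \<rho> (bump r) (bump r) = 4 / r 1" for k
    unfolding B.simps B1 D1 by (simp add: sum_three[of _ 2] three_arith)
  then have le: "B k r \<rho> (bump r) (bump r) \<le> 4 / r 1" for k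
    using B_mono_Suc[OF m, of k "bump r"] by simp
  show f: "bump r \<in> fin_energy r \<rho>" by (rule fin_energyI[OF c le])
  show "En r \<rho> (bump r) (bump r) \<le> 4 / r 1"
    by (rule LIMSEQ_le_const2[OF En_square(1)[OF m f]]) (use le in blast)
qed

section \<open>Antisymmetric functions\<close>

text \<open>The sign representation of the symmetric group. Invariance under rotations follows, as
  each of them is a product of two reflections.\<close>

definition anti :: "(real^2 \<Rightarrow> real) \<Rightarrow> bool" where
  "anti u \<longleftrightarrow> (\<forall>c. \<forall>x\<in>K. u (sym (mirror c) x) = - u x)"

text \<open>The signed mean over the six symmetries, which is the orthogonal projection onto the
  antisymmetric functions.\<close>

definition proj :: "(real^2 \<Rightarrow> real) \<Rightarrow> real^2 \<Rightarrow> real" where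
  "proj v x = (\<Sum>c\<in>UNIV. v (sym (rot c) x) - v (sym (mirror c) x)) / 6"

lemma anti_vanish: assumes "anti u" shows "vanish u"
  unfolding vanish_def
proof
  fix i
  \<comment> \<open>The reflection \<open>mirror (i + i)\<close> fixes the letter i, because i + i -
    i = i.\<close>
  have "u (sym (mirror (i + i)) (p i)) = - u (p i)" using assms p_K by (auto simp: anti_def)
  then show "u (p i) = 0" by (simp add: sym_p mirror_def)
qed

lemma anti_rot: assumes "anti u" "x \<in> K" shows "u (sym (rot c) x) = u x"
proof -
  have "sym (mirror c) (sym (mirror 0) x) = sym (rot c) x" by (simp add: sym_comp bij_mirror rot_comp)
  then show ?thesis using assms sym_K[of "mirror 0"] by (metis anti_def minus_minus three_sym_intros(2))
qed

lemma anti_proj: "anti (proj v)"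
  unfolding anti_def
proof (intro allI ballI)
  fix d x assume x: "x \<in> K"
  have "proj v (sym (mirror d) x) = (\<Sum>c\<in>UNIV. v (sym (mirror (c + d)) x) - v (sym (rot (c - d)) x)) / 6"
    unfolding proj_def by (simp add: sym_comp bij_mirror rot_comp)
  also have "(\<Sum>c\<in>UNIV. v (sym (mirror (c + d)) x) - v (sym (rot (c - d)) x)) = (\<Sum>c\<in>UNIV. v (sym (mirror c) x)) - (\<Sum>c\<in>UNIV. v (sym (rot c) x))"
  proof -
    have "(\<Sum>c\<in>UNIV. v (sym (mirror (c + d)) x)) = (\<Sum>c\<in>UNIV. v (sym (mirror c) x))"
      by (rule sum.reindex_bij_witness[of _ "\<lambda>c. c - d" "\<lambda>c. c + d"]) auto
    moreover have "(\<Sum>c\<in>UNIV. v (sym (rot (c - d)) x)) = (\<Sum>c\<in>UNIV. v (sym (rot c) x))"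
      by (rule sum.reindex_bij_witness[of _ "\<lambda>c. c + d" "\<lambda>c. c - d"]) auto
    ultimately show ?thesis by (simp add: sum_subtractf)
  qed
  finally show "proj v (sym (mirror d) x) = - proj v x"
    by (simp add: proj_def sum_subtractf field_simps)
qed

lemma sum_fin_energy:
  assumes "matching r \<rho>" "\<And>c. c \<in> S \<Longrightarrow> f c \<in> fin_energy r \<rho>" "finite S"
  shows "(\<lambda>x. \<Sum>c\<in>S. f c x) \<in> fin_energy r \<rho>"
  using assms(3,2)
proof (induction S)
  case empty show ?case by (rule fin_energyI[of _ _ _ 0]) (simp_all add: B_zero)
next
  case (insert c S)
  then show ?case using fin_energy_add[OF assms(1), of "f c" "\<lambda>x. \<Sum>c\<in>S. f c x"] by simp
qed

lemma proj_fin_energy: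
  assumes m: "matching r \<rho>" and v: "v \<in> fin_energy r \<rho>" shows "proj v \<in> fin_energy r \<rho>"
proof -
  have "(\<lambda>x. (v \<circ> sym (rot c)) x - (v \<circ> sym (mirror c)) x) \<in> fin_energy r \<rho>" for c
    by (intro fin_energy_diff m fin_energy_sym v three_sym_intros)
  then have "(\<lambda>x. \<Sum>c\<in>UNIV. (v \<circ> sym (rot c)) x - (v \<circ> sym (mirror c)) x) \<in> fin_energy r \<rho>"
    by (intro sum_fin_energy m finite)
  from fin_energy_scale[OF this, of "1/6"] show ?thesis by (simp add: proj_def[abs_def])
qed

lemma B_sum_right: "finite S \<Longrightarrow> B m r \<rho> u (\<lambda>x. \<Sum>c\<in>S. f c x) = (\<Sum>c\<in>S. B m r \<rho> u (f c))"
proof (induction S rule: finite_induct)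
  case empty then show ?case using B_zero B_commute by simp
next
  case (insert c S) then show ?case by (simp add: B_add_right)
qed

text \<open>Invariance of the form moves each symmetry over to u, where its sign cancels the one in
  \<open>proj\<close>, so all six terms agree. In other words, v - proj v is orthogonal to
  u.\<close>

lemma B_proj:
  assumes "anti u" shows "B m r \<rho> u (proj v) = B m r \<rho> u v"
proof -
  have R: "B m r \<rho> u (v \<circ> sym (rot c)) = B m r \<rho> u v" for c
  proof -
    have "B m r \<rho> u (v \<circ> sym (rot c)) = B m r \<rho> (u \<circ> sym (rot c)) (v \<circ> sym (rot c))"
      by (rule B_cong) (simp_all add: anti_rot[OF assms])
    then show ?thesis by (simp add: B_sym)
  qed
  have S: "B m r \<rho> u (v \<circ> sym (mirror c)) = - B m r \<rho> u v" for c
  proof -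
    have "B m r \<rho> u (v \<circ> sym (mirror c)) = B m r \<rho> (\<lambda>x. (-1) * (u \<circ> sym (mirror c)) x) (v \<circ> sym (mirror c))"
      by (rule B_cong) (use assms in \<open>simp_all add: anti_def\<close>)
    then show ?thesis by (simp only: B_scale_left B_sym three_sym_intros)
  qed
  have "proj v = (\<lambda>x. 1/6 * (\<Sum>c\<in>UNIV. (\<lambda>x. (v \<circ> sym (rot c)) x - (v \<circ> sym (mirror c)) x) x))"
    by (auto simp: proj_def)
  then have "B m r \<rho> u (proj v) = 1/6 * (\<Sum>c\<in>UNIV. B m r \<rho> u (\<lambda>x. (v \<circ> sym (rot c)) x - (v \<circ> sym (mirror c)) x))"
    by (simp only: B_scale_right B_sum_right finite)
  also have "\<dots> = B m r \<rho> u v" unfolding B_diff_right R S by simp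
  finally show ?thesis .
qed

lemma En_proj: "anti u \<Longrightarrow> En r \<rho> u (proj v) = En r \<rho> u v"
  by (simp add: En_def B_proj)

text \<open>By orthogonality the energy lost by projecting is that of v - proj v, hence
  nonnegative.\<close>

lemma En_proj_le:
  assumes m: "matching r \<rho>" and v: "v \<in> fin_energy r \<rho>"
  shows "En r \<rho> (proj v) (proj v) \<le> En r \<rho> v v"
proof (rule LIMSEQ_le[OF En_square(1)[OF m proj_fin_energy[OF m v]] En_square(1)[OF m v]])
  have "B k r \<rho> (proj v) (proj v) \<le> B k r \<rho> v v" for k
  proof -
    have "0 \<le> B k r \<rho> (\<lambda>x. v x - proj v x) (\<lambda>x. v x - proj v x)" by (rule B_nonneg[OF m])
    also have "\<dots> = B k r \<rho> v v - B k r \<rho> (proj v) (proj v)"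
      by (simp add: B_diff_left B_diff_right B_proj[OF anti_proj] B_commute[of _ _ _ v "proj v"])
    finally show ?thesis by simp
  qed
  then show "\<exists>N. \<forall>n\<ge>N. B n r \<rho> (proj v) (proj v) \<le> B n r \<rho> v v" by blast
qed

text \<open>\<open>bump\<close> is invariant under the reflection exchanging 0 and 1, so its own
  projection would be zero. Planted in cell 0 it sits off the symmetry axes, and its six images no
  longer cancel.\<close>

definition test :: "(nat \<Rightarrow> real) \<Rightarrow> real^2 \<Rightarrow> real" where
  "test r = proj (T 0 (bump (r \<circ> Suc)))"

lemma test_energy:
  assumes m: "matching r \<rho>"
  shows "test r \<in> fin_energy r \<rho>" "En r \<rho> (test r) (test r) \<le> 4 / (r 1 * r 2)" "anti (test r)"
proof -
  let ?b = "bump (r \<circ> Suc)"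
  note m' = matching_shift[OF m]
  note b = bump_energy(1)[OF m'] bump_vanish[OF matching_small[OF m']]
  have f: "T 0 ?b \<in> fin_energy r \<rho>" by (rule T_fin_energy[OF m b])
  show "test r \<in> fin_energy r \<rho>" unfolding test_def by (rule proj_fin_energy[OF m f])
  show "anti (test r)" unfolding test_def by (rule anti_proj)
  have pos: "0 < r 1" using matching_pos(1)[OF m, of 1] by simp
  have "En (r \<circ> Suc) (\<rho> \<circ> Suc) ?b (T 0 ?b \<circ> G 0) = En (r \<circ> Suc) (\<rho> \<circ> Suc) ?b ?b"
  proof -
    have "B k (r \<circ> Suc) (\<rho> \<circ> Suc) ?b (T 0 ?b \<circ> G 0) = B k (r \<circ> Suc) (\<rho> \<circ> Suc) ?b ?b" for k
      by (rule B_cong) (simp_all add: T_G)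
    then show ?thesis by (simp add: En_def)
  qed
  then have "En r \<rho> (T 0 ?b) (T 0 ?b) = 1 / r 1 * En (r \<circ> Suc) (\<rho> \<circ> Suc) ?b ?b"
    by (simp add: En_T[OF m b f])
  also have "\<dots> \<le> 1 / r 1 * (4 / r 2)"
    using bump_energy(2)[OF m'] pos by (intro mult_left_mono) (auto simp: numeral_2_eq_2)
  finally show "En r \<rho> (test r) (test r) \<le> 4 / (r 1 * r 2)"
    using En_proj_le[OF m f] unfolding test_def by simp
qed

text \<open>Of the six images only the one under the identity is nonzero on this edge, whence the
  value 1/6. The others lie in different cells, except under the reflection fixing 0: it takes edge
  2 of the cell to edge 1, where the bump is zero.\<close>

lemma test_value:
  assumes m: "matching r \<rho>" and t: "t \<in> {0..1}"
  shows "test r (G 0 (e 2 t)) = 1/6"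
proof -
  let ?b = "bump (r \<circ> Suc)"
  note b = bump_edges[OF matching_small[OF matching_shift[OF m]]]
  have eK: "sym \<pi> (e 2 t) \<in> K" if "three_sym \<pi>" for \<pi> by (rule sym_K[OF that e_K[OF t]])
  have R: "T 0 ?b (sym (rot c) (G 0 (e 2 t))) = (if c = 0 then 1 else 0)" for c
    using eK[of "rot c"] b[OF t, of 2] by (simp add: sym_G T_G rot_def[of c 0] sym_rot_e)
  have S: "T 0 ?b (sym (mirror c) (G 0 (e 2 t))) = 0" for c
  proof -
    have "(0::3) - 2 \<noteq> 2" using three_facts(13) by (metis add_diff_cancel_left' diff_eq_eq three_facts(12,14) zero_neq_one)
    then show ?thesis using eK[of "mirror c"] b[of "1 - t" "0 - 2"] t
      by (auto simp: sym_G T_G mirror_def[of c 0] sym_mirror_e)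
  qed
  show ?thesis unfolding test_def proj_def R S by simp
qed

end

section \<open>Integration over the gasket\<close>

lemma emeasure_mix_measure:
  assumes s: "sets M = sets N" and A: "A \<in> sets M"
  shows "emeasure (mix_measure \<eta> M N) A = ennreal \<eta> * emeasure M A + ennreal (1 - \<eta>) * emeasure N A"
  unfolding mix_measure_def
proof (rule emeasure_measure_of_sigma[OF sets.sigma_algebra_axioms _ _ A])
  let ?m = "\<lambda>A. ennreal \<eta> * emeasure M A + ennreal (1 - \<eta>) * emeasure N A"
  show "positive (sets M) ?m" by (simp add: positive_def)
  show "countably_additive (sets M) ?m"
  proof (rule countably_additiveI)
    fix A :: "nat \<Rightarrow> _" assume A: "range A \<subseteq> sets M" "disjoint_family A" "\<Union> (range A) \<in> sets M"
    have "(\<Sum>i. ?m (A i)) = (\<Sum>i. ennreal \<eta> * emeasure M (A i)) + (\<Sum>i. ennreal (1 - \<eta>) * emeasure N (A i))"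
      by (rule suminf_add[symmetric]) auto
    also have "\<dots> = ?m (\<Union> (range A))"
      using A s by (simp add: suminf_emeasure)
    finally show "(\<Sum>i. ?m (A i)) = ?m (\<Union> (range A))" .
  qed
qed

lemma sets_mix_measure [simp]: "sets (mix_measure \<eta> M N) = sets M"
  by (simp add: mix_measure_def)

lemma space_mix_measure [simp]: "space (mix_measure \<eta> M N) = space M"
  by (simp add: mix_measure_def)

lemma nn_integral_mix_measure:
  assumes s: "sets M = sets N" and f: "f \<in> borel_measurable M"
  shows "nn_integral (mix_measure \<eta> M N) f = ennreal \<eta> * nn_integral M f + ennreal (1 - \<eta>) * nn_integral N f"
  using f
proof induction
  case (cong f g)
  have "nn_integral X f = nn_integral X g" if "space X = space M" for X
    by (rule nn_integral_cong) (use cong.hyps that in simp)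
  then show ?case using cong sets_eq_imp_space_eq[OF s] by simp
next
  case (set A)
  then show ?case using s by (simp add: emeasure_mix_measure)
next
  case (mult f c)
  have m: "f \<in> borel_measurable X" if "sets X = sets M" for X
    using mult.hyps(2) measurable_cong_sets[OF that refl] by blast
  show ?case using mult.IH s
    by (simp add: nn_integral_cmult m distrib_left mult.left_commute)
next
  case (add f g)
  have m: "f \<in> borel_measurable X" "g \<in> borel_measurable X" if "sets X = sets M" for X
    using add.hyps measurable_cong_sets[OF that refl] by blast+
  show ?case using add.IH s by (simp add: nn_integral_add m distrib_left add_ac)
next
  case (seq U)
  have m: "U i \<in> borel_measurable X" if "sets X = sets M" for X i
    using seq.hyps(1) measurable_cong_sets[OF that refl] by blast
  have inc: "incseq (\<lambda>i. c * nn_integral X (U i))" for X and c :: ennreal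
    using seq.hyps by (auto simp: incseq_def le_fun_def intro!: mult_left_mono nn_integral_mono)
  show ?case
    using seq.IH s seq.hyps(3)
    by (simp add: nn_integral_monotone_convergence_SUP[OF seq.hyps(3)] m SUP_mult_left_ennreal ennreal_SUP_add[OF inc inc, symmetric] image_comp)
qed

lemma integral_mix_measure:
  fixes f :: "'a \<Rightarrow> real"
  assumes s: "sets M = sets N" and \<eta>: "0 \<le> \<eta>" "\<eta> \<le> 1" and fm: "finite_measure M" "finite_measure N"
    and f: "f \<in> borel_measurable M" and bd: "\<And>x. x \<in> space M \<Longrightarrow> \<bar>f x\<bar> \<le> C"
  shows "(LINT x|mix_measure \<eta> M N. f x) = \<eta> * (LINT x|M. f x) + (1 - \<eta>) * (LINT x|N. f x)"
    and "integrable (mix_measure \<eta> M N) f"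
proof -
  let ?X = "mix_measure \<eta> M N"
  have sp: "space N = space M" using sets_eq_imp_space_eq[OF s] by simp
  have "emeasure ?X (space ?X) \<noteq> \<infinity>"
    using fm[THEN finite_measure.emeasure_finite] emeasure_mix_measure[OF s sets.top]
    by (simp add: ennreal_mult_eq_top_iff ennreal_add_eq_top)
  then have fX: "finite_measure ?X" by (intro finite_measureI)
  have int: "integrable Y g" if "finite_measure Y" "sets Y = sets M" "g \<in> borel_measurable M" "\<And>x. x \<in> space M \<Longrightarrow> \<bar>g x\<bar> \<le> D" for Y D and g :: "'a \<Rightarrow> real"
  proof (rule finite_measure.integrable_const_bound[OF that(1), of g D])
    show "AE x in Y. norm (g x) \<le> D" using that(4) sets_eq_imp_space_eq[OF that(2)] by (intro AE_I2) auto
    show "g \<in> borel_measurable Y" using that(3) measurable_cong_sets[OF that(2) refl] by blast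
  qed
  show "integrable ?X f" by (rule int[OF fX _ f bd]) simp
  have nonneg: "(LINT x|?X. g x) = \<eta> * (LINT x|M. g x) + (1 - \<eta>) * (LINT x|N. g x)"
    if g: "g \<in> borel_measurable M" "\<And>x. x \<in> space M \<Longrightarrow> 0 \<le> g x" "\<And>x. x \<in> space M \<Longrightarrow> \<bar>g x\<bar> \<le> D" for g D
  proof -
    have i: "integrable ?X g" "integrable M g" "integrable N g"
      by (rule int[OF _ _ g(1,3)]; use fX fm s in simp)+
    have "ennreal (LINT x|?X. g x) = (\<integral>\<^sup>+ x. g x \<partial>?X)"
      by (rule nn_integral_eq_integral[symmetric, OF i(1)]) (use g in \<open>auto intro!: AE_I2\<close>)
    also have "\<dots> = ennreal \<eta> * (\<integral>\<^sup>+ x. g x \<partial>M) + ennreal (1 - \<eta>) * (\<integral>\<^sup>+ x. g x \<partial>N)"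
      by (rule nn_integral_mix_measure[OF s]) (use g in simp)
    also have "(\<integral>\<^sup>+ x. g x \<partial>M) = ennreal (LINT x|M. g x)"
      by (rule nn_integral_eq_integral[OF i(2)]) (use g in \<open>auto intro!: AE_I2\<close>)
    also have "(\<integral>\<^sup>+ x. g x \<partial>N) = ennreal (LINT x|N. g x)"
      by (rule nn_integral_eq_integral[OF i(3)]) (use g sp in \<open>auto intro!: AE_I2\<close>)
    also have "ennreal \<eta> * ennreal (LINT x|M. g x) + ennreal (1 - \<eta>) * ennreal (LINT x|N. g x) =
      ennreal (\<eta> * (LINT x|M. g x) + (1 - \<eta>) * (LINT x|N. g x))"
      using \<eta> g sp by (subst ennreal_mult'[symmetric] ennreal_plus[symmetric]; (intro mult_nonneg_nonneg integral_nonneg_AE AE_I2)?; simp)+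
    finally show ?thesis
    proof (rule ennreal_inj[THEN iffD1, rotated 2])
      show "0 \<le> (LINT x|?X. g x)" using g by (intro integral_nonneg_AE AE_I2) auto
      show "0 \<le> \<eta> * (LINT x|M. g x) + (1 - \<eta>) * (LINT x|N. g x)"
        using \<eta> g sp by (intro add_nonneg_nonneg mult_nonneg_nonneg integral_nonneg_AE AE_I2) auto
    qed
  qed
  define P where "P x = max 0 (f x)" for x
  define R where "R x = max 0 (- f x)" for x
  have PR: "f x = P x - R x" for x by (simp add: P_def R_def max_def)
  have Pm: "P \<in> borel_measurable M" "R \<in> borel_measurable M" using f by (auto simp: P_def[abs_def] R_def[abs_def])
  have Pb: "\<bar>P x\<bar> \<le> C" "\<bar>R x\<bar> \<le> C" if "x \<in> space M" for x using bd[OF that] by (auto simp: P_def R_def)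
  have spl: "(LINT x|Y. f x) = (LINT x|Y. P x) - (LINT x|Y. R x)" if "finite_measure Y" "sets Y = sets M" for Y
    unfolding PR by (rule Bochner_Integration.integral_diff) (rule int[OF that], use Pm Pb in auto)+
  have "(LINT x|?X. P x) = \<eta> * (LINT x|M. P x) + (1 - \<eta>) * (LINT x|N. P x)"
    by (rule nonneg[OF Pm(1) _ Pb(1)]) (auto simp: P_def)
  moreover have "(LINT x|?X. R x) = \<eta> * (LINT x|M. R x) + (1 - \<eta>) * (LINT x|N. R x)"
    by (rule nonneg[OF Pm(2) _ Pb(2)]) (auto simp: R_def)
  ultimately show "(LINT x|?X. f x) = \<eta> * (LINT x|M. f x) + (1 - \<eta>) * (LINT x|N. f x)"
    unfolding spl[OF fX sets_mix_measure] spl[OF fm(1) refl] spl[OF fm(2) s[symmetric]]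
    by (simp add: algebra_simps)
qed

section \<open>Invariant functionals on C(K) and the measure mu_f\<close>

context ssg begin

text \<open>A positive linear functional on C(K), invariant under the symmetries but not normalized.
  The variational argument knows the measures only through these properties and thus treats all
  combinations of mu_l and mu_f at once.\<close>

definition mean :: "((real^2 \<Rightarrow> real) \<Rightarrow> real) \<Rightarrow> bool" where
  "mean \<Phi> \<longleftrightarrow> (\<forall>f g. continuous_on K f \<longrightarrow> continuous_on K g \<longrightarrow> \<Phi> (\<lambda>x. f x + g x) = \<Phi> f + \<Phi> g) \<and>
     (\<forall>c f. continuous_on K f \<longrightarrow> \<Phi> (\<lambda>x. c * f x) = c * \<Phi> f) \<and>
     (\<forall>f g. continuous_on K f \<longrightarrow> continuous_on K g \<longrightarrow> (\<forall>x\<in>K. f x \<le> g x) \<longrightarrow> \<Phi> f \<le> \<Phi> g) \<and>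
     (\<forall>\<pi> f. three_sym \<pi> \<longrightarrow> continuous_on K f \<longrightarrow> \<Phi> (f \<circ> sym \<pi>) = \<Phi> f)"

lemma bounded_on_K:
  assumes "continuous_on K (f :: real^2 \<Rightarrow> real)" obtains C where "0 \<le> C" "\<And>x. x \<in> K \<Longrightarrow> \<bar>f x\<bar> \<le> C"
proof -
  have "bounded (f ` K)" by (intro compact_imp_bounded compact_continuous_image assms K_compact)
  then obtain B where "\<And>x. x \<in> K \<Longrightarrow> \<bar>f x\<bar> \<le> B"
    unfolding bounded_iff by (metis image_eqI real_norm_def)
  then show ?thesis by (intro that[of "max 0 B"]) (auto simp: le_max_iff_disj)
qed

lemma borel_prob_onD:
  assumes "borel_prob_on K M"
  shows "prob_space M" "sets M = sets (restrict_space borel K)" "space M = K"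
    "\<And>f. continuous_on K f \<Longrightarrow> (f :: real^2 \<Rightarrow> real) \<in> borel_measurable M"
    "\<And>f. continuous_on K f \<Longrightarrow> integrable M (f :: real^2 \<Rightarrow> real)"
    "\<And>A. A \<in> sets borel \<Longrightarrow> A \<subseteq> K \<Longrightarrow> A \<in> sets M"
proof -
  show p: "prob_space M" and s: "sets M = sets (restrict_space borel K)" using assms by (auto simp: borel_prob_on_def)
  show sp: "space M = K" using sets_eq_imp_space_eq[OF s] by (simp add: space_restrict_space)
  show m: "f \<in> borel_measurable M" if "continuous_on K f" for f :: "real^2 \<Rightarrow> real"
    using borel_measurable_continuous_on_restrict[OF that] measurable_cong_sets[OF s refl] by blast
  show "integrable M f" if f: "continuous_on K f" for f :: "real^2 \<Rightarrow> real"
  proof -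
    obtain C where "\<And>x. x \<in> K \<Longrightarrow> \<bar>f x\<bar> \<le> C" using bounded_on_K[OF f] by metis
    then show ?thesis
      using prob_space.finite_measure[OF p] m[OF f] sp
      by (intro finite_measure.integrable_const_bound[of M f C] AE_I2) auto
  qed
  show "A \<in> sets M" if "A \<in> sets borel" "A \<subseteq> K" for A
    unfolding s using that by (auto simp: sets_restrict_space)
qed

lemma mean_integral:
  assumes M: "borel_prob_on K M"
    and sy: "\<And>\<pi> (f :: real^2 \<Rightarrow> real). three_sym \<pi> \<Longrightarrow> continuous_on K f \<Longrightarrow> (LINT x|M. (f \<circ> sym \<pi>) x) = (LINT x|M. f x)"
  shows "mean (\<lambda>f. LINT x|M. f x)"
  unfolding mean_def
proof (intro conjI allI impI)
  note D = borel_prob_onD[OF M]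
  fix f g :: "real^2 \<Rightarrow> real" assume f: "continuous_on K f"
  show "(LINT x|M. c * f x) = c * (LINT x|M. f x)" for c by simp
  show "(LINT x|M. (f \<circ> sym \<pi>) x) = (LINT x|M. f x)" if "three_sym \<pi>" for \<pi> by (rule sy[OF that f])
  assume g: "continuous_on K g"
  show "(LINT x|M. f x + g x) = (LINT x|M. f x) + (LINT x|M. g x)" using D(5)[OF f] D(5)[OF g] by simp
  show "(LINT x|M. f x) \<le> (LINT x|M. g x)" if "\<forall>x\<in>K. f x \<le> g x"
    by (rule integral_mono[OF D(5)[OF f] D(5)[OF g]]) (use that D(3) in auto)
qed

lemma W_dist: "dist (W w x) (W w y) = ratio ^ length w * dist x y"
  by (induction w) (auto simp: W_Cons dist_G)

lemma W_cont: "continuous_on S (W w)"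
proof (induction w)
  case (Cons i w) then show ?case unfolding W_Cons by (rule continuous_on_compose[OF _ G_cont])
qed simp

lemma W_unique:
  "x \<in> K \<Longrightarrow> y \<in> K \<Longrightarrow> length w = length w' \<Longrightarrow> W w x = W w' y \<Longrightarrow> w = w'"
proof (induction w arbitrary: w')
  case (Cons i w)
  then obtain j w'' where w': "w' = j # w''" by (cases w') auto
  from cell_unique[OF W_K W_K, of x y i w j w''] Cons show ?case by (auto simp: w' W_Cons)
qed simp

lemma small_osc:
  assumes f: "continuous_on K (f :: real^2 \<Rightarrow> real)" and "0 < \<epsilon>"
  obtains m0 where "\<And>w x y. m0 \<le> length w \<Longrightarrow> x \<in> K \<Longrightarrow> y \<in> K \<Longrightarrow> \<bar>f (W w x) - f (W w y)\<bar> \<le> \<epsilon>"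
proof -
  from compact_uniformly_continuous[OF f K_compact] \<open>0 < \<epsilon>\<close>
  obtain d where d: "0 < d" "\<And>x y. x \<in> K \<Longrightarrow> y \<in> K \<Longrightarrow> dist y x < d \<Longrightarrow> dist (f y) (f x) < \<epsilon>"
    unfolding uniformly_continuous_on_def by metis
  have "(\<lambda>n. ratio ^ n * diameter K) \<longlonglongrightarrow> 0 * diameter K"
    using ratio by (intro tendsto_mult tendsto_const LIMSEQ_power_zero) auto
  then have "\<forall>\<^sub>F n in sequentially. ratio ^ n * diameter K < d"
    using d(1) by (intro order_tendstoD(2)) auto
  then obtain m0 where m0: "\<And>n. m0 \<le> n \<Longrightarrow> ratio ^ n * diameter K < d" by (auto simp: eventually_sequentially)
  show ?thesis
  proof (rule that[of m0])
    fix w :: "3 list" and x y assume w: "m0 \<le> length w" and x: "x \<in> K" and y: "y \<in> K"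
    have "dist (W w x) (W w y) \<le> ratio ^ length w * diameter K"
      unfolding W_dist using diameter_bounded_bound[OF compact_imp_bounded[OF K_compact] x y] ratio by (intro mult_left_mono) auto
    also have "\<dots> < d" by (rule m0[OF w])
    finally show "\<bar>f (W w x) - f (W w y)\<bar> \<le> \<epsilon>" using d(2)[OF W_K[OF y] W_K[OF x], of w w] by (simp add: dist_real_def)
  qed
qed

definition avg :: "nat \<Rightarrow> real^2 \<Rightarrow> (real^2 \<Rightarrow> real) \<Rightarrow> real" where
  "avg m z f = (1/3) ^ m * (\<Sum>w | length w = m. f (W w z))"

lemma avg_0: "avg 0 z f = f z" by (simp add: avg_def)

lemma avg_Suc: "avg (Suc m) z f = 1/3 * (\<Sum>i\<in>UNIV. avg m z (f \<circ> G i))"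
  by (simp add: avg_def sum_words_Suc W_Cons sum_distrib_left)

lemma avg_sym: "three_sym \<pi> \<Longrightarrow> avg m z (f \<circ> sym \<pi>) = avg m (sym \<pi> z) f"
proof (induction m arbitrary: f)
  case 0 show ?case by (simp add: avg_0)
next
  case (Suc m)
  have "(f \<circ> sym \<pi>) \<circ> G i = (f \<circ> G (\<pi> i)) \<circ> sym \<pi>" for i by (auto simp: sym_G)
  then have "avg (Suc m) z (f \<circ> sym \<pi>) = 1/3 * (\<Sum>i\<in>UNIV. avg m (sym \<pi> z) (f \<circ> G (\<pi> i)))"
    by (simp only: avg_Suc Suc.IH[OF Suc.prems])
  then show ?case using sum_bij[OF three_sym_bij[OF Suc.prems], of "\<lambda>i. avg m (sym \<pi> z) (f \<circ> G i)"] by (simp only: avg_Suc)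
qed

lemma finite_words: "finite {w :: 3 list. length w = m}"
  using finite_lists_length_eq[of "UNIV :: 3 set" m] by simp

lemma card_words: "card {w :: 3 list. length w = m} = 3 ^ m"
  using card_lists_length_eq[of "UNIV :: 3 set" m] by simp

text \<open>Riemann sums: for continuous integrands this replaces the uniqueness of the self-similar measure.\<close>

lemma mu_f_avg:
  assumes \<mu>: "is_mu_f \<alpha> p K \<mu>" and f: "continuous_on K f" and z: "z \<in> K"
  shows "(\<lambda>m. avg m z f) \<longlonglongrightarrow> (LINT x|\<mu>. f x)"
proof (rule LIMSEQ_I)
  fix \<epsilon> :: real assume e: "0 < \<epsilon>"
  have bp: "borel_prob_on K \<mu>" using \<mu> by (simp add: is_mu_f_def)
  note D = borel_prob_onD[OF bp]
  interpret prob_space \<mu> by (rule D(1))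
  from e have "0 < \<epsilon> / 2" by simp
  from small_osc[OF f this] obtain m0 where
    m0: "\<And>w x y. m0 \<le> length w \<Longrightarrow> x \<in> K \<Longrightarrow> y \<in> K \<Longrightarrow> \<bar>f (W w x) - f (W w y)\<bar> \<le> \<epsilon> / 2" by metis
  show "\<exists>no. \<forall>n\<ge>no. norm (avg n z f - (LINT x|\<mu>. f x)) < \<epsilon>"
  proof (intro exI[of _ m0] allI impI)
    fix n assume n: "m0 \<le> n"
    let ?I = "{w :: 3 list. length w = n}"
    have cs: "W w ` K \<in> sets \<mu>" for w
      by (rule D(6)) (auto intro!: borel_compact compact_continuous_image W_cont K_compact W_K)
    have dis: "disjoint_family_on (\<lambda>w. W w ` K) ?I"
      unfolding disjoint_family_on_def using W_unique by fastforce
    have me: "measure \<mu> (W w ` K) = (1/3) ^ length w" for w using \<mu> by (simp add: is_mu_f_def)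
    \<comment> \<open>The cells of level n are disjoint and their masses already add up to 1, so
      everything between them is a null set.\<close>
    have "measure \<mu> (\<Union>w\<in>?I. W w ` K) = (\<Sum>w\<in>?I. measure \<mu> (W w ` K))"
      by (rule finite_measure_finite_Union[OF finite_words _ dis]) (use cs in auto)
    also have "\<dots> = (\<Sum>w\<in>?I. (1/3) ^ n)" by (intro sum.cong) (auto simp: me)
    also have "\<dots> = 1" by (simp add: card_words power_divide)
    finally have "prob (\<Union>w\<in>?I. W w ` K) = 1" .
    then have ae: "AE x in \<mu>. x \<in> (\<Union>w\<in>?I. W w ` K)"
      by (subst prob_eq_1[symmetric]) (use cs in \<open>auto intro!: sets.finite_UN finite_words\<close>)
    have ci: "integrable \<mu> (\<lambda>x. indicator (W w ` K) x :: real)" for w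
      by (rule integrable_real_indicator[OF cs]) (simp add: less_top[symmetric])
    define g where "g x = (\<Sum>w\<in>?I. f (W w z) * indicator (W w ` K) x)" for x
    have gi: "integrable \<mu> g"
      unfolding g_def by (intro Bochner_Integration.integrable_sum integrable_mult_right ci)
    have "(LINT x|\<mu>. g x) = (\<Sum>w\<in>?I. f (W w z) * measure \<mu> (W w ` K))"
      unfolding g_def using cs
      by (subst Bochner_Integration.integral_sum)
         (auto intro!: integrable_mult_right ci simp: Int_absorb2[OF sets.sets_into_space[OF cs]])
    also have "\<dots> = avg n z f" unfolding avg_def sum_distrib_left by (intro sum.cong) (auto simp: me)
    finally have gA: "(LINT x|\<mu>. g x) = avg n z f" .
    have "\<bar>avg n z f - (LINT x|\<mu>. f x)\<bar> = \<bar>LINT x|\<mu>. g x - f x\<bar>"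
      using gi D(5)[OF f] by (simp add: gA)
    also have "\<dots> \<le> (LINT x|\<mu>. \<bar>g x - f x\<bar>)" by (rule integral_abs_bound)
    also have "\<dots> \<le> (LINT x|\<mu>. \<epsilon> / 2)"
    proof (rule integral_mono_AE)
      show "AE x in \<mu>. \<bar>g x - f x\<bar> \<le> \<epsilon> / 2"
        using ae
      proof eventually_elim
        case (elim x)
        then obtain w y where w: "length w = n" "y \<in> K" "x = W w y" by auto
        have "g x = (\<Sum>v\<in>?I. if v = w then f (W w z) else 0)"
          unfolding g_def
        proof (rule sum.cong[OF refl])
          fix v assume v: "v \<in> ?I"
          have "v = w" if "x \<in> W v ` K"
            using that w v by (auto intro: W_unique[of _ y v w])
          then show "f (W v z) * indicator (W v ` K) x = (if v = w then f (W w z) else 0)"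
            using w by (auto simp: indicator_def)
        qed
        also have "\<dots> = f (W w z)" using w(1) by (simp add: finite_words)
        finally show ?case using m0[of w z y] n w z by simp
      qed
    qed (use gi D(5)[OF f] in auto)
    also have "\<dots> = \<epsilon> / 2" by (simp add: prob_space)
    finally show "norm (avg n z f - (LINT x|\<mu>. f x)) < \<epsilon>" using e by simp
  qed
qed

text \<open>A symmetry permutes the cells and moves the sample point, and the limit of the Riemann
  sums does not depend on the sample point.\<close>

lemma mu_f_mean:
  assumes \<mu>: "is_mu_f \<alpha> p K \<mu>" shows "mean (\<lambda>f. LINT x|\<mu>. f x)"
proof (rule mean_integral)
  show "borel_prob_on K \<mu>" using \<mu> by (simp add: is_mu_f_def)
  fix \<pi> and f :: "real^2 \<Rightarrow> real" assume \<pi>: "three_sym \<pi>" and f: "continuous_on K f"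
  have fs: "continuous_on K (f \<circ> sym \<pi>)"
    by (rule continuous_on_compose[OF sym_cont], rule continuous_on_subset[OF f]) (auto simp: sym_K[OF \<pi>])
  show "(LINT x|\<mu>. (f \<circ> sym \<pi>) x) = (LINT x|\<mu>. f x)"
    by (rule LIMSEQ_unique[OF mu_f_avg[OF \<mu> fs p_K[of 0], unfolded avg_sym[OF \<pi>]] mu_f_avg[OF \<mu> f sym_K[OF \<pi> p_K]]])
qed

text \<open>The recursion \<open>avg_Suc\<close> of the Riemann sums, in the limit.\<close>

lemma mu_f_self_similar:
  fixes f :: "real^2 \<Rightarrow> real"
  assumes \<mu>: "is_mu_f \<alpha> p K \<mu>" and f: "continuous_on K f"
  shows "(LINT x|\<mu>. f x) = 1/3 * (\<Sum>i\<in>UNIV. LINT x|\<mu>. (f \<circ> G i) x)"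
proof (rule LIMSEQ_unique)
  show "(\<lambda>m. avg (Suc m) (p 0) f) \<longlonglongrightarrow> (LINT x|\<mu>. f x)"
    by (rule LIMSEQ_Suc[OF mu_f_avg[OF \<mu> f p_K]])
  show "(\<lambda>m. avg (Suc m) (p 0) f) \<longlonglongrightarrow> 1/3 * (\<Sum>i\<in>UNIV. LINT x|\<mu>. (f \<circ> G i) x)"
    unfolding avg_Suc by (intro tendsto_intros mu_f_avg[OF \<mu> u_G_cont[OF f] p_K])
qed

section \<open>The length measure mu_l on the edges\<close>

abbreviation I01 :: "real measure" where "I01 \<equiv> restrict_space lborel {0<..<1}"

lemma edge_param_unique:
  "t \<in> {0<..<1} \<Longrightarrow> t' \<in> {0<..<1} \<Longrightarrow> edge_param \<alpha> p w i t = edge_param \<alpha> p w' i' t' \<Longrightarrow> w = w' \<and> i = i'"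
proof (induction w arbitrary: w')
  case Nil
  show ?case
  proof (cases w')
    case Nil then show ?thesis using edge_unique(1) \<open>edge_param \<alpha> p [] i t = _\<close> Nil.prems by blast
  next
    case (Cons j v)
    have "edge_param \<alpha> p v i' t' \<in> K" by (rule edge_param_K) (use Nil.prems in auto)
    then show ?thesis using Nil.prems(3) edge_not_cell[OF Nil.prems(1)] by (auto simp: Cons edge_param_Cons)
  qed
next
  case (Cons j v)
  have K1: "edge_param \<alpha> p v i t \<in> K" by (rule edge_param_K) (use Cons.prems in auto)
  show ?case
  proof (cases w')
    case Nil
    then show ?thesis using Cons.prems(3) edge_not_cell[OF Cons.prems(2) K1, of i' j] by (simp add: edge_param_Cons)
  next
    case (Cons j' v')
    have K2: "edge_param \<alpha> p v' i' t' \<in> K" by (rule edge_param_K) (use Cons.prems(2) in auto)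
    have eq: "G j (edge_param \<alpha> p v i t) = G j' (edge_param \<alpha> p v' i' t')"
      using Cons.prems(3) by (simp add: Cons edge_param_Cons)
    then show ?thesis using cell_unique[OF K1 K2 eq] Cons.IH[OF Cons.prems(1,2), of v'] by (simp add: Cons)
  qed
qed

lemma edge_param_cont: "continuous_on S (edge_param \<alpha> p w i)"
proof (induction w)
  case (Cons i w) then show ?case unfolding edge_param_Cons by (rule continuous_on_compose[OF _ G_cont])
qed (rule e_cont)

text \<open>The open interval is a countable union of compact ones, and so is its continuous
  image.\<close>

lemma edge_borel: "edge \<alpha> p w i \<in> sets borel"
proof -
  have "{0<..<1::real} = (\<Union>n. {1 / real (Suc n)..1 - 1 / real (Suc n)})"
  proof (intro equalityI subsetI)
    fix x :: real assume "x \<in> {0<..<1}"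
    then have "0 < min x (1 - x)" by auto
    then obtain n where "inverse (real (Suc n)) < min x (1 - x)" using reals_Archimedean by blast
    then have "x \<in> {1 / real (Suc n)..1 - 1 / real (Suc n)}" by (auto simp: inverse_eq_divide)
    then show "x \<in> (\<Union>n. {1 / real (Suc n)..1 - 1 / real (Suc n)})" by blast
  next
    fix x :: real assume "x \<in> (\<Union>n. {1 / real (Suc n)..1 - 1 / real (Suc n)})"
    then obtain n where "1 / real (Suc n) \<le> x" "x \<le> 1 - 1 / real (Suc n)" by auto
    moreover have "0 < 1 / real (Suc n)" by simp
    ultimately show "x \<in> {0<..<1}" unfolding greaterThanLessThan_iff by linarith
  qed
  then have "edge \<alpha> p w i = (\<Union>n. edge_param \<alpha> p w i ` {1 / real (Suc n)..1 - 1 / real (Suc n)})"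
    unfolding edge_def by (simp only: image_UN)
  also have "\<dots> \<in> sets borel"
    by (intro sets.countable_UN image_subsetI borel_compact compact_continuous_image edge_param_cont compact_Icc)
  finally show ?thesis .
qed

lemma edge_subset_K: "edge \<alpha> p w i \<subseteq> K"
  by (auto simp: edge_def intro!: edge_param_K)

lemma integral_scale_measure:
  fixes f :: "'a \<Rightarrow> real"
  assumes "f \<in> borel_measurable M" "0 \<le> c"
  shows "(LINT x|scale_measure (ennreal c) M. f x) = c * (LINT x|M. f x)"
proof -
  have "scale_measure (ennreal c) M = density M (\<lambda>_. ennreal c)"
    by (rule measure_eqI) (auto simp: emeasure_density nn_integral_cmult)
  then show ?thesis using assms by (simp add: integral_density)
qed

lemma mu_l_edge:
  assumes \<mu>: "is_mu_l \<alpha> p K \<beta> \<mu>" and \<beta>: "0 < \<beta>" "\<beta> < 1/3" and f: "continuous_on K f"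
  shows "(LINT x|\<mu>. indicator (edge \<alpha> p w i) x * f x) = (1/3 - \<beta>) * \<beta> ^ length w * (LINT t|I01. f (edge_param \<alpha> p w i t))"
proof -
  have bp: "borel_prob_on K \<mu>" using \<mu> by (simp add: is_mu_l_def)
  note D = borel_prob_onD[OF bp]
  let ?E = "edge \<alpha> p w i" and ?g = "edge_param \<alpha> p w i"
  have E: "?E \<in> sets \<mu>" by (rule D(6)[OF edge_borel edge_subset_K])
  have "(LINT x|\<mu>. indicator ?E x * f x) = (LINT x|restrict_space \<mu> ?E. f x)"
    using E edge_subset_K[of w i] D(3) by (subst integral_restrict_space) (auto simp: Int_absorb2)
  also have "restrict_space \<mu> ?E = scale_measure (ennreal ((1/3 - \<beta>) * \<beta> ^ length w)) (distr I01 (restrict_space borel ?E) ?g)"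
    using \<mu> by (simp add: is_mu_l_def)
  also have "(LINT x|\<dots>. f x) = (1/3 - \<beta>) * \<beta> ^ length w * (LINT x|distr I01 (restrict_space borel ?E) ?g. f x)"
  proof (rule integral_scale_measure)
    show "f \<in> borel_measurable (distr I01 (restrict_space borel ?E) ?g)"
      using borel_measurable_continuous_on_restrict[OF continuous_on_subset[OF f edge_subset_K]] by simp
  qed (use \<beta> in simp)
  also have "(LINT x|distr I01 (restrict_space borel ?E) ?g. f x) = (LINT t|I01. f (?g t))"
  proof (rule integral_distr)
    have "?g \<in> borel_measurable (restrict_space borel {0<..<1})"
      by (rule borel_measurable_continuous_on_restrict[OF edge_param_cont])
    then have "?g \<in> borel_measurable I01"
      by (subst measurable_cong_sets[OF _ refl, of _ "restrict_space borel {0<..<1}"]) (auto simp: sets_restrict_space)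
    then show "?g \<in> measurable I01 (restrict_space borel ?E)"
      by (intro measurable_restrict_space2) (auto simp: edge_def space_restrict_space)
    show "f \<in> borel_measurable (restrict_space borel ?E)"
      by (rule borel_measurable_continuous_on_restrict[OF continuous_on_subset[OF f edge_subset_K]])
  qed
  finally show ?thesis .
qed

definition J :: "nat \<Rightarrow> (real^2 \<Rightarrow> real) \<Rightarrow> real" where
  "J k f = (\<Sum>w | length w = k. \<Sum>i\<in>UNIV. LINT t|I01. f (edge_param \<alpha> p w i t))"

lemma J_Suc: "J (Suc k) f = (\<Sum>i\<in>UNIV. J k (f \<circ> G i))"
  by (simp add: J_def sum_words_Suc edge_param_Cons)

lemma J_0: "J 0 f = (\<Sum>i\<in>UNIV. LINT t|I01. f (e i t))"
  by (simp add: J_def)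

lemma I01_reverse: "(LINT t|I01. h (1 - t)) = (LINT t|I01. h t)" for h :: "real \<Rightarrow> real"
proof -
  have "(LINT t|I01. h t) = (LINT t|lborel. indicator {0<..<1} t * h t)"
    by (subst integral_restrict_space) auto
  also have "\<dots> = (LINT t|lborel. indicator {0<..<1} (1 + (-1) * t) * h (1 + (-1) * t))"
    using lborel_integral_real_affine[of "-1" "\<lambda>t. indicator {0<..<1} t * h t" 1] by simp
  also have "\<dots> = (LINT t|lborel. indicator {0<..<1} t * h (1 - t))"
    by (rule Bochner_Integration.integral_cong) (auto simp: indicator_def)
  also have "\<dots> = (LINT t|I01. h (1 - t))"
    by (subst integral_restrict_space) auto
  finally show ?thesis by simp
qed

lemma J_sym: "three_sym \<pi> \<Longrightarrow> J k (f \<circ> sym \<pi>) = J k f"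
proof (induction k arbitrary: f)
  case 0
  have "(LINT t|I01. f (sym \<pi> (e i t))) = (LINT t|I01. f (e (\<pi> i) t))" for i
    by (rule sym_e[OF 0]) (simp_all add: I01_reverse[of "\<lambda>t. f (e (\<pi> i) t)"])
  then show ?case using sum_bij[OF three_sym_bij[OF 0], of "\<lambda>i. LINT t|I01. f (e i t)"] by (simp add: J_0)
next
  case (Suc k)
  have "(f \<circ> sym \<pi>) \<circ> G i = (f \<circ> G (\<pi> i)) \<circ> sym \<pi>" for i by (auto simp: sym_G)
  then have "J (Suc k) (f \<circ> sym \<pi>) = (\<Sum>i\<in>UNIV. J k (f \<circ> G (\<pi> i)))"
    by (simp only: J_Suc Suc.IH[OF Suc.prems])
  then show ?case using sum_bij[OF three_sym_bij[OF Suc.prems], of "\<lambda>i. J k (f \<circ> G i)"] by (simp only: J_Suc)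
qed

lemma prob_I01: "prob_space I01"
  by (rule prob_spaceI) (simp add: emeasure_restrict_space)

lemma J_1: "J k (\<lambda>_. 1) = 3 * 3 ^ k"
proof (induction k)
  case 0 show ?case using prob_space.prob_space[OF prob_I01] by (simp add: J_0)
next
  case (Suc k) then show ?case by (simp add: J_Suc o_def)
qed

text \<open>Edges with words shorter than n carry the mass 1 - (3 \<beta>)^n, so the partial sum
  misses at most (3 \<beta>)^n times a bound for f. The terms of the resulting series display the
  symmetry and the self-similarity of the measure.\<close>

lemma mu_l_sums:
  assumes \<mu>: "is_mu_l \<alpha> p K \<beta> \<mu>" and \<beta>: "0 < \<beta>" "\<beta> < 1/3" and f: "continuous_on K f"
  shows "(\<lambda>k. (1/3 - \<beta>) * \<beta> ^ k * J k f) sums (LINT x|\<mu>. f x)"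
proof -
  have bp: "borel_prob_on K \<mu>" using \<mu> by (simp add: is_mu_l_def)
  note D = borel_prob_onD[OF bp]
  interpret prob_space \<mu> by (rule D(1))
  define S where "S n = (\<Union>k<n. {w :: 3 list. length w = k}) \<times> (UNIV :: 3 set)" for n
  define A where "A = (\<lambda>(w, i). edge \<alpha> p w i)"
  define h where "h n x = (\<Sum>a\<in>S n. indicator (A a) x :: real)" for n x
  have Sf: "finite (S n)" for n unfolding S_def using finite_words by auto
  have As: "A a \<in> sets \<mu>" for a by (cases a) (auto simp: A_def intro!: D(6) edge_borel edge_subset_K[THEN subsetD])
  have dis: "disjoint_family_on A (S n)" for n
    unfolding disjoint_family_on_def A_def edge_def using edge_param_unique by (fastforce split: prod.splits)
  have h01: "0 \<le> h n x" "h n x \<le> 1" for n x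
  proof -
    have "h n x = indicator (\<Union>(A ` S n)) x"
      unfolding h_def by (rule indicator_UN_disjoint[OF Sf dis, symmetric])
    then show "0 \<le> h n x" "h n x \<le> 1" by (auto simp: indicator_def)
  qed
  have hi: "integrable \<mu> (\<lambda>x. h n x * g x)" if "continuous_on K g" for n g
  proof -
    have "integrable \<mu> (\<lambda>x. indicator (A a) x * g x)" for a
      using integrable_mult_indicator[OF As D(5)[OF that], of a] by simp
    then show ?thesis unfolding h_def sum_distrib_right by (intro Bochner_Integration.integrable_sum)
  qed
  have int: "(LINT x|\<mu>. h n x * g x) = (\<Sum>k<n. (1/3 - \<beta>) * \<beta> ^ k * J k g)" if g: "continuous_on K g" for n g
  proof -
    have "integrable \<mu> (\<lambda>x. indicator (A a) x * g x)" for a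
      using integrable_mult_indicator[OF As D(5)[OF g], of a] by simp
    then have "(LINT x|\<mu>. h n x * g x) = (\<Sum>a\<in>S n. LINT x|\<mu>. indicator (A a) x * g x)"
      unfolding h_def sum_distrib_right by (intro Bochner_Integration.integral_sum)
    also have "\<dots> = (\<Sum>w\<in>(\<Union>k<n. {w. length w = k}). \<Sum>i\<in>UNIV. LINT x|\<mu>. indicator (edge \<alpha> p w i) x * g x)"
      unfolding S_def sum.cartesian_product by (rule sum.cong) (auto simp: A_def)
    also have "\<dots> = (\<Sum>k<n. \<Sum>w | length w = k. \<Sum>i\<in>UNIV. LINT x|\<mu>. indicator (edge \<alpha> p w i) x * g x)"
      by (rule sum.UNION_disjoint) (auto simp: finite_words)
    also have "\<dots> = (\<Sum>k<n. (1/3 - \<beta>) * \<beta> ^ k * J k g)"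
      unfolding J_def sum_distrib_left by (intro sum.cong refl) (simp add: mu_l_edge[OF \<mu> \<beta> g])
    finally show ?thesis .
  qed
  \<comment> \<open>There are 3 * 3^k edges of level k, each of mass (1/3 - \<beta>) \<beta>^k; the
    sum is geometric.\<close>
  have h1: "(LINT x|\<mu>. h n x) = 1 - (3 * \<beta>) ^ n" for n
  proof -
    have "(LINT x|\<mu>. h n x) = (\<Sum>k<n. (1/3 - \<beta>) * \<beta> ^ k * J k (\<lambda>_. 1))"
      using int[of "\<lambda>_. 1" n] by simp
    also have "\<dots> = (1 - 3 * \<beta>) * (\<Sum>k<n. (3 * \<beta>) ^ k)"
      unfolding J_1 sum_distrib_left by (intro sum.cong) (auto simp: power_mult_distrib algebra_simps)
    also have "\<dots> = 1 - (3 * \<beta>) ^ n" by (rule one_diff_power_eq[symmetric])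
    finally show ?thesis .
  qed
  obtain C where C: "0 \<le> C" "\<And>x. x \<in> K \<Longrightarrow> \<bar>f x\<bar> \<le> C" using bounded_on_K[OF f] by metis
  have est: "norm ((\<Sum>k<n. (1/3 - \<beta>) * \<beta> ^ k * J k f) - (LINT x|\<mu>. f x)) \<le> C * (3 * \<beta>) ^ n" for n
  proof -
    have i1: "integrable \<mu> (h n)" using hi[of "\<lambda>_. 1" n] by simp
    have "(\<Sum>k<n. (1/3 - \<beta>) * \<beta> ^ k * J k f) - (LINT x|\<mu>. f x) = (LINT x|\<mu>. h n x * f x - f x)"
      using int[OF f, of n] hi[OF f, of n] D(5)[OF f] by simp
    also have "norm \<dots> \<le> (LINT x|\<mu>. \<bar>h n x * f x - f x\<bar>)" by (simp add: integral_abs_bound)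
    also have "\<dots> \<le> (LINT x|\<mu>. C * (1 - h n x))"
    proof (rule integral_mono)
      fix x assume "x \<in> space \<mu>"
      then have x: "x \<in> K" using D(3) by simp
      have "\<bar>h n x * f x - f x\<bar> = \<bar>f x\<bar> * \<bar>h n x - 1\<bar>" by (simp add: abs_mult[symmetric] algebra_simps)
      also have "\<dots> \<le> C * \<bar>h n x - 1\<bar>" using C(2)[OF x] by (intro mult_right_mono) auto
      also have "\<bar>h n x - 1\<bar> = 1 - h n x" using h01[of n x] by simp
      finally show "\<bar>h n x * f x - f x\<bar> \<le> C * (1 - h n x)" .
    qed (use hi[OF f, of n] D(5)[OF f] i1 in auto)
    also have "\<dots> = C * (3 * \<beta>) ^ n" using i1 h1[of n] by (simp add: prob_space)
    finally show ?thesis .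
  qed
  have "(\<lambda>n. C * (3 * \<beta>) ^ n) \<longlonglongrightarrow> C * 0"
    using \<beta> by (intro tendsto_intros LIMSEQ_power_zero) auto
  then have "(\<lambda>n. C * (3 * \<beta>) ^ n) \<longlonglongrightarrow> 0" by simp
  then have "(\<lambda>n. (\<Sum>k<n. (1/3 - \<beta>) * \<beta> ^ k * J k f) - (LINT x|\<mu>. f x)) \<longlonglongrightarrow> 0"
    by (rule Lim_null_comparison[rotated]) (use est in auto)
  then show ?thesis unfolding sums_def by (simp add: LIM_zero_iff)
qed

lemma mu_l_mean:
  assumes \<mu>: "is_mu_l \<alpha> p K \<beta> \<mu>" and \<beta>: "0 < \<beta>" "\<beta> < 1/3" shows "mean (\<lambda>f. LINT x|\<mu>. f x)"
proof (rule mean_integral)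
  show "borel_prob_on K \<mu>" using \<mu> by (simp add: is_mu_l_def)
  fix \<pi> and f :: "real^2 \<Rightarrow> real" assume \<pi>: "three_sym \<pi>" and f: "continuous_on K f"
  have fs: "continuous_on K (f \<circ> sym \<pi>)"
    by (rule continuous_on_compose[OF sym_cont], rule continuous_on_subset[OF f]) (auto simp: sym_K[OF \<pi>])
  show "(LINT x|\<mu>. (f \<circ> sym \<pi>) x) = (LINT x|\<mu>. f x)"
    using mu_l_sums[OF \<mu> \<beta> fs] mu_l_sums[OF \<mu> \<beta> f] unfolding J_sym[OF \<pi>] by (rule sums_unique2)
qed

text \<open>The term k = 0 of the series belongs to the first-level edges; the remaining ones are
  \<beta> times the series of the three cells.\<close>

lemma mu_l_self_similar:
  assumes \<mu>: "is_mu_l \<alpha> p K \<beta> \<mu>" and \<beta>: "0 < \<beta>" "\<beta> < 1/3" and f: "continuous_on K f"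
  shows "(LINT x|\<mu>. f x) = (1/3 - \<beta>) * (\<Sum>i\<in>UNIV. LINT t|I01. f (e i t)) + \<beta> * (\<Sum>i\<in>UNIV. LINT x|\<mu>. (f \<circ> G i) x)"
proof -
  have "(\<lambda>k. \<Sum>i\<in>UNIV. (1/3 - \<beta>) * \<beta> ^ k * J k (f \<circ> G i)) sums (\<Sum>i\<in>UNIV. LINT x|\<mu>. (f \<circ> G i) x)"
    by (intro sums_sum mu_l_sums[OF \<mu> \<beta> u_G_cont[OF f]])
  from sums_mult[OF this, of \<beta>]
  have "(\<lambda>k. (1/3 - \<beta>) * \<beta> ^ Suc k * J (Suc k) f) sums (\<beta> * (\<Sum>i\<in>UNIV. LINT x|\<mu>. (f \<circ> G i) x))"
    by (simp only: J_Suc sum_distrib_left power_Suc mult_ac)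
  from sums_Suc[OF this] have "(\<lambda>k. (1/3 - \<beta>) * \<beta> ^ k * J k f) sums (\<beta> * (\<Sum>i\<in>UNIV. LINT x|\<mu>. (f \<circ> G i) x) + (1/3 - \<beta>) * J 0 f)"
    by simp
  from sums_unique2[OF mu_l_sums[OF \<mu> \<beta> f] this] show ?thesis by (simp add: J_0)
qed

end

section \<open>Two general tools: diagonal sequences and the first variation\<close>

lemma pointwise_convergent_subsequence:
  fixes f :: "nat \<Rightarrow> 'a \<Rightarrow> real"
  assumes S: "countable S" "S \<noteq> {}" and bd: "\<And>n x. x \<in> S \<Longrightarrow> \<bar>f n x\<bar> \<le> C"
  obtains k where "strict_mono (k :: nat \<Rightarrow> nat)" "\<And>x. x \<in> S \<Longrightarrow> convergent (\<lambda>n. f (k n) x)"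
proof -
  define y where "y = from_nat_into S"
  have y: "y n \<in> S" for n unfolding y_def by (rule from_nat_into[OF S(2)])
  let ?P = "\<lambda>n s. convergent (\<lambda>j. f (s j) (y n))"
  interpret subseqs ?P
  proof
    fix n and s :: "nat \<Rightarrow> nat" assume "strict_mono s"
    have "bounded (range (\<lambda>j. f (s j) (y n)))"
      unfolding bounded_iff using bd[OF y] by (intro exI[of _ C]) auto
    from bounded_imp_convergent_subsequence[OF this] obtain l r where "strict_mono r" "((\<lambda>j. f (s j) (y n)) \<circ> r) \<longlonglongrightarrow> l"
      by blast
    then show "\<exists>r'. strict_mono r' \<and> ?P n (s \<circ> r')" by (auto simp: convergent_def o_def)
  qed
  have d: "?P n (diagseq \<circ> (+) (Suc n))" for n
  proof (rule diagseq_holds)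
    fix s r :: "nat \<Rightarrow> nat" and n assume r: "strict_mono r" and "?P n s"
    then obtain l where "(\<lambda>j. f (s j) (y n)) \<longlonglongrightarrow> l" by (auto simp: convergent_def)
    from LIMSEQ_subseq_LIMSEQ[OF this r] show "?P n (s \<circ> r)" by (auto simp: convergent_def o_def)
  qed
  show ?thesis
  proof (rule that[OF subseq_diagseq])
    fix x assume "x \<in> S"
    then obtain n where x: "x = y n" unfolding y_def using from_nat_into_surj[OF S(1)] by metis
    have "convergent (\<lambda>j. f (diagseq (j + Suc n)) (y n))" using d[of n] by (simp add: o_def add.commute)
    then show "convergent (\<lambda>j. f (diagseq j) x)"
      unfolding x using convergent_ignore_initial_segment[of "\<lambda>j. f (diagseq j) (y n)" "Suc n"] by simp
  qed
qed

lemma quadratic_nonneg_imp_linear_zero: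
  fixes b c :: real
  assumes "\<And>t. 0 \<le> 2 * t * b + t\<^sup>2 * c" shows "b = 0"
proof (rule ccontr)
  assume "b \<noteq> 0"
  \<comment> \<open>At t = - b / d with d above the modulus of c, the linear term wins over the
    quadratic one.\<close>
  define d where "d = \<bar>c\<bar> + 1"
  have d: "0 < d" "c < d" by (auto simp: d_def)
  have "2 * (- b / d) * b + (- b / d)\<^sup>2 * c = b\<^sup>2 / d\<^sup>2 * (c - 2 * d)"
    using d by (simp add: power2_eq_square field_simps)
  also have "\<dots> < 0" using d \<open>b \<noteq> 0\<close> by (intro mult_pos_neg) auto
  finally show False using assms[of "- b / d"] by simp
qed

context ssg begin

section \<open>Minimizing the Rayleigh quotient\<close>

lemma dyad_tendsto:
  assumes "\<And>t. t \<in> {0..1} \<Longrightarrow> (\<lambda>n. f n t) \<longlonglongrightarrow> g t"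
  shows "(\<lambda>n. dyad N (f n) (f n)) \<longlonglongrightarrow> dyad N g g"
  unfolding dyad_def by (intro tendsto_intros assms dyadic_in_unit) auto

lemma B_tendsto:
  assumes "\<And>x. x \<in> K \<Longrightarrow> (\<lambda>n. f n x) \<longlonglongrightarrow> g x"
  shows "(\<lambda>n. B m r \<rho> (f n) (f n)) \<longlonglongrightarrow> B m r \<rho> g g"
  using assms
proof (induction m arbitrary: r \<rho> f g)
  case 0 then show ?case by (simp, intro tendsto_intros 0 p_K)
next
  case (Suc m)
  have "(\<lambda>n. B m (r \<circ> Suc) (\<rho> \<circ> Suc) (f n \<circ> G i) (f n \<circ> G i)) \<longlonglongrightarrow> B m (r \<circ> Suc) (\<rho> \<circ> Suc) (g \<circ> G i) (g \<circ> G i)" for i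
    by (rule Suc.IH) (simp add: Suc.prems G_K)
  moreover have "(\<lambda>n. dyad m (f n \<circ> e i) (f n \<circ> e i)) \<longlonglongrightarrow> dyad m (g \<circ> e i) (g \<circ> e i)" for i
    by (rule dyad_tendsto) (simp add: Suc.prems e_K del: atLeastAtMost_iff)
  ultimately show ?case unfolding B.simps by (intro tendsto_intros)
qed

text \<open>Diagonal extraction gives convergence on the countable union of the finite nets. The
  nets make it uniform, since their estimate applies to differences of members of the sequence,
  which again have bounded energy. Antisymmetry pins the values at the vertices to 0 and thereby
  bounds the sequence.\<close>

lemma compactness:
  fixes f :: "nat \<Rightarrow> real^2 \<Rightarrow> real"
  assumes m: "matching r \<rho>" and f: "\<And>n. f n \<in> fin_energy r \<rho>" "\<And>n. anti (f n)" "\<And>n. En r \<rho> (f n) (f n) \<le> C"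
  obtains k u where "strict_mono k" "uniform_limit K (\<lambda>n. f (k n)) u sequentially"
proof -
  have C0: "0 \<le> C" using En_nonneg[OF m f(1)] f(3) order_trans by blast
  have sC: "sqrt (En r \<rho> (f n) (f n)) \<le> sqrt C" for n using f(3) by simp
  have bd: "\<bar>f n x\<bar> \<le> 5 * sqrt C" if "x \<in> K" for n x
  proof -
    have "f n (p 0) = 0" using anti_vanish[OF f(2)[of n]] by (simp add: vanish_def)
    then show ?thesis using osc_bound[OF m f(1) that, of n 0] sC[of n] by linarith
  qed
  from finite_net obtain F where F: "\<And>j. finite (F j)" "\<And>j. F j \<subseteq> K"
    "\<And>j r \<rho> u x. matching r \<rho> \<Longrightarrow> u \<in> fin_energy r \<rho> \<Longrightarrow> x \<in> K \<Longrightarrow>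
     \<exists>y\<in>F j. \<bar>u x - u y\<bar> \<le> 5 * (4/5) ^ j * sqrt (En r \<rho> u u)" by metis
  let ?S = "insert (p 0) (\<Union>j. F j)"
  have "countable ?S" "?S \<noteq> {}" using F(1) by (auto intro: countable_finite)
  moreover have "\<bar>f n x\<bar> \<le> 5 * sqrt C" if "x \<in> ?S" for n x using bd that F(2) p_K by blast
  ultimately obtain k where k: "strict_mono k" "\<And>x. x \<in> ?S \<Longrightarrow> convergent (\<lambda>n. f (k n) x)"
    using pointwise_convergent_subsequence[of ?S f "5 * sqrt C"] by metis
  have "uniformly_Cauchy_on K (\<lambda>n. f (k n))"
  proof (rule uniformly_Cauchy_onI)
    fix \<epsilon> :: real assume e: "0 < \<epsilon>"
    have "(\<lambda>j. 5 * (4/5) ^ j * sqrt C) \<longlonglongrightarrow> 5 * 0 * sqrt C"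
      by (intro tendsto_intros LIMSEQ_power_zero) auto
    then have "\<forall>\<^sub>F j in sequentially. 5 * (4/5) ^ j * sqrt C < \<epsilon> / 3"
      using e by (intro order_tendstoD(2)) auto
    then obtain j where j: "5 * (4/5) ^ j * sqrt C < \<epsilon> / 3" by (auto simp: eventually_sequentially)
    have "\<forall>y\<in>F j. \<exists>N. \<forall>a\<ge>N. \<forall>b\<ge>N. \<bar>f (k a) y - f (k b) y\<bar> < \<epsilon> / 3"
    proof
      fix y assume "y \<in> F j"
      then have "Cauchy (\<lambda>n. f (k n) y)" using k(2)[of y] by (auto intro: convergent_Cauchy)
      then show "\<exists>N. \<forall>a\<ge>N. \<forall>b\<ge>N. \<bar>f (k a) y - f (k b) y\<bar> < \<epsilon> / 3"
        using e unfolding Cauchy_def dist_real_def by (meson divide_pos_pos zero_less_numeral)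
    qed
    then obtain N where N: "\<And>y a b. y \<in> F j \<Longrightarrow> N y \<le> a \<Longrightarrow> N y \<le> b \<Longrightarrow> \<bar>f (k a) y - f (k b) y\<bar> < \<epsilon> / 3" by metis
    define N0 where "N0 = (\<Sum>y\<in>F j. N y)"
    have N0: "N y \<le> N0" if "y \<in> F j" for y unfolding N0_def by (rule member_le_sum) (use that F(1) in auto)
    show "\<exists>N. \<forall>x\<in>K. \<forall>a\<ge>N. \<forall>b\<ge>N. dist (f (k a) x) (f (k b) x) < \<epsilon>"
    proof (intro exI[of _ N0] ballI allI impI)
      fix x a b assume x: "x \<in> K" and ab: "N0 \<le> a" "N0 \<le> b"
      define w where "w x = f (k a) x - f (k b) x" for x
      have wf: "w \<in> fin_energy r \<rho>" unfolding w_def by (intro fin_energy_diff m f)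
      \<comment> \<open>The parallelogram identity bounds the energy of the difference by 4 * C. The
        error from the net is then below two thirds of \<epsilon>, and the net point takes the last
        third.\<close>
      have "En r \<rho> w w \<le> (2 * sqrt C)\<^sup>2"
      proof (rule LIMSEQ_le_const2[OF En_square(1)[OF m wf]], intro exI[of _ 0] allI impI)
        fix i
        have "B i r \<rho> w w \<le> 2 * B i r \<rho> (f (k a)) (f (k a)) + 2 * B i r \<rho> (f (k b)) (f (k b))"
          using B_parallelogram[of i r \<rho> "f (k a)" "f (k b)"] B_nonneg[OF m, of i "\<lambda>x. f (k a) x + f (k b) x"]
          unfolding w_def by linarith
        also have "\<dots> \<le> 2 * C + 2 * C"
          using En_square(2)[OF m f(1), of i "k a"] En_square(2)[OF m f(1), of i "k b"] f(3)[of "k a"] f(3)[of "k b"] by linarith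
        also have "\<dots> = (2 * sqrt C)\<^sup>2" using C0 by (simp add: power_mult_distrib)
        finally show "B i r \<rho> w w \<le> (2 * sqrt C)\<^sup>2" .
      qed
      then have "sqrt (En r \<rho> w w) \<le> 2 * sqrt C" using C0 by (intro real_le_lsqrt) (auto simp: En_nonneg[OF m wf])
      then have s: "5 * (4/5) ^ j * sqrt (En r \<rho> w w) \<le> 5 * (4/5) ^ j * (2 * sqrt C)" by (intro mult_left_mono) auto
      obtain y where y: "y \<in> F j" "\<bar>w x - w y\<bar> \<le> 5 * (4/5) ^ j * sqrt (En r \<rho> w w)"
        using F(3)[OF m wf x] by blast
      have "\<bar>w y\<bar> < \<epsilon> / 3" unfolding w_def using N[OF y(1)] N0[OF y(1)] ab by (meson order_trans)
      then have "\<bar>w x\<bar> < \<epsilon>" using y(2) s j by linarith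
      then show "dist (f (k a) x) (f (k b) x) < \<epsilon>" by (simp add: w_def dist_real_def)
    qed
  qed
  then have "uniformly_convergent_on K (\<lambda>n. f (k n))" by (rule Cauchy_uniformly_convergent)
  then show ?thesis using that[OF k(1)] by (auto simp: uniformly_convergent_on_def)
qed

lemma meanD:
  assumes "mean \<Phi>"
  shows "\<And>f g. continuous_on K f \<Longrightarrow> continuous_on K g \<Longrightarrow> \<Phi> (\<lambda>x. f x + g x) = \<Phi> f + \<Phi> g"
    "\<And>c f. continuous_on K f \<Longrightarrow> \<Phi> (\<lambda>x. c * f x) = c * \<Phi> f"
    "\<And>f g. continuous_on K f \<Longrightarrow> continuous_on K g \<Longrightarrow> (\<And>x. x \<in> K \<Longrightarrow> f x \<le> g x) \<Longrightarrow> \<Phi> f \<le> \<Phi> g"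
    "\<And>\<pi> f. three_sym \<pi> \<Longrightarrow> continuous_on K f \<Longrightarrow> \<Phi> (f \<circ> sym \<pi>) = \<Phi> f"
  using assms unfolding mean_def by simp_all

lemma mean_cong:
  assumes "mean \<Phi>" "continuous_on K f" "\<And>x. x \<in> K \<Longrightarrow> f x = g x" shows "\<Phi> f = \<Phi> g"
proof (rule order_antisym)
  have g: "continuous_on K g" by (rule continuous_on_eq[OF assms(2,3)])
  show "\<Phi> f \<le> \<Phi> g" "\<Phi> g \<le> \<Phi> f" by (rule meanD(3)[OF assms(1)]; use assms g in simp)+
qed

lemma mean_nonneg:
  assumes "mean \<Phi>" "continuous_on K f" "\<And>x. x \<in> K \<Longrightarrow> 0 \<le> f x" shows "0 \<le> \<Phi> f"
proof -
  have "\<Phi> (\<lambda>x. 0 * f x) \<le> \<Phi> f" by (rule meanD(3)[OF assms(1)]) (use assms in \<open>auto intro!: continuous_intros\<close>)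
  then show ?thesis using meanD(2)[OF assms(1,2), of 0] by simp
qed

lemma mean_const: "mean \<Phi> \<Longrightarrow> \<Phi> (\<lambda>_. c) = c * \<Phi> (\<lambda>_. 1)"
  using meanD(2)[of \<Phi> "\<lambda>_. 1" c] by simp

lemma mean_dist:
  assumes "mean \<Phi>" "continuous_on K f" "continuous_on K g" "\<And>x. x \<in> K \<Longrightarrow> \<bar>f x - g x\<bar> \<le> \<epsilon>"
  shows "\<bar>\<Phi> f - \<Phi> g\<bar> \<le> \<epsilon> * \<Phi> (\<lambda>_. 1)"
proof -
  have "\<Phi> f \<le> \<Phi> (\<lambda>x. g x + \<epsilon>)" "\<Phi> g \<le> \<Phi> (\<lambda>x. f x + \<epsilon>)"
    by (rule meanD(3)[OF assms(1)]; use assms(2-4) in \<open>force intro!: continuous_intros simp: abs_le_iff\<close>)+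
  then show ?thesis
    using meanD(1)[OF assms(1), of g "\<lambda>_. \<epsilon>"] meanD(1)[OF assms(1), of f "\<lambda>_. \<epsilon>"] mean_const[OF assms(1), of \<epsilon>] assms(2,3)
    by (simp add: abs_le_iff)
qed

lemma mean_combination:
  assumes "mean \<Phi>" "mean \<Psi>" "0 \<le> a" "0 \<le> b" shows "mean (\<lambda>f. a * \<Phi> f + b * \<Psi> f)"
  unfolding mean_def
  using meanD[OF assms(1)] meanD[OF assms(2)] assms(3,4)
  by (auto simp: algebra_simps intro!: add_mono mult_left_mono)

lemma mean_sum:
  assumes "mean \<Phi>" "finite S" "\<And>c. c \<in> S \<Longrightarrow> continuous_on K (f c)"
  shows "\<Phi> (\<lambda>x. \<Sum>c\<in>S. f c x) = (\<Sum>c\<in>S. \<Phi> (f c))"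
  using assms(2,3)
proof (induction S rule: finite_induct)
  case empty then show ?case using mean_const[OF assms(1), of 0] by simp
next
  case (insert c S)
  then show ?case using meanD(1)[OF assms(1), of "f c" "\<lambda>x. \<Sum>c\<in>S. f c x"]
    by (simp add: continuous_on_sum)
qed

text \<open>As in \<open>B_proj\<close>, now for the pairing of u and v under \<Phi> in place of the
  energy.\<close>

lemma mean_proj:
  assumes \<Phi>: "mean \<Phi>" and u: "anti u" "continuous_on K u" and v: "continuous_on K v"
  shows "\<Phi> (\<lambda>x. u x * proj v x) = \<Phi> (\<lambda>x. u x * v x)"
proof -
  have vs: "continuous_on K (v \<circ> sym \<pi>)" if "three_sym \<pi>" for \<pi>
    by (rule continuous_on_compose[OF sym_cont], rule continuous_on_subset[OF v]) (auto simp: sym_K[OF that])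
  have uv: "continuous_on K (\<lambda>x. u x * v x)" by (intro continuous_intros u v)
  have R: "\<Phi> (\<lambda>x. u x * (v \<circ> sym (rot c)) x) = \<Phi> (\<lambda>x. u x * v x)" for c
  proof -
    have "\<Phi> (\<lambda>x. u x * (v \<circ> sym (rot c)) x) = \<Phi> ((\<lambda>x. u x * v x) \<circ> sym (rot c))"
      by (rule mean_cong[OF \<Phi>]) (simp_all add: anti_rot[OF u(1)] continuous_on_mult u vs del: o_apply, simp add: anti_rot[OF u(1)])
    then show ?thesis by (simp only: meanD(4)[OF \<Phi> three_sym_intros(1) uv])
  qed
  have S: "\<Phi> (\<lambda>x. u x * (v \<circ> sym (mirror c)) x) = - \<Phi> (\<lambda>x. u x * v x)" for c
  proof -
    have "\<Phi> (\<lambda>x. (-1) * (u x * (v \<circ> sym (mirror c)) x)) = \<Phi> ((\<lambda>x. u x * v x) \<circ> sym (mirror c))"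
    proof (rule mean_cong[OF \<Phi>])
      show "continuous_on K (\<lambda>x. (-1) * (u x * (v \<circ> sym (mirror c)) x))"
        by (intro continuous_on_mult continuous_on_const u vs three_sym_intros)
    qed (use u(1) in \<open>simp add: anti_def\<close>)
    then have "(-1) * \<Phi> (\<lambda>x. u x * (v \<circ> sym (mirror c)) x) = \<Phi> (\<lambda>x. u x * v x)"
      by (simp only: meanD(4)[OF \<Phi> three_sym_intros(2) uv] meanD(2)[OF \<Phi> continuous_on_mult[OF u(2) vs[OF three_sym_intros(2)]]])
    then show ?thesis by simp
  qed
  let ?g = "\<lambda>c x. u x * (v \<circ> sym (rot c)) x + (-1) * (u x * (v \<circ> sym (mirror c)) x)"
  have g: "continuous_on K (?g c)" for c
    by (intro continuous_on_add continuous_on_mult continuous_on_const u vs three_sym_intros)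
  have gc: "\<Phi> (?g c) = 2 * \<Phi> (\<lambda>x. u x * v x)" for c
  proof -
    have "\<Phi> (?g c) = \<Phi> (\<lambda>x. u x * (v \<circ> sym (rot c)) x) + (-1) * \<Phi> (\<lambda>x. u x * (v \<circ> sym (mirror c)) x)"
      by (subst meanD(1)[OF \<Phi>], (intro continuous_on_mult continuous_on_const u vs three_sym_intros)+)
         (simp only: meanD(2)[OF \<Phi> continuous_on_mult[OF u(2) vs[OF three_sym_intros(2)]]])
    then show ?thesis unfolding R S by simp
  qed
  have "\<Phi> (\<lambda>x. u x * proj v x) = \<Phi> (\<lambda>x. 1/6 * (\<Sum>c\<in>UNIV. ?g c x))"
    by (rule arg_cong[of _ _ \<Phi>]) (simp add: proj_def fun_eq_iff sum_distrib_left algebra_simps)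
  also have "\<dots> = 1/6 * (\<Sum>c\<in>UNIV. \<Phi> (?g c))"
    using g by (subst meanD(2)[OF \<Phi> continuous_on_sum]) (simp_all only: mean_sum[OF \<Phi> finite])
  also have "\<dots> = \<Phi> (\<lambda>x. u x * v x)" unfolding gc by simp
  finally show ?thesis .
qed

lemma En_expand:
  assumes m: "matching r \<rho>" and u: "u \<in> fin_energy r \<rho>" and v: "v \<in> fin_energy r \<rho>"
  shows "En r \<rho> (\<lambda>x. u x + t * v x) (\<lambda>x. u x + t * v x) = En r \<rho> u u + 2 * t * En r \<rho> u v + t\<^sup>2 * En r \<rho> v v"
proof (rule LIMSEQ_unique)
  show "(\<lambda>m. B m r \<rho> (\<lambda>x. u x + t * v x) (\<lambda>x. u x + t * v x)) \<longlonglongrightarrow> En r \<rho> (\<lambda>x. u x + t * v x) (\<lambda>x. u x + t * v x)"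
    by (intro En_tendsto m fin_energy_add fin_energy_scale u v)
  have "B k r \<rho> (\<lambda>x. u x + t * v x) (\<lambda>x. u x + t * v x) = B k r \<rho> u u + 2 * t * B k r \<rho> u v + t\<^sup>2 * B k r \<rho> v v" for k
    by (simp add: B_add_left B_add_right B_scale_left B_scale_right B_commute[of _ _ _ v u] power2_eq_square algebra_simps)
  then show "(\<lambda>m. B m r \<rho> (\<lambda>x. u x + t * v x) (\<lambda>x. u x + t * v x)) \<longlonglongrightarrow> En r \<rho> u u + 2 * t * En r \<rho> u v + t\<^sup>2 * En r \<rho> v v"
    by (simp only:) (intro tendsto_intros En_tendsto m u v)
qed

lemma En_scale:
  assumes m: "matching r \<rho>" and u: "u \<in> fin_energy r \<rho>"
  shows "En r \<rho> (\<lambda>x. t * u x) (\<lambda>x. t * u x) = t\<^sup>2 * En r \<rho> u u"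
proof (rule LIMSEQ_unique[OF En_tendsto[OF m fin_energy_scale[OF u] fin_energy_scale[OF u]]])
  show "(\<lambda>m. B m r \<rho> (\<lambda>x. t * u x) (\<lambda>x. t * u x)) \<longlonglongrightarrow> t\<^sup>2 * En r \<rho> u u"
    unfolding B_scale_left B_scale_right power2_eq_square mult.assoc by (intro tendsto_intros En_tendsto m u)
qed

text \<open>The values at the vertices are 0, and 25 is the square of the oscillation
  constant.\<close>

lemma sup_bound:
  assumes m: "matching r \<rho>" and u: "u \<in> fin_energy r \<rho>" "anti u" and x: "x \<in> K"
  shows "(u x)\<^sup>2 \<le> 25 * En r \<rho> u u"
proof -
  have "\<bar>u x\<bar> \<le> 5 * sqrt (En r \<rho> u u)"
    using osc_bound[OF m u(1) x, of 0] anti_vanish[OF u(2)] by (simp add: vanish_def)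
  then have "\<bar>u x\<bar>\<^sup>2 \<le> (5 * sqrt (En r \<rho> u u))\<^sup>2" by (rule power_mono) simp
  then show ?thesis using En_nonneg[OF m u(1)] by (simp add: power_mult_distrib)
qed

lemma anti_scale: "anti u \<Longrightarrow> anti (\<lambda>x. c * u x)" and anti_add: "anti u \<Longrightarrow> anti v \<Longrightarrow> anti (\<lambda>x. u x + v x)"
  by (auto simp: anti_def)

text \<open>The direct method on the unit sphere of antisymmetric functions. The function t makes
  the sphere nonempty and bounds the minimum from above; the bound from below is the supremum
  estimate for the minimizer, integrated by \<Phi>.\<close>

lemma minimizer:
  assumes m: "matching r \<rho>" and \<Phi>: "mean \<Phi>"
    and t: "t \<in> fin_energy r \<rho>" "anti t" "0 < \<Phi> (\<lambda>x. (t x)\<^sup>2)"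
  obtains u l where "u \<in> fin_energy r \<rho>" "anti u" "\<Phi> (\<lambda>x. (u x)\<^sup>2) = 1"
    "\<And>v. v \<in> fin_energy r \<rho> \<Longrightarrow> En r \<rho> u v = l * \<Phi> (\<lambda>x. u x * v x)"
    "l * \<Phi> (\<lambda>x. (t x)\<^sup>2) \<le> En r \<rho> t t" "1 \<le> 25 * l * \<Phi> (\<lambda>_. 1)"
proof -
  define S where "S = {u \<in> fin_energy r \<rho>. anti u \<and> \<Phi> (\<lambda>x. (u x)\<^sup>2) = 1}"
  define l where "l = Inf ((\<lambda>u. En r \<rho> u u) ` S)"
  have sq: "continuous_on K (\<lambda>x. (u x)\<^sup>2)" if "u \<in> fin_energy r \<rho>" for u
    by (intro continuous_intros fin_energy_cont[OF that])
  have norm: "(\<lambda>x. (1 / sqrt (\<Phi> (\<lambda>x. (v x)\<^sup>2))) * v x) \<in> S \<and>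
      En r \<rho> (\<lambda>x. (1 / sqrt (\<Phi> (\<lambda>x. (v x)\<^sup>2))) * v x) (\<lambda>x. (1 / sqrt (\<Phi> (\<lambda>x. (v x)\<^sup>2))) * v x) = En r \<rho> v v / \<Phi> (\<lambda>x. (v x)\<^sup>2)"
    if v: "v \<in> fin_energy r \<rho>" "anti v" "0 < \<Phi> (\<lambda>x. (v x)\<^sup>2)" for v
  proof -
    define c where "c = 1 / sqrt (\<Phi> (\<lambda>x. (v x)\<^sup>2))"
    have c2: "c\<^sup>2 = 1 / \<Phi> (\<lambda>x. (v x)\<^sup>2)" using v(3) by (simp add: c_def power_divide)
    have "\<Phi> (\<lambda>x. (c * v x)\<^sup>2) = c\<^sup>2 * \<Phi> (\<lambda>x. (v x)\<^sup>2)"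
      unfolding power_mult_distrib by (rule meanD(2)[OF \<Phi> sq[OF v(1)]])
    then have "\<Phi> (\<lambda>x. (c * v x)\<^sup>2) = 1" unfolding c2 using v(3) by simp
    then show ?thesis
      unfolding c_def[symmetric] S_def
      using fin_energy_scale[OF v(1), of c] anti_scale[OF v(2), of c] En_scale[OF m v(1), of c] c2 by simp
  qed
  have ne: "S \<noteq> {}" using norm[OF t] by blast
  have bb: "bdd_below ((\<lambda>u. En r \<rho> u u) ` S)"
    by (rule bdd_belowI[of _ 0]) (auto simp: S_def intro: En_nonneg[OF m])
  have l_le: "l \<le> En r \<rho> u u" if "u \<in> S" for u
    unfolding l_def by (rule cInf_lower[OF _ bb]) (use that in blast)
  have l_le': "l * \<Phi> (\<lambda>x. (v x)\<^sup>2) \<le> En r \<rho> v v" if v: "v \<in> fin_energy r \<rho>" "anti v" for v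
  proof (cases "0 < \<Phi> (\<lambda>x. (v x)\<^sup>2)")
    case True
    have "l \<le> En r \<rho> v v / \<Phi> (\<lambda>x. (v x)\<^sup>2)"
      using l_le[OF conjunct1[OF norm[OF v True]]] unfolding conjunct2[OF norm[OF v True]] .
    then show ?thesis using True by (simp add: field_simps)
  next
    case False
    moreover have "0 \<le> \<Phi> (\<lambda>x. (v x)\<^sup>2)" by (rule mean_nonneg[OF \<Phi> sq[OF v(1)]]) simp
    ultimately have "\<Phi> (\<lambda>x. (v x)\<^sup>2) = 0" by simp
    then show ?thesis using En_nonneg[OF m v(1)] by simp
  qed
  have "\<exists>u\<in>S. En r \<rho> u u < l + 1 / real (Suc n)" for n
  proof -
    have "Inf ((\<lambda>u. En r \<rho> u u) ` S) < l + 1 / real (Suc n)" unfolding l_def[symmetric] by simp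
    then show ?thesis using cInf_less_iff[of "(\<lambda>u. En r \<rho> u u) ` S"] ne bb by auto
  qed
  then obtain f where f: "\<And>n. f n \<in> S" "\<And>n. En r \<rho> (f n) (f n) < l + 1 / real (Suc n)" by metis
  have fS: "f n \<in> fin_energy r \<rho>" "anti (f n)" "\<Phi> (\<lambda>x. (f n x)\<^sup>2) = 1" for n using f(1)[of n] by (auto simp: S_def)
  have fb: "En r \<rho> (f n) (f n) \<le> l + 1" for n
  proof -
    have "1 / real (Suc n) \<le> 1" by simp
    then show ?thesis using f(2)[of n] by linarith
  qed
  obtain k u where k: "strict_mono k" "uniform_limit K (\<lambda>n. f (k n)) u sequentially"
    by (rule compactness[OF m fS(1) fS(2) fb])
  have uc: "continuous_on K u"
    by (rule uniform_limit_theorem[OF _ k(2)]) (auto intro!: always_eventually fin_energy_cont fS)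
  have pt: "(\<lambda>n. f (k n) x) \<longlonglongrightarrow> u x" if "x \<in> K" for x by (rule tendsto_uniform_limitI[OF k(2) that])
  have ua: "anti u"
    unfolding anti_def
  proof (intro allI ballI)
    fix c x assume x: "x \<in> K"
    have "(\<lambda>n. f (k n) (sym (mirror c) x)) \<longlonglongrightarrow> u (sym (mirror c) x)" by (rule pt[OF sym_K[OF _ x]]) simp
    moreover have "(\<lambda>n. - f (k n) x) \<longlonglongrightarrow> - u x" by (intro tendsto_intros pt x)
    moreover have "(\<lambda>n. f (k n) (sym (mirror c) x)) = (\<lambda>n. - f (k n) x)" using fS(2) x by (auto simp: anti_def)
    ultimately show "u (sym (mirror c) x) = - u x" by (simp add: LIMSEQ_unique)
  qed
  \<comment> \<open>Lower semicontinuity: each \<open>B i\<close> passes to the pointwise limit, and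
    a bound on all of them bounds the energy.\<close>
  have Bl: "B i r \<rho> u u \<le> l" for i
  proof (rule LIMSEQ_le[OF B_tendsto[OF pt]])
    have "(\<lambda>n. l + 1 / real (Suc n)) \<longlonglongrightarrow> l + 0"
      by (intro tendsto_intros LIMSEQ_Suc[OF lim_1_over_n])
    then show "(\<lambda>n. l + 1 / real (Suc n)) \<longlonglongrightarrow> l" by simp
    have "B i r \<rho> (f (k n)) (f (k n)) \<le> l + 1 / real (Suc n)" for n
    proof -
      have "1 / real (Suc (k n)) \<le> 1 / real (Suc n)" using strict_mono_imp_increasing[OF k(1), of n] by (simp add: frac_le)
      then show ?thesis using En_square(2)[OF m fS(1), of i "k n"] f(2)[of "k n"] by linarith
    qed
    then show "\<exists>N. \<forall>n\<ge>N. B i r \<rho> (f (k n)) (f (k n)) \<le> l + 1 / real (Suc n)" by blast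
  qed
  have uf: "u \<in> fin_energy r \<rho>" by (rule fin_energyI[OF uc Bl])
  have El: "En r \<rho> u u \<le> l" by (rule LIMSEQ_le_const2[OF En_square(1)[OF m uf]]) (use Bl in blast)
  \<comment> \<open>Uniform convergence preserves the constraint. The 1 added to the total mass in
    the tolerance keeps the denominator positive.\<close>
  have u1: "\<Phi> (\<lambda>x. (u x)\<^sup>2) = 1"
  proof -
    have bu: "bounded (u ` K)" by (intro compact_imp_bounded compact_continuous_image uc K_compact)
    have ul: "uniform_limit K (\<lambda>n x. f (k n) x * f (k n) x) (\<lambda>x. u x * u x) sequentially"
      by (rule uniform_lim_mult[OF k(2) k(2) bu bu])
    have P1: "0 \<le> \<Phi> (\<lambda>_. 1)" by (rule mean_nonneg[OF \<Phi>]) auto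
    have "\<bar>1 - \<Phi> (\<lambda>x. (u x)\<^sup>2)\<bar> \<le> \<epsilon>" if e: "0 < \<epsilon>" for \<epsilon>
    proof -
      let ?\<delta> = "\<epsilon> / (\<Phi> (\<lambda>_. 1) + 1)"
      have d: "0 < ?\<delta>" using e P1 by simp
      from uniform_limitD[OF ul d] obtain n where n: "\<And>x. x \<in> K \<Longrightarrow> dist (f (k n) x * f (k n) x) (u x * u x) < ?\<delta>"
        by (auto simp: eventually_sequentially)
      have "\<bar>\<Phi> (\<lambda>x. (f (k n) x)\<^sup>2) - \<Phi> (\<lambda>x. (u x)\<^sup>2)\<bar> \<le> ?\<delta> * \<Phi> (\<lambda>_. 1)"
        by (rule mean_dist[OF \<Phi> sq[OF fS(1)] sq[OF uf]]) (use n in \<open>auto simp: dist_real_def power2_eq_square less_imp_le\<close>)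
      also have "\<dots> \<le> ?\<delta> * (\<Phi> (\<lambda>_. 1) + 1)" using d by (intro mult_left_mono) auto
      also have "\<dots> = \<epsilon>" using P1 by simp
      finally show ?thesis by (simp add: fS)
    qed
    then have "\<bar>1 - \<Phi> (\<lambda>x. (u x)\<^sup>2)\<bar> \<le> 0" by (rule field_le_epsilon[of _ 0, simplified])
    then show ?thesis by simp
  qed
  have uS: "u \<in> S" using uf ua u1 by (simp add: S_def)
  have Eu: "En r \<rho> u u = l" using El l_le[OF uS] by simp
  \<comment> \<open>The Euler-Lagrange equation in antisymmetric directions, the only ones in which
    u is minimal by construction.\<close>
  have EL: "En r \<rho> u v = l * \<Phi> (\<lambda>x. u x * v x)" if v: "v \<in> fin_energy r \<rho>" "anti v" for v
  proof -
    have vc: "continuous_on K v" by (rule fin_energy_cont[OF v(1)])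
    have "0 \<le> 2 * s * (En r \<rho> u v - l * \<Phi> (\<lambda>x. u x * v x)) + s\<^sup>2 * (En r \<rho> v v - l * \<Phi> (\<lambda>x. (v x)\<^sup>2))" for s
    proof -
      have "\<Phi> (\<lambda>x. (u x + s * v x)\<^sup>2) = \<Phi> (\<lambda>x. (u x)\<^sup>2 + (2 * s * (u x * v x) + s\<^sup>2 * (v x)\<^sup>2))"
        by (rule arg_cong[of _ _ \<Phi>]) (auto simp: power2_eq_square algebra_simps)
      also have "\<dots> = 1 + (2 * s * \<Phi> (\<lambda>x. u x * v x) + s\<^sup>2 * \<Phi> (\<lambda>x. (v x)\<^sup>2))"
        using uc vc by (simp add: meanD(1,2)[OF \<Phi>] continuous_intros u1)
      finally have P: "\<Phi> (\<lambda>x. (u x + s * v x)\<^sup>2) = 1 + (2 * s * \<Phi> (\<lambda>x. u x * v x) + s\<^sup>2 * \<Phi> (\<lambda>x. (v x)\<^sup>2))" .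
      have "l * \<Phi> (\<lambda>x. (u x + s * v x)\<^sup>2) \<le> En r \<rho> (\<lambda>x. u x + s * v x) (\<lambda>x. u x + s * v x)"
        by (intro l_le' fin_energy_add fin_energy_scale anti_add anti_scale m uf ua v)
      then show ?thesis unfolding P En_expand[OF m uf v(1)] Eu by (simp add: algebra_simps)
    qed
    then have "En r \<rho> u v - l * \<Phi> (\<lambda>x. u x * v x) = 0" by (rule quadratic_nonneg_imp_linear_zero)
    then show ?thesis by simp
  qed
  show ?thesis
  proof (rule that[OF uf ua u1])
    \<comment> \<open>A general v is replaced by its projection, which changes neither side.\<close>
    show "En r \<rho> u v = l * \<Phi> (\<lambda>x. u x * v x)" if v: "v \<in> fin_energy r \<rho>" for v
      using EL[OF proj_fin_energy[OF m v] anti_proj] En_proj[OF ua] mean_proj[OF \<Phi> ua uc fin_energy_cont[OF v]] by simp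
    show "l * \<Phi> (\<lambda>x. (t x)\<^sup>2) \<le> En r \<rho> t t" by (rule l_le'[OF t(1,2)])
    have "1 = \<Phi> (\<lambda>x. (u x)\<^sup>2)" using u1 by simp
    also have "\<dots> \<le> \<Phi> (\<lambda>_. 25 * En r \<rho> u u)"
      by (rule meanD(3)[OF \<Phi> sq[OF uf]]) (auto intro: sup_bound[OF m uf ua])
    also have "\<dots> = 25 * l * \<Phi> (\<lambda>_. 1)" unfolding Eu by (rule mean_const[OF \<Phi>])
    finally show "1 \<le> 25 * l * \<Phi> (\<lambda>_. 1)" .
  qed
qed

end

section \<open>Localized eigenfunctions\<close>

text \<open>The quotients \<open>res_delta rs n / r ^ n\<close> are partial products of factors
  whose distances from 1 are summable. The infinite product converges to a nonzero limit, so the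
  quotients are bounded and bounded away from 0.\<close>

lemma res_delta_asymp:
  assumes pos: "\<And>i. 1 \<le> i \<Longrightarrow> 0 < rs i" and r: "0 < r" and s: "summable (\<lambda>i. \<bar>r - rs (Suc i)\<bar>)"
  obtains d1 d2 where "0 < d1" "0 < d2" "\<And>n. d1 * r ^ n \<le> res_delta rs n" "\<And>n. res_delta rs n \<le> d2 * r ^ n"
proof -
  define x where "x i = rs (Suc i) / r" for i
  have xp: "0 < x i" for i using pos r by (simp add: x_def)
  have "\<bar>x i - 1\<bar> = 1 / r * \<bar>r - rs (Suc i)\<bar>" for i
  proof -
    have "x i - 1 = - (1 / r * (r - rs (Suc i)))" using r by (simp add: x_def field_simps)
    then show ?thesis using r by (simp add: abs_mult)
  qed
  then have "summable (\<lambda>i. norm (x i - 1))" using summable_mult[OF s, of "1 / r"] by simp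
  then have c: "convergent_prod x"
    by (intro abs_convergent_prod_imp_convergent_prod summable_imp_abs_convergent_prod)
  define P where "P n = (\<Prod>i<n. x i)" for n
  have Pp: "0 < P n" for n unfolding P_def by (intro prod_pos) (use xp in auto)
  have "(\<lambda>n. P (Suc n)) \<longlonglongrightarrow> prodinf x"
    using convergent_prod_LIMSEQ[OF c] by (simp add: P_def lessThan_Suc_atMost)
  then have Pl: "P \<longlonglongrightarrow> prodinf x" by (rule LIMSEQ_imp_Suc)
  have nz: "prodinf x \<noteq> 0" by (rule prodinf_nonzero[OF c]) (use xp in \<open>metis less_irrefl\<close>)
  from Pl have "Bseq P" by (intro convergent_imp_Bseq) (auto simp: convergent_def)
  then obtain d2 where d2: "0 < d2" "\<And>n. P n \<le> d2" unfolding Bseq_def by (metis abs_le_D1 real_norm_def)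
  from tendsto_inverse[OF Pl nz] have "Bseq (\<lambda>n. inverse (P n))" by (intro convergent_imp_Bseq) (auto simp: convergent_def)
  then obtain d where d: "0 < d" "\<And>n. inverse (P n) \<le> d" unfolding Bseq_def by (metis abs_le_D1 real_norm_def)
  have d1: "1 / d \<le> P n" for n using d(2)[of n] d(1) Pp[of n] by (simp add: field_simps)
  have eq: "res_delta rs n = P n * r ^ n" for n
  proof (induction n)
    case 0 show ?case by (simp add: res_delta_def P_def)
  next
    case (Suc n)
    have "res_delta rs (Suc n) = res_delta rs n * rs (Suc n)" by (simp add: res_delta_def)
    then show ?case using Suc r by (simp add: P_def x_def)
  qed
  show ?thesis
  proof (rule that[of "1 / d" d2])
    show "1 / d * r ^ n \<le> res_delta rs n" "res_delta rs n \<le> d2 * r ^ n" for n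
      unfolding eq using r by (intro mult_right_mono d1 d2; simp)+
  qed (use d d2 in auto)
qed

context ssg begin

section \<open>Both measures under descent into a cell\<close>

lemma cont_mult_K: "continuous_on K f \<Longrightarrow> continuous_on K g \<Longrightarrow> continuous_on K (\<lambda>x. f x * g x :: real)"
  by (rule continuous_on_mult)

lemma cont_W: "continuous_on K v \<Longrightarrow> continuous_on K (v \<circ> W w)"
  by (rule continuous_on_compose[OF W_cont], erule continuous_on_subset) (auto simp: W_K)

text \<open>The weights stay free, since each descent into a cell multiplies them by \<beta> and 1/3
  respectively.\<close>

definition combo :: "(real^2) measure \<Rightarrow> (real^2) measure \<Rightarrow> real \<Rightarrow> real \<Rightarrow> (real^2 \<Rightarrow> real) \<Rightarrow> real" where
  "combo \<mu>l \<mu>f a b f = a * (LINT x|\<mu>l. f x) + b * (LINT x|\<mu>f. f x)"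

lemma combo_mean:
  assumes "is_mu_f \<alpha> p K \<mu>f" "is_mu_l \<alpha> p K \<beta> \<mu>l" "0 < \<beta>" "\<beta> < 1/3" "0 \<le> a" "0 \<le> b"
  shows "mean (combo \<mu>l \<mu>f a b)"
  unfolding combo_def[abs_def] using assms by (intro mean_combination mu_l_mean mu_f_mean)

lemma combo_1:
  assumes "is_mu_f \<alpha> p K \<mu>f" "is_mu_l \<alpha> p K \<beta> \<mu>l"
  shows "combo \<mu>l \<mu>f a b (\<lambda>_. 1) = a + b"
proof -
  have "prob_space \<mu>f" "prob_space \<mu>l" using assms by (auto simp: is_mu_f_def is_mu_l_def borel_prob_on_def)
  then show ?thesis by (simp add: combo_def prob_space.prob_space)
qed

text \<open>Self-similarity of both measures. \<open>T i u\<close> is zero on the other cells and on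
  the first-level edges, so the edge term of mu_l drops out.\<close>

lemma combo_T:
  assumes \<mu>f: "is_mu_f \<alpha> p K \<mu>f" and \<mu>l: "is_mu_l \<alpha> p K \<beta> \<mu>l" and \<beta>: "0 < \<beta>" "\<beta> < 1/3"
    and u: "continuous_on K u" "vanish u" and v: "continuous_on K v"
  shows "combo \<mu>l \<mu>f a b (\<lambda>x. T i u x * v x) = combo \<mu>l \<mu>f (a * \<beta>) (b / 3) (\<lambda>x. u x * (v \<circ> G i) x)"
proof -
  let ?h = "\<lambda>x. T i u x * v x" and ?g = "\<lambda>x. u x * (v \<circ> G i) x"
  have h: "continuous_on K ?h" by (intro cont_mult_K T_cont u v)
  have g: "continuous_on K ?g" by (intro cont_mult_K u_G_cont u v)
  have cell: "\<Phi> (?h \<circ> G j) = (if j = i then \<Phi> ?g else 0)" if \<Phi>: "mean \<Phi>" for \<Phi> j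
  proof (cases "j = i")
    case True
    have "\<Phi> ?g = \<Phi> (?h \<circ> G j)" by (rule mean_cong[OF \<Phi> g]) (simp add: True T_G)
    with True show ?thesis by simp
  next
    case False
    have "\<Phi> (\<lambda>_. 0) = \<Phi> (?h \<circ> G j)" by (rule mean_cong[OF \<Phi>]) (simp_all add: False T_G)
    then show ?thesis using False mean_const[OF \<Phi>, of 0] by simp
  qed
  have s: "(\<Sum>j\<in>UNIV. if j = i then c else 0) = c" for c :: real by simp
  have "(LINT x|\<mu>f. ?h x) = 1/3 * (LINT x|\<mu>f. ?g x)"
    unfolding mu_f_self_similar[OF \<mu>f h] cell[OF mu_f_mean[OF \<mu>f]] s ..
  moreover have "(LINT x|\<mu>l. ?h x) = \<beta> * (LINT x|\<mu>l. ?g x)"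
  proof -
    have "(LINT t|I01. ?h (e j t)) = (LINT t|I01. 0)" for j
      by (rule Bochner_Integration.integral_cong) (auto simp: T_e[OF u(2)] space_restrict_space)
    then show ?thesis
      unfolding mu_l_self_similar[OF \<mu>l \<beta> h] cell[OF mu_l_mean[OF \<mu>l \<beta>]] s by simp
  qed
  ultimately show ?thesis by (simp add: combo_def)
qed

lemma combo_Tw:
  assumes \<mu>f: "is_mu_f \<alpha> p K \<mu>f" and \<mu>l: "is_mu_l \<alpha> p K \<beta> \<mu>l" and \<beta>: "0 < \<beta>" "\<beta> < 1/3"
    and u: "continuous_on K u" "vanish u" and v: "continuous_on K v"
  shows "combo \<mu>l \<mu>f a b (\<lambda>x. Tw w u x * v x) =
    combo \<mu>l \<mu>f (a * \<beta> ^ length w) (b * (1/3) ^ length w) (\<lambda>x. u x * (v \<circ> W w) x)"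
  using v
proof (induction w arbitrary: a b v)
  case Nil then show ?case by simp
next
  case (Cons i w)
  have c: "continuous_on K (Tw w u)" for w by (induction w) (simp_all add: u T_cont)
  have "combo \<mu>l \<mu>f a b (\<lambda>x. Tw (i # w) u x * v x) = combo \<mu>l \<mu>f (a * \<beta>) (b / 3) (\<lambda>x. Tw w u x * (v \<circ> G i) x)"
    unfolding Tw.simps by (rule combo_T[OF \<mu>f \<mu>l \<beta> c Tw_vanish[OF u(2)] Cons.prems])
  also have "\<dots> = combo \<mu>l \<mu>f (a * \<beta> * \<beta> ^ length w) (b / 3 * (1/3) ^ length w) (\<lambda>x. u x * (v \<circ> G i \<circ> W w) x)"
    by (rule Cons.IH[OF u_G_cont[OF Cons.prems]])
  finally show ?case by (simp add: W_Cons o_assoc mult.assoc)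
qed

lemma Tw_cont: "continuous_on K u \<Longrightarrow> continuous_on K (Tw w u)"
  by (induction w) (simp_all add: T_cont)

text \<open>The test function is 1/6 on edge 2 of cell 0. Descending into the cell costs \<beta>,
  the edge has weight 1/3 - \<beta>, and the square of 1/6 is 1/36.\<close>

lemma test_edge_mass:
  assumes \<mu>l: "is_mu_l \<alpha> p K \<beta> \<mu>l" and \<beta>: "0 < \<beta>" "\<beta> < 1/3" and m: "matching r \<rho>"
  shows "\<beta> * (1/3 - \<beta>) / 36 \<le> (LINT x|\<mu>l. (test r x)\<^sup>2)"
proof -
  note me = mu_l_mean[OF \<mu>l \<beta>]
  have bound: "\<beta> * (LINT x|\<mu>l. (f \<circ> G i) x) \<le> (LINT x|\<mu>l. f x) \<and> (1/3 - \<beta>) * (LINT t|I01. f (e i t)) \<le> (LINT x|\<mu>l. f x)"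
    if f: "continuous_on K f" "\<And>x. x \<in> K \<Longrightarrow> 0 \<le> f x" for f i
  proof -
    have n1: "0 \<le> (LINT x|\<mu>l. (f \<circ> G i) x)" for i
      by (rule mean_nonneg[OF me u_G_cont[OF f(1)]]) (simp add: f(2) G_K)
    have n2: "0 \<le> (LINT t|I01. f (e i t))" for i
      by (intro integral_nonneg_AE AE_I2) (auto simp: space_restrict_space intro!: f(2) e_K)
    have "(LINT x|\<mu>l. (f \<circ> G i) x) \<le> (\<Sum>i\<in>UNIV. LINT x|\<mu>l. (f \<circ> G i) x)"
      "(LINT t|I01. f (e i t)) \<le> (\<Sum>i\<in>UNIV. LINT t|I01. f (e i t))"
      by (rule member_le_sum; use n1 n2 in simp)+
    then have "\<beta> * (LINT x|\<mu>l. (f \<circ> G i) x) \<le> \<beta> * (\<Sum>i\<in>UNIV. LINT x|\<mu>l. (f \<circ> G i) x)"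
      "(1/3 - \<beta>) * (LINT t|I01. f (e i t)) \<le> (1/3 - \<beta>) * (\<Sum>i\<in>UNIV. LINT t|I01. f (e i t))"
      using \<beta> by (auto intro!: mult_left_mono)
    moreover have "0 \<le> \<beta> * (\<Sum>i\<in>UNIV. LINT x|\<mu>l. (f \<circ> G i) x)" "0 \<le> (1/3 - \<beta>) * (\<Sum>i\<in>UNIV. LINT t|I01. f (e i t))"
      using \<beta> n1 n2 by (auto intro!: mult_nonneg_nonneg sum_nonneg)
    ultimately show ?thesis unfolding mu_l_self_similar[OF \<mu>l \<beta> f(1)] by linarith
  qed
  let ?f = "\<lambda>x. (test r x)\<^sup>2"
  have c: "continuous_on K ?f" by (intro continuous_intros fin_energy_cont[OF test_energy(1)[OF m]])
  have "(LINT t|I01. (?f \<circ> G 0) (e 2 t)) = (LINT t|I01. 1/36)"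
    by (rule Bochner_Integration.integral_cong) (auto simp: test_value[OF m] space_restrict_space power2_eq_square)
  also have "\<dots> = 1/36" using prob_space.prob_space[OF prob_I01] by simp
  finally have I: "(LINT t|I01. (?f \<circ> G 0) (e 2 t)) = 1/36" .
  have "0 \<le> (?f \<circ> G 0) x" for x by simp
  from conjunct2[OF bound[OF u_G_cont[OF c] this, of 2]]
  have "(1/3 - \<beta>) * (1/36) \<le> (LINT x|\<mu>l. (?f \<circ> G 0) x)" unfolding I .
  then have "\<beta> * ((1/3 - \<beta>) * (1/36)) \<le> \<beta> * (LINT x|\<mu>l. (?f \<circ> G 0) x)" using \<beta> by simp
  also have "\<dots> \<le> (LINT x|\<mu>l. ?f x)" using bound[OF c] by simp
  finally show ?thesis by simp
qed

lemma mu_f_cell: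
  fixes f :: "real^2 \<Rightarrow> real"
  assumes \<mu>f: "is_mu_f \<alpha> p K \<mu>f" and "continuous_on K f" "\<And>x. x \<in> K \<Longrightarrow> 0 \<le> f x"
  shows "(1/3) ^ length w * (LINT x|\<mu>f. (f \<circ> W w) x) \<le> (LINT x|\<mu>f. f x)"
  using assms(2,3)
proof (induction w arbitrary: f)
  case (Cons i w)
  note f = Cons.prems and me = mu_f_mean[OF \<mu>f]
  have "(1/3) ^ length w * (LINT x|\<mu>f. (f \<circ> G i \<circ> W w) x) \<le> (LINT x|\<mu>f. (f \<circ> G i) x)"
    by (rule Cons.IH[OF u_G_cont[OF f(1)]]) (simp add: f(2) G_K)
  also have "\<dots> \<le> (\<Sum>i\<in>UNIV. LINT x|\<mu>f. (f \<circ> G i) x)"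
    by (rule member_le_sum) (auto intro!: mean_nonneg[OF me u_G_cont[OF f(1)]] f(2) G_K simp del: o_apply, simp add: f(2) G_K)
  also have "\<dots> = 3 * (LINT x|\<mu>f. f x)" using mu_f_self_similar[OF \<mu>f f(1)] by simp
  finally show ?case by (simp add: W_Cons o_assoc)
qed simp

text \<open>mu_f does not charge edges, so the value 1/6 must be spread to a whole cell. The energy
  of \<open>test r\<close> is at most 4 / r0^2, so the oscillation bound keeps the function at least
  1/12 on a cell at the end of the edge, of a depth depending on r0 alone.\<close>

lemma test_fractal_mass:
  assumes \<mu>f: "is_mu_f \<alpha> p K \<mu>f" and r0: "0 < r0"
  obtains c where "0 < c" "\<And>r \<rho>. matching r \<rho> \<Longrightarrow> (\<And>i. 1 \<le> i \<Longrightarrow> r0 \<le> r i) \<Longrightarrow> c \<le> (LINT x|\<mu>f. (test r x)\<^sup>2)"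
proof -
  have "(\<lambda>k. 5 * (4/5) ^ k * sqrt (4 / (r0 * r0))) \<longlonglongrightarrow> 5 * 0 * sqrt (4 / (r0 * r0))"
    by (intro tendsto_intros LIMSEQ_power_zero) auto
  then have "\<forall>\<^sub>F k in sequentially. 5 * (4/5) ^ k * sqrt (4 / (r0 * r0)) < 1/12"
    by (intro order_tendstoD(2)) auto
  then obtain k where k: "\<And>j. k \<le> j \<Longrightarrow> 5 * (4/5) ^ j * sqrt (4 / (r0 * r0)) < 1/12" by (auto simp: eventually_sequentially)
  \<comment> \<open>The cell of depth k + 2 whose vertex belonging to p 0 is G 0 (G 1 (p 0)), the
    starting point of the edge in \<open>test_value\<close>.\<close>
  define w :: "3 list" where "w = [0, 1] @ replicate k 0"
  have "W (replicate k 0) (p 0) = p 0" by (induction k) (auto simp: W_Cons G_p)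
  then have wp: "W w (p 0) = G 0 (e 2 0)" by (simp add: w_def W_Cons e_0 three_facts three_numerals)
  show ?thesis
  proof (rule that[of "(1/3) ^ length w * (1/144)"])
    fix r \<rho> assume m: "matching r \<rho>" and r: "\<And>i. 1 \<le> i \<Longrightarrow> r0 \<le> r i"
    note te = test_energy[OF m]
    have "4 / (r 1 * r 2) \<le> 4 / (r0 * r0)"
      using r0 r[of 1] r[of 2] by (intro divide_left_mono mult_mono) (auto intro!: mult_pos_pos)
    then have E: "sqrt (En r \<rho> (test r) (test r)) \<le> sqrt (4 / (r0 * r0))" using te(2) by simp
    have ge: "1/144 \<le> ((\<lambda>x. (test r x)\<^sup>2) \<circ> W w) x" if x: "x \<in> K" for x
    proof -
      have "\<bar>test r (W w x) - test r (W w (p 0))\<bar> \<le> 5 * (4/5) ^ length w * sqrt (En r \<rho> (test r) (test r))"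
        by (rule osc_cell[OF m te(1) x])
      also have "\<dots> \<le> 5 * (4/5) ^ length w * sqrt (4 / (r0 * r0))" using E by (intro mult_left_mono) auto
      also have "\<dots> < 1/12" by (rule k) (simp add: w_def)
      finally have "\<bar>test r (W w x) - 1/6\<bar> < 1/12" unfolding wp using test_value[OF m, of 0] by simp
      then have "1/12 \<le> test r (W w x)" by linarith
      then have "(1/12)\<^sup>2 \<le> (test r (W w x))\<^sup>2" by (rule power_mono) simp
      then show ?thesis by (simp add: power2_eq_square)
    qed
    have c: "continuous_on K (\<lambda>x. (test r x)\<^sup>2)" by (intro continuous_intros fin_energy_cont[OF te(1)])
    have "(LINT x|\<mu>f. 1/144) \<le> (LINT x|\<mu>f. ((\<lambda>x. (test r x)\<^sup>2) \<circ> W w) x)"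
      by (rule meanD(3)[OF mu_f_mean[OF \<mu>f] _ cont_W[OF c]]) (use ge in auto)
    moreover have "(LINT x|\<mu>f. 1/144) = (1/144 :: real)"
      using \<mu>f by (simp add: is_mu_f_def borel_prob_on_def prob_space.prob_space)
    ultimately have "(1/3) ^ length w * (1/144) \<le> (1/3) ^ length w * (LINT x|\<mu>f. ((\<lambda>x. (test r x)\<^sup>2) \<circ> W w) x)"
      by (intro mult_left_mono) auto
    also have "\<dots> \<le> (LINT x|\<mu>f. (test r x)\<^sup>2)" by (rule mu_f_cell[OF \<mu>f c]) simp
    finally show "(1/3) ^ length w * (1/144) \<le> (LINT x|\<mu>f. (test r x)\<^sup>2)" .
  qed simp
qed

text \<open>Removing V_0 leaves the integral of a function that is zero there unchanged, whatever
  mass the vertices have.\<close>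

lemma integral_interior:
  assumes \<mu>f: "is_mu_f \<alpha> p K \<mu>f" and \<mu>l: "is_mu_l \<alpha> p K \<beta> \<mu>l" and \<eta>: "0 < \<eta>" "\<eta> \<le> 1"
    and f: "continuous_on K f"
  defines "M \<equiv> interior_measure p K (mix_measure \<eta> \<mu>l \<mu>f)"
  shows "f \<in> borel_measurable M" "integrable M f" "vanish f \<Longrightarrow> (LINT x|M. f x) = combo \<mu>l \<mu>f \<eta> (1 - \<eta>) f"
proof -
  let ?X = "mix_measure \<eta> \<mu>l \<mu>f"
  have b: "borel_prob_on K \<mu>f" "borel_prob_on K \<mu>l" using \<mu>f \<mu>l by (auto simp: is_mu_f_def is_mu_l_def)
  note Df = borel_prob_onD[OF b(1)] and Dl = borel_prob_onD[OF b(2)]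
  have s: "sets \<mu>l = sets \<mu>f" using Df(2) Dl(2) by simp
  obtain C where C: "\<And>x. x \<in> K \<Longrightarrow> \<bar>f x\<bar> \<le> C" using bounded_on_K[OF f] by metis
  note mix = integral_mix_measure[OF s less_imp_le[OF \<eta>(1)] \<eta>(2) prob_space.finite_measure[OF Dl(1)] prob_space.finite_measure[OF Df(1)] Dl(4)[OF f], of C]
  have mi: "(LINT x|?X. f x) = combo \<mu>l \<mu>f \<eta> (1 - \<eta>) f" "integrable ?X f"
    using mix C Dl(3) by (auto simp: combo_def)
  have A: "K - range p \<in> sets ?X"
  proof -
    have "closed (range p)" by (rule finite_imp_closed) simp
    then show ?thesis using Dl(6)[of "K - range p"] K_closed by (simp add: borel_closed sets.Diff)
  qed
  have Asp: "(K - range p) \<inter> space ?X \<in> sets ?X" using A Dl(3) by (simp add: Int_absorb2)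
  show fm: "f \<in> borel_measurable M"
    unfolding M_def interior_measure_def by (rule measurable_restrict_space1[OF borel_measurable_integrable[OF mi(2)]])
  show "integrable M f"
    unfolding M_def interior_measure_def integrable_restrict_space[OF Asp]
    using integrable_mult_indicator[OF A mi(2)] .
  assume v: "vanish f"
  have "(LINT x|M. f x) = (LINT x|?X. indicator (K - range p) x *\<^sub>R f x)"
    unfolding M_def interior_measure_def by (rule integral_restrict_space[OF Asp])
  also have "\<dots> = (LINT x|?X. f x)"
    by (rule Bochner_Integration.integral_cong) (use v Dl(3) in \<open>auto simp: indicator_def vanish_def\<close>)
  finally show "(LINT x|M. f x) = combo \<mu>l \<mu>f \<eta> (1 - \<eta>) f" using mi(1) by simp
qed

section \<open>Eigenfunctions of level n\<close>

lemma domain0_eq: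
  "matching r \<rho> \<Longrightarrow> energy_domain0 \<alpha> p K r \<rho> = {u \<in> fin_energy r \<rho>. vanish u}"
  by (simp add: energy_domain0_def energy_domain_eq vanish_def)

text \<open>Energy and measure of a transplanted function scale by 1 / \<delta>_n and by the weights
  of \<open>combo\<close>, which turns the equation for u on K into the one for
  \<open>Tw w u\<close>, with the same eigenvalue for all words of length n. Independence comes from
  the disjointness of the cells.\<close>

lemma localized_eigenfunctions:
  fixes n :: nat
  assumes m: "matching r \<rho>" and \<mu>f: "is_mu_f \<alpha> p K \<mu>f" and \<mu>l: "is_mu_l \<alpha> p K \<beta> \<mu>l" and \<beta>: "0 < \<beta>" "\<beta> < 1/3"
    and \<eta>: "0 < \<eta>" "\<eta> \<le> 1"
    and u: "u \<in> fin_energy (shift n r) (shift n \<rho>)" "vanish u"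
    and u1: "combo \<mu>l \<mu>f (\<eta> * \<beta> ^ n) ((1 - \<eta>) * (1/3) ^ n) (\<lambda>x. (u x)\<^sup>2) = 1"
    and El: "\<And>v. v \<in> fin_energy (shift n r) (shift n \<rho>) \<Longrightarrow>
      En (shift n r) (shift n \<rho>) u v = l * combo \<mu>l \<mu>f (\<eta> * \<beta> ^ n) ((1 - \<eta>) * (1/3) ^ n) (\<lambda>x. u x * v x)"
  defines "M \<equiv> interior_measure p K (mix_measure \<eta> \<mu>l \<mu>f)"
  defines "A \<equiv> neg_dirichlet_laplacian \<alpha> p K r \<rho> (mix_measure \<eta> \<mu>l \<mu>f)"
  shows "is_eigenvalue M A (l / res_delta r n)" "enat (3 ^ n) \<le> multiplicity_in M A (l / res_delta r n)"
proof -
  let ?\<nu> = "l / res_delta r n"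
  let ?\<Phi> = "combo \<mu>l \<mu>f \<eta> (1 - \<eta>)"
  let ?\<Phi>n = "combo \<mu>l \<mu>f (\<eta> * \<beta> ^ n) ((1 - \<eta>) * (1/3) ^ n)"
  have \<Phi>n: "mean ?\<Phi>n" by (rule combo_mean[OF \<mu>f \<mu>l \<beta>]) (use \<eta> \<beta> in auto)
  note int = integral_interior[OF \<mu>f \<mu>l \<eta>, folded M_def]
  have uc: "continuous_on K u" by (rule fin_energy_cont[OF u(1)])
  have fT: "Tw w u \<in> fin_energy r \<rho>" if "length w = n" for w
    by (rule Tw_fin_energy[OF m _ u(2)]) (use u(1) that in simp)
  have vT: "vanish (Tw w u)" for w by (rule Tw_vanish[OF u(2)])
  note cT = Tw_cont[OF uc]
  have \<Phi>T: "?\<Phi> (\<lambda>x. Tw w u x * v x) = ?\<Phi>n (\<lambda>x. u x * (v \<circ> W w) x)" if "length w = n" "continuous_on K v" for w v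
    using combo_Tw[OF \<mu>f \<mu>l \<beta> uc u(2) that(2), of \<eta> "1 - \<eta>" w] that(1) by simp
  have eig: "Tw w u \<in> eigenspace A ?\<nu>" if w: "length w = n" for w
  proof -
    have "energy_form \<alpha> p r \<rho> (Tw w u) v = (LINT x|M. ?\<nu> * Tw w u x * v x)"
      if v: "v \<in> fin_energy r \<rho>" "vanish v" for v
    proof -
      have vc: "continuous_on K v" by (rule fin_energy_cont[OF v(1)])
      have vW: "v \<circ> W w \<in> fin_energy (shift n r) (shift n \<rho>)" using fin_energy_W[OF m v(1), of w] w by simp
      have "energy_form \<alpha> p r \<rho> (Tw w u) v = En r \<rho> (Tw w u) v" by (rule energy_form_eq[OF m fT[OF w] v(1)])
      also have "\<dots> = 1 / res_delta r n * En (shift n r) (shift n \<rho>) u (v \<circ> W w)"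
        using En_Tw[OF m _ u(2) v(1), of w] u(1) w by simp
      also have "\<dots> = ?\<nu> * ?\<Phi> (\<lambda>x. Tw w u x * v x)"
        unfolding El[OF vW] \<Phi>T[OF w vc] by simp
      also have "?\<Phi> (\<lambda>x. Tw w u x * v x) = (LINT x|M. Tw w u x * v x)"
        by (rule int(3)[symmetric, OF cont_mult_K[OF cT vc]]) (use v(2) in \<open>simp add: vanish_def\<close>)
      finally show ?thesis by (simp add: mult.assoc)
    qed
    moreover have L2: "(\<lambda>x. c * Tw w u x) \<in> L2 M" for c
    proof -
      have "continuous_on K (\<lambda>x. c * Tw w u x)" by (intro continuous_intros cT)
      then show ?thesis unfolding L2_def using int(1) int(2)[OF continuous_on_power] by blast
    qed
    moreover from this[of 1] have "Tw w u \<in> L2 M" by simp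
    ultimately show ?thesis
      unfolding eigenspace_def A_def neg_dirichlet_laplacian_def form_operator_def M_def[symmetric]
      using fT[OF w] vT L2[of ?\<nu>] by (simp add: domain0_eq[OF m])
  qed
  have ind: "c j = 0" if h: "bij_betw h {..<3 ^ n} {w :: 3 list. length w = n}"
    and ae: "AE x in M. (\<Sum>i<3 ^ n. c i * Tw (h i) u x) = 0" and j: "j < 3 ^ n" for c j and h :: "nat \<Rightarrow> 3 list"
  proof -
    have hl: "length (h i) = n" if "i < 3 ^ n" for i using h that by (auto simp: bij_betw_def)
    have hi: "h i = h j \<longleftrightarrow> i = j" if "i < 3 ^ n" for i using h that j by (auto simp: bij_betw_def inj_on_def)
    define v where "v x = (\<Sum>i<3 ^ n. c i * Tw (h i) u x)" for x
    have vc: "continuous_on K v" unfolding v_def[abs_def] by (intro continuous_intros cT)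
    \<comment> \<open>Pairing the relation with \<open>Tw (h j) u\<close> isolates c j: in the cell
      of \<open>h j\<close> no other summand is nonzero, and u has norm 1.\<close>
    have "(LINT x|M. Tw (h j) u x * v x) = 0"
      by (rule integral_eq_zero_AE) (use ae in \<open>auto simp: v_def elim: eventually_mono\<close>)
    then have "?\<Phi> (\<lambda>x. Tw (h j) u x * v x) = 0"
      using int(3)[OF cont_mult_K[OF cT vc], of "h j"] vT[of "h j"] by (simp add: vanish_def)
    then have z: "?\<Phi>n (\<lambda>x. u x * (v \<circ> W (h j)) x) = 0" using \<Phi>T[OF hl[OF j] vc] by simp
    have "?\<Phi>n (\<lambda>x. u x * (v \<circ> W (h j)) x) = ?\<Phi>n (\<lambda>x. c j * (u x)\<^sup>2)"
    proof (rule mean_cong[OF \<Phi>n cont_mult_K[OF uc cont_W[OF vc]]])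
      fix x assume x: "x \<in> K"
      have "v (W (h j) x) = (\<Sum>i<3 ^ n. if i = j then c j * u x else 0)"
        unfolding v_def by (rule sum.cong[OF refl]) (use Tw_W[OF x, of "h _" "h j" u] hl hi j in auto)
      also have "\<dots> = c j * u x" using j by simp
      finally show "u x * (v \<circ> W (h j)) x = c j * (u x)\<^sup>2" by (simp add: power2_eq_square)
    qed
    also have "\<dots> = c j" using meanD(2)[OF \<Phi>n continuous_on_power[OF uc], of "c j" 2] u1 by simp
    finally show ?thesis using z by simp
  qed
  obtain h :: "nat \<Rightarrow> 3 list" where h: "bij_betw h {0..<3 ^ n} {w. length w = n}"
    using ex_bij_betw_nat_finite[OF finite_words[of n]] unfolding card_words by blast
  then have h: "bij_betw h {..<3 ^ n} {w :: 3 list. length w = n}" by (simp add: atLeast0LessThan)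
  have he: "Tw (h i) u \<in> eigenspace A ?\<nu>" if "i < 3 ^ n" for i
    using h that by (intro eig) (auto simp: bij_betw_def)
  have L: "L2_independent M (3 ^ n) (\<lambda>i. Tw (h i) u)"
    unfolding L2_independent_def using ind[OF h] by blast
  show "is_eigenvalue M A ?\<nu>"
    unfolding is_eigenvalue_def
  proof (intro bexI[OF _ he[of 0]] notI)
    assume "AE x in M. Tw (h 0) u x = 0"
    \<comment> \<open>If this eigenfunction were zero, it would be a linear relation with
      coefficient 1 at index 0.\<close>
    then have "AE x in M. (\<Sum>i<3 ^ n. (if i = 0 then 1 else 0) * Tw (h i) u x) = 0"
      by eventually_elim (rule sum.neutral, auto)
    from ind[OF h this, of 0] show False by simp
  qed simp
  show "enat (3 ^ n) \<le> multiplicity_in M A ?\<nu>"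
    unfolding multiplicity_in_def
    by (rule Sup_upper, intro CollectI exI[of _ "3 ^ n"] exI[of _ "\<lambda>i. Tw (h i) u"] conjI refl allI impI he L)
qed

text \<open>b is the rate at which mass decays: \<open>b ^ n\<close> bounds the total mass from
  above and, up to c, the squared norm of the test function from below. The lower bound on l then
  rests on the supremum constant 25, the upper one on the energy bound 4 / r0^2 of the test
  function.\<close>

lemma level_eigenvalue:
  fixes n :: nat
  assumes m: "matching r \<rho>" and \<mu>f: "is_mu_f \<alpha> p K \<mu>f" and \<mu>l: "is_mu_l \<alpha> p K \<beta> \<mu>l" and \<beta>: "0 < \<beta>" "\<beta> < 1/3"
    and \<eta>: "0 < \<eta>" "\<eta> \<le> 1"
    and r0: "0 < r0" "\<And>i. 1 \<le> i \<Longrightarrow> r0 \<le> r i"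
    and b: "0 < b" and mass: "\<eta> * \<beta> ^ n + (1 - \<eta>) * (1/3) ^ n \<le> b ^ n"
    and c: "0 < c" "c * b ^ n \<le> combo \<mu>l \<mu>f (\<eta> * \<beta> ^ n) ((1 - \<eta>) * (1/3) ^ n) (\<lambda>x. (test (shift n r) x)\<^sup>2)"
  shows "\<exists>l. 1 / (25 * b ^ n) \<le> l \<and> l \<le> 4 / (r0 * r0 * c * b ^ n) \<and>
    is_eigenvalue (interior_measure p K (mix_measure \<eta> \<mu>l \<mu>f)) (neg_dirichlet_laplacian \<alpha> p K r \<rho> (mix_measure \<eta> \<mu>l \<mu>f)) (l / res_delta r n) \<and>
    enat (3 ^ n) \<le> multiplicity_in (interior_measure p K (mix_measure \<eta> \<mu>l \<mu>f)) (neg_dirichlet_laplacian \<alpha> p K r \<rho> (mix_measure \<eta> \<mu>l \<mu>f)) (l / res_delta r n)"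
proof -
  let ?r = "shift n r" and ?\<rho> = "shift n \<rho>"
  let ?\<Phi> = "combo \<mu>l \<mu>f (\<eta> * \<beta> ^ n) ((1 - \<eta>) * (1/3) ^ n)"
  note m' = matching_shift_n[OF m, of n]
  note te = test_energy[OF m']
  have \<Phi>: "mean ?\<Phi>" by (rule combo_mean[OF \<mu>f \<mu>l \<beta>]) (use \<eta> \<beta> in auto)
  have bn: "0 < b ^ n" using b by simp
  have cb: "0 < c * b ^ n" using c(1) bn by simp
  have tp: "0 < ?\<Phi> (\<lambda>x. (test ?r x)\<^sup>2)" using c(2) cb by linarith
  obtain u l where u: "u \<in> fin_energy ?r ?\<rho>" "anti u" "?\<Phi> (\<lambda>x. (u x)\<^sup>2) = 1"
    "\<And>v. v \<in> fin_energy ?r ?\<rho> \<Longrightarrow> En ?r ?\<rho> u v = l * ?\<Phi> (\<lambda>x. u x * v x)"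
    "l * ?\<Phi> (\<lambda>x. (test ?r x)\<^sup>2) \<le> En ?r ?\<rho> (test ?r) (test ?r)" "1 \<le> 25 * l * ?\<Phi> (\<lambda>_. 1)"
    by (rule minimizer[OF m' \<Phi> te(1,3) tp]) blast
  have P1: "0 \<le> ?\<Phi> (\<lambda>_. 1)" "?\<Phi> (\<lambda>_. 1) \<le> b ^ n"
    using mass \<eta> \<beta> unfolding combo_1[OF \<mu>f \<mu>l] by auto
  have lp: "0 < l"
  proof (rule ccontr)
    assume "\<not> 0 < l"
    then have "25 * l * ?\<Phi> (\<lambda>_. 1) \<le> 0" using P1(1) by (intro mult_nonpos_nonneg[of "25 * l"]) auto
    with u(6) show False by linarith
  qed
  have "1 \<le> 25 * l * b ^ n" using u(6) mult_left_mono[OF P1(2), of "25 * l"] lp by linarith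
  then have lo: "1 / (25 * b ^ n) \<le> l" using bn by (simp add: field_simps)
  have "r0 \<le> ?r 1" "r0 \<le> ?r 2" using r0(2)[of "1 + n"] r0(2)[of "2 + n"] by (auto simp: shift_def)
  then have "4 / (?r 1 * ?r 2) \<le> 4 / (r0 * r0)"
    using r0(1) by (intro divide_left_mono mult_mono) (auto intro!: mult_pos_pos)
  then have "l * ?\<Phi> (\<lambda>x. (test ?r x)\<^sup>2) \<le> 4 / (r0 * r0)" using u(5) te(2) by linarith
  then have "l * (c * b ^ n) \<le> 4 / (r0 * r0)" using mult_left_mono[OF c(2), of l] lp by linarith
  then have hi: "l \<le> 4 / (r0 * r0 * c * b ^ n)"
    using cb c(1) bn r0(1) by (simp add: field_simps)
  show ?thesis
    using lo hi localized_eigenfunctions[OF m \<mu>f \<mu>l \<beta> \<eta> u(1) anti_vanish[OF u(2)] u(3,4)] by blast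
qed

end

theorem mainTheorem3:
  fixes \<alpha> \<beta> \<eta> r :: real
    and p :: "3 \<Rightarrow> real^2"
    and K :: "(real^2) set"
    and rs \<rho>s :: "nat \<Rightarrow> real"
    and \<mu>f \<mu>l :: "(real^2) measure"
  assumes "0 < \<alpha>" and "\<alpha> < 1"
    and "equilateral p"
    and "is_stretched_gasket \<alpha> p K"
    and "\<And>i. i \<ge> 1 \<Longrightarrow> matching_pair (rs i) (\<rho>s i)"
    and "1/3 \<le> r" and "r \<le> 3/5"
    and "summable (\<lambda>i. \<bar>r - rs (Suc i)\<bar>)"
    and "0 < \<beta>" and "\<beta> < 1/3"
    and "0 < \<eta>" and "\<eta> \<le> 1"
    and "is_mu_f \<alpha> p K \<mu>f"
    and "is_mu_l \<alpha> p K \<beta> \<mu>l"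
  defines "\<mu> \<equiv> mix_measure \<eta> \<mu>l \<mu>f"
  defines "M \<equiv> interior_measure p K \<mu>"
  defines "A \<equiv> neg_dirichlet_laplacian \<alpha> p K rs \<rho>s \<mu>"
  shows "\<exists>c1 c2 :: real. \<exists>\<nu> :: nat \<Rightarrow> real. 0 < c1 \<and> 0 < c2 \<and>
    (\<forall>n\<ge>1. is_eigenvalue M A (\<nu> n) \<and> enat (3 ^ n) \<le> multiplicity_in M A (\<nu> n) \<and>
      (\<eta> < 1 \<longrightarrow> c1 * (3 / r) ^ n \<le> \<nu> n \<and> \<nu> n \<le> c2 * (3 / r) ^ n) \<and>
      (\<eta> = 1 \<longrightarrow> c1 * (\<beta> * r) powi (- int n) \<le> \<nu> n \<and> \<nu> n \<le> c2 * (\<beta> * r) powi (- int n)))"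
proof -
  interpret ssg \<alpha> p K by unfold_locales (use assms in auto)
  have m: "matching rs \<rho>s" using assms(5) by (simp add: matching_def)
  note pos = matching_pos(1)[OF m]
  have r: "0 < r" using assms(6) by simp
  obtain d1 d2 where d: "0 < d1" "0 < d2" "\<And>n. d1 * r ^ n \<le> res_delta rs n" "\<And>n. res_delta rs n \<le> d2 * r ^ n"
    using res_delta_asymp[OF pos r assms(8)] by blast
  \<comment> \<open>The resistances are positive and converge to r > 0, so their inverses are
    bounded.\<close>
  obtain r0 where r0: "0 < r0" "\<And>i. 1 \<le> i \<Longrightarrow> r0 \<le> rs i"
  proof -
    have "(\<lambda>i. r - rs (Suc i)) \<longlonglongrightarrow> 0"
      using summable_LIMSEQ_zero[OF assms(8)] by (simp add: tendsto_rabs_zero_iff)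
    then have "(\<lambda>i. r - (r - rs (Suc i))) \<longlonglongrightarrow> r - 0" by (intro tendsto_intros)
    then have lim: "(\<lambda>i. rs (Suc i)) \<longlonglongrightarrow> r" by simp
    have "(\<lambda>i. inverse (rs (Suc i))) \<longlonglongrightarrow> inverse r" by (rule tendsto_inverse[OF lim]) (use r in simp)
    then have "Bseq (\<lambda>i. inverse (rs (Suc i)))" by (intro convergent_imp_Bseq) (auto simp: convergent_def)
    then obtain C where C: "0 < C" "\<And>i. norm (inverse (rs (Suc i))) \<le> C" unfolding Bseq_def by blast
    have "1 / C \<le> rs i" if "1 \<le> i" for i
      using C(1) C(2)[of "i - 1"] pos[OF that] that by (simp add: field_simps)
    with C(1) show ?thesis by (intro that[of "1 / C"]) auto
  qed
  note \<beta> = assms(9,10) and \<eta> = assms(11,12) and \<mu>f = assms(13) and \<mu>l = assms(14)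
  obtain cf where cf: "0 < cf" "\<And>r \<rho>. matching r \<rho> \<Longrightarrow> (\<And>i. 1 \<le> i \<Longrightarrow> r0 \<le> r i) \<Longrightarrow> cf \<le> (LINT x|\<mu>f. (test r x)\<^sup>2)"
    using test_fractal_mass[OF \<mu>f r0(1)] by blast
  \<comment> \<open>The dominant mass ratio: 1/3 exceeds \<beta>, so mu_f governs as soon as it is
    present, and then its share of the norm of the test function alone gives c. For \<eta> = 1 the
    edges have to supply both.\<close>
  define b where "b = (if \<eta> < 1 then 1/3 else \<beta>)"
  define c where "c = (if \<eta> < 1 then (1 - \<eta>) * cf else \<beta> * (1/3 - \<beta>) / 36)"
  have b: "0 < b" and c: "0 < c" using \<beta> cf(1) by (auto simp: b_def c_def)
  have mass: "\<eta> * \<beta> ^ n + (1 - \<eta>) * (1/3) ^ n \<le> b ^ n" for n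
  proof (cases "\<eta> < 1")
    case True
    have "\<beta> ^ n \<le> (1/3) ^ n" using \<beta> by (intro power_mono) auto
    then have "\<eta> * \<beta> ^ n \<le> \<eta> * (1/3) ^ n" using \<eta> by (intro mult_left_mono) auto
    then show ?thesis using True by (simp add: b_def left_diff_distrib)
  next
    case False
    then show ?thesis using \<eta> by (simp add: b_def)
  qed
  have low: "c * b ^ n \<le> combo \<mu>l \<mu>f (\<eta> * \<beta> ^ n) ((1 - \<eta>) * (1/3) ^ n) (\<lambda>x. (test (shift n rs) x)\<^sup>2)" for n
  proof -
    note m' = matching_shift_n[OF m, of n]
    have F: "cf \<le> (LINT x|\<mu>f. (test (shift n rs) x)\<^sup>2)" by (rule cf(2)[OF m']) (use r0(2) in \<open>simp add: shift_def\<close>)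
    have L: "\<beta> * (1/3 - \<beta>) / 36 \<le> (LINT x|\<mu>l. (test (shift n rs) x)\<^sup>2)" by (rule test_edge_mass[OF \<mu>l \<beta> m'])
    show ?thesis
    proof (cases "\<eta> < 1")
      case True
      have "0 \<le> (LINT x|\<mu>l. (test (shift n rs) x)\<^sup>2)" by (intro integral_nonneg_AE AE_I2) simp
      then have "0 \<le> \<eta> * \<beta> ^ n * (LINT x|\<mu>l. (test (shift n rs) x)\<^sup>2)" using \<eta> \<beta> by simp
      moreover have "(1 - \<eta>) * (1/3) ^ n * cf \<le> (1 - \<eta>) * (1/3) ^ n * (LINT x|\<mu>f. (test (shift n rs) x)\<^sup>2)"
        using True F by (intro mult_left_mono) auto
      moreover have "c * b ^ n = (1 - \<eta>) * (1/3) ^ n * cf" using True by (simp add: b_def c_def)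
      ultimately show ?thesis unfolding combo_def by linarith
    next
      case False
      then have e1: "\<eta> = 1" using \<eta> by simp
      have "\<beta> ^ n * (\<beta> * (1/3 - \<beta>) / 36) \<le> \<beta> ^ n * (LINT x|\<mu>l. (test (shift n rs) x)\<^sup>2)"
        using L \<beta> by (intro mult_left_mono) auto
      then show ?thesis by (simp add: combo_def b_def c_def e1 mult_ac)
    qed
  qed
  have ex: "\<exists>l. 1 / (25 * b ^ n) \<le> l \<and> l \<le> 4 / (r0 * r0 * c * b ^ n) \<and>
    is_eigenvalue M A (l / res_delta rs n) \<and> enat (3 ^ n) \<le> multiplicity_in M A (l / res_delta rs n)" for n
    unfolding M_def A_def \<mu>_def by (rule level_eigenvalue[OF m \<mu>f \<mu>l \<beta> \<eta> r0 b mass c low])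
  obtain l where l: "\<And>n. 1 / (25 * b ^ n) \<le> l n" "\<And>n. l n \<le> 4 / (r0 * r0 * c * b ^ n)"
    "\<And>n. is_eigenvalue M A (l n / res_delta rs n)" "\<And>n. enat (3 ^ n) \<le> multiplicity_in M A (l n / res_delta rs n)"
    using ex by metis
  define \<nu> where "\<nu> n = l n / res_delta rs n" for n
  define c1 where "c1 = 1 / (25 * d2)"
  define c2 where "c2 = 4 / (r0 * r0 * c * d1)"
  have c12: "0 < c1" "0 < c2" using d r0 c by (auto simp: c1_def c2_def)
  have dp: "0 < res_delta rs n" for n by (rule res_delta_pos[OF m])
  have lo: "c1 * inverse ((b * r) ^ n) \<le> \<nu> n" for n
  proof -
    have "c1 * inverse ((b * r) ^ n) = 1 / (25 * b ^ n) / (d2 * r ^ n)"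
      by (simp add: c1_def power_mult_distrib field_simps)
    also have "\<dots> \<le> l n / res_delta rs n"
      using l(1)[of n] d(4)[of n] dp[of n] b by (intro frac_le) (auto intro: order_trans[OF _ l(1)])
    finally show ?thesis by (simp add: \<nu>_def)
  qed
  have hi: "\<nu> n \<le> c2 * inverse ((b * r) ^ n)" for n
  proof -
    have "l n / res_delta rs n \<le> 4 / (r0 * r0 * c * b ^ n) / (d1 * r ^ n)"
      using l(2)[of n] d(1) d(3)[of n] r r0(1) c b by (intro frac_le) auto
    also have "\<dots> = c2 * inverse ((b * r) ^ n)"
      by (simp add: c2_def power_mult_distrib field_simps)
    finally show ?thesis by (simp add: \<nu>_def)
  qed
  have p1: "inverse ((b * r) ^ n) = (3 / r) ^ n" if "\<eta> < 1" for n
    using that by (simp add: b_def power_mult_distrib power_divide field_simps)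
  have p2: "inverse ((b * r) ^ n) = (\<beta> * r) powi (- int n)" if "\<eta> = 1" for n
    using that by (simp add: b_def power_int_minus)
  show ?thesis
    using c12 l(3,4) lo hi p1 p2 unfolding \<nu>_def[symmetric]
    by (intro exI[of _ c1] exI[of _ c2] exI[of _ \<nu>]) (metis \<nu>_def)
qed

end
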